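(* For every $k \geq 3$, the problems $k$-MHE and $k$-MHV can be solved in time $O^*(2^{n'})$. When $k = 3$, they can be solved in time $O^*(1.89^{n'})$. Here $n'$ is the number of uncolored (non-precolored) vertices of the input graph.
   Context: Let $G=(V,E)$ be a simple undirected graph and $k$ a positive integer. A partial $k$-coloring is a map $c : S \to [k]$ for some $S \subseteq V$ (the precolored vertices; vertices of $V \setminus S$ are uncolored); a full coloring $c' : V \to [k]$ is an extended full coloring of $c$ if $c'(v)=c(v)$ for all $v \in S$. Under a full coloring, an edge is happy if its endpoints have the same color, and a vertex is happy if it and all its neighbors have the same color. $k$-MHE ($k$ fixed): given $G$, $c : S \subseteq V \to [k]$ and an integer $\ell$, decide whether some extended full coloring of $c$ makes at least $\ell$ edges happy. $k$-MHV: the same with at least $\ell$ happy vertices. The notation $f(n) = O^*(g(n))$ means $f(n) = O(g(n)\,\mathrm{poly}(n))$, with $n$ the number of vertices. *)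

theory Defs
  imports
    Complex_Main
    "HOL-Library.Landau_Symbols"
    "HOL-Library.Log_Nat"
    "HOL-Computational_Algebra.Polynomial"
begin

section \<open>Graphs, precolorings and happiness\<close>

text \<open>Edges are two-element sets of vertices; a partial coloring is a finite map whose domain
  is the set of precolored vertices. Values of a full coloring outside \<open>V\<close> are irrelevant.\<close>

definition simple_graph :: "'a set \<Rightarrow> 'a set set \<Rightarrow> bool" where
  "simple_graph V E \<longleftrightarrow>
     finite V \<and> (\<forall>e\<in>E. \<exists>u v. e = {u, v} \<and> u \<in> V \<and> v \<in> V \<and> u \<noteq> v)"

definition partial_coloring :: "nat \<Rightarrow> 'a set \<Rightarrow> ('a \<rightharpoonup> nat) \<Rightarrow> bool" where
  "partial_coloring k V c \<longleftrightarrow> dom c \<subseteq> V \<and> ran c \<subseteq> {1..k}"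

definition extended_full_coloring ::
  "nat \<Rightarrow> 'a set \<Rightarrow> ('a \<rightharpoonup> nat) \<Rightarrow> ('a \<Rightarrow> nat) \<Rightarrow> bool" where
  "extended_full_coloring k V c c' \<longleftrightarrow>
     (\<forall>v\<in>V. c' v \<in> {1..k}) \<and> (\<forall>v\<in>dom c. c v = Some (c' v))"

definition happy_edges :: "'a set set \<Rightarrow> ('a \<Rightarrow> nat) \<Rightarrow> 'a set set" where
  "happy_edges E c' = {e \<in> E. \<forall>u\<in>e. \<forall>v\<in>e. c' u = c' v}"

definition happy_vertices :: "'a set \<Rightarrow> 'a set set \<Rightarrow> ('a \<Rightarrow> nat) \<Rightarrow> 'a set" where
  "happy_vertices V E c' = {v \<in> V. \<forall>u\<in>V. {u, v} \<in> E \<longrightarrow> c' u = c' v}"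

section \<open>Instances and the two decision problems\<close>

text \<open>Inputs are graphs on the vertex set \<open>{..<n}\<close>.\<close>

record hc_inst =
  size_of :: nat
  edges_of :: "nat set set"
  precol_of :: "nat \<rightharpoonup> nat"
  target_of :: int

definition hc_instances :: "nat \<Rightarrow> hc_inst set" where
  "hc_instances k =
     {I. simple_graph {..<size_of I} (edges_of I) \<and>
         partial_coloring k {..<size_of I} (precol_of I)}"

definition MHE :: "nat \<Rightarrow> hc_inst \<Rightarrow> bool" where
  "MHE k I \<longleftrightarrow>
     (\<exists>c'. extended_full_coloring k {..<size_of I} (precol_of I) c' \<and>
           int (card (happy_edges (edges_of I) c')) \<ge> target_of I)"

definition MHV :: "nat \<Rightarrow> hc_inst \<Rightarrow> bool" where
  "MHV k I \<longleftrightarrow>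
     (\<exists>c'. extended_full_coloring k {..<size_of I} (precol_of I) c' \<and>
           int (card (happy_vertices {..<size_of I} (edges_of I) c')) \<ge> target_of I)"

definition uncolored :: "hc_inst \<Rightarrow> nat" where
  "uncolored I = card ({..<size_of I} - dom (precol_of I))"

text \<open>The input word consists of \<open>n\<close>, the adjacency matrix row by row, the precoloring
  (\<open>0\<close> for an uncolored vertex), the sign of the target, and the binary digits of its absolute
  value, most significant first, closed by the end marker \<open>2\<close>. The target is written digit by
  digit because running times are measured in \<open>n\<close> only: a program need not read a target
  that has too many digits to be attainable.\<close>

definition encode :: "hc_inst \<Rightarrow> nat list" where
  "encode I =
     [size_of I] @
     concat (map (\<lambda>u. map (\<lambda>v. of_bool ({u, v} \<in> edges_of I)) [0..<size_of I]) [0..<size_of I]) @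
     map (\<lambda>v. case precol_of I v of None \<Rightarrow> 0 | Some i \<Rightarrow> i) [0..<size_of I] @
     [of_bool (target_of I < 0)] @
     (let m = nat \<bar>target_of I\<bar> in map (\<lambda>i. of_bool (bit m i)) (rev [0..<floorlog 2 m])) @
     [2]"

section \<open>Random access machines with logarithmic cost\<close>

text \<open>Programs are structured RAM programs over finitely many arrays of natural numbers; scalar
  variables are arrays used at index 0 only. The cost is logarithmic: every operation is charged
  according to the binary lengths of the numbers and addresses it handles, with schoolbook cost
  for multiplication and division. Unit cost would not do, since then arithmetic on exponentially
  long numbers would be free.\<close>

type_synonym vname = string
type_synonym state = "vname \<Rightarrow> nat \<Rightarrow> nat"

datatype aexp =
    Const nat
  | Get vname aexp
  | Add aexp aexp
  | Sub aexp aexp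
  | Mul aexp aexp
  | Quot aexp aexp
  | Rem aexp aexp

datatype bexp =
    Less aexp aexp
  | Equal aexp aexp
  | Neg bexp
  | Conj bexp bexp

datatype com =
    Skip
  | Assign vname aexp aexp
  | Seq com com
  | If bexp com com
  | While bexp com

definition len :: "nat \<Rightarrow> nat" where
  "len m = floorlog 2 m + 1"

fun aval :: "aexp \<Rightarrow> state \<Rightarrow> nat" where
  "aval (Const m) s = m"
| "aval (Get x a) s = s x (aval a s)"
| "aval (Add a b) s = aval a s + aval b s"
| "aval (Sub a b) s = aval a s - aval b s"
| "aval (Mul a b) s = aval a s * aval b s"
| "aval (Quot a b) s = aval a s div aval b s"
| "aval (Rem a b) s = aval a s mod aval b s"

fun acost :: "aexp \<Rightarrow> state \<Rightarrow> nat" where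
  "acost (Const m) s = len m"
| "acost (Get x a) s = acost a s + len (aval a s) + len (s x (aval a s))"
| "acost (Add a b) s = acost a s + acost b s + len (aval a s) + len (aval b s)"
| "acost (Sub a b) s = acost a s + acost b s + len (aval a s) + len (aval b s)"
| "acost (Mul a b) s = acost a s + acost b s + len (aval a s) * len (aval b s)"
| "acost (Quot a b) s = acost a s + acost b s + len (aval a s) * len (aval b s)"
| "acost (Rem a b) s = acost a s + acost b s + len (aval a s) * len (aval b s)"

fun bval :: "bexp \<Rightarrow> state \<Rightarrow> bool" where
  "bval (Less a b) s = (aval a s < aval b s)"
| "bval (Equal a b) s = (aval a s = aval b s)"
| "bval (Neg b) s = (\<not> bval b s)"
| "bval (Conj b b') s = (bval b s \<and> bval b' s)"

fun bcost :: "bexp \<Rightarrow> state \<Rightarrow> nat" where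
  "bcost (Less a b) s = acost a s + acost b s + len (aval a s) + len (aval b s)"
| "bcost (Equal a b) s = acost a s + acost b s + len (aval a s) + len (aval b s)"
| "bcost (Neg b) s = bcost b s + 1"
| "bcost (Conj b b') s = bcost b s + bcost b' s + 1"

text \<open>\<open>exec p s t s'\<close>: started in \<open>s\<close>, the program \<open>p\<close> terminates in \<open>s'\<close> at cost \<open>t\<close>.\<close>

inductive exec :: "com \<Rightarrow> state \<Rightarrow> nat \<Rightarrow> state \<Rightarrow> bool" where
  Skip: "exec Skip s 1 s"
| Assign: "exec (Assign x i a) s
             (acost i s + acost a s + len (aval i s) + len (aval a s))
             (s(x := (s x)(aval i s := aval a s)))"
| Seq: "exec p s t s' \<Longrightarrow> exec q s' t' s'' \<Longrightarrow> exec (Seq p q) s (t + t') s''"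
| IfTrue: "bval b s \<Longrightarrow> exec p s t s' \<Longrightarrow> exec (If b p q) s (bcost b s + 1 + t) s'"
| IfFalse: "\<not> bval b s \<Longrightarrow> exec q s t s' \<Longrightarrow> exec (If b p q) s (bcost b s + 1 + t) s'"
| WhileFalse: "\<not> bval b s \<Longrightarrow> exec (While b p) s (bcost b s + 1) s"
| WhileTrue: "bval b s \<Longrightarrow> exec p s t s' \<Longrightarrow> exec (While b p) s' t' s'' \<Longrightarrow>
                exec (While b p) s (bcost b s + 1 + t + t') s''"

inductive_cases SkipE: "exec Skip s t s'"
inductive_cases AssignE: "exec (Assign x i a) s t s'"
inductive_cases SeqE: "exec (Seq p q) s t s'"
inductive_cases IfE: "exec (If b p q) s t s'"
inductive_cases WhileE: "exec (While b p) s t s'"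

lemma exec_deterministic:
  "exec p s t s' \<Longrightarrow> exec p s u s'' \<Longrightarrow> u = t \<and> s'' = s'"
proof (induction arbitrary: u s'' rule: exec.induct)
  case (Skip s)
  then show ?case by (auto elim: SkipE)
next
  case (Assign x i a s)
  then show ?case by (auto elim: AssignE)
next
  case (Seq p s t s1 q t' s2)
  from Seq.prems obtain v w r where "u = v + w" "exec p s v r" "exec q r w s''"
    by (rule SeqE)
  with Seq.IH show ?case by metis
next
  case (IfTrue b s p t s' q)
  from IfTrue.prems IfTrue.hyps obtain v where "u = bcost b s + 1 + v" "exec p s v s''"
    by (auto elim: IfE)
  with IfTrue.IH show ?case by metis
next
  case (IfFalse b s q t s' p)
  from IfFalse.prems IfFalse.hyps obtain v where "u = bcost b s + 1 + v" "exec q s v s''"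
    by (auto elim: IfE)
  with IfFalse.IH show ?case by metis
next
  case (WhileFalse b s p)
  from WhileFalse.prems WhileFalse.hyps show ?case by (auto elim: WhileE)
next
  case (WhileTrue b s p t s1 t' s2)
  from WhileTrue.prems WhileTrue.hyps obtain v w r
    where "u = bcost b s + 1 + v + w" "exec p s v r" "exec (While b p) r w s''"
    by (auto elim: WhileE)
  with WhileTrue.IH show ?case by metis
qed

section \<open>Solvability within a time bound\<close>

definition init_state :: "nat list \<Rightarrow> state" where
  "init_state xs = (\<lambda>x i. if x = ''in'' \<and> i < length xs then xs ! i else 0)"

definition solvable_in_time ::
  "'i set \<Rightarrow> ('i \<Rightarrow> nat list) \<Rightarrow> ('i \<Rightarrow> bool) \<Rightarrow> ('i \<Rightarrow> real) set \<Rightarrow> bool" where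
  "solvable_in_time A enc Q F \<longleftrightarrow>
     (\<exists>p T. (\<lambda>x. real (T x)) \<in> F \<and>
        (\<forall>x\<in>A. \<exists>s. exec p (init_state (enc x)) (T x) s \<and> s ''out'' 0 = of_bool (Q x)))"

text \<open>\<open>Ostar A n g\<close> is the class \<open>O*(g)\<close> of functions on the inputs in \<open>A\<close>, where \<open>n x\<close> is the
  size parameter of the input \<open>x\<close>. The filter \<open>principal A\<close> makes the bound uniform over
  all of \<open>A\<close>.\<close>

definition Ostar :: "'i set \<Rightarrow> ('i \<Rightarrow> nat) \<Rightarrow> ('i \<Rightarrow> real) \<Rightarrow> ('i \<Rightarrow> real) set" where
  "Ostar A n g = (\<Union>q :: real poly. O[principal A](\<lambda>x. g x * poly q (real (n x))))"

end

theory Submission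
  imports Defs "HOL-Library.Nat_Bijection" "HOL-Library.FuncSet"
begin

text \<open>Happy edges and happy vertices are monochromatic sets: the edges and the closed neighborhoods.
  A coloring thus amounts to a partition of the uncolored vertices into classes \<open>S\<^sub>1, \<dots>, S\<^sub>k\<close>, and its
  value is \<open>\<Sum>\<^sub>i f\<^sub>i(S\<^sub>i)\<close>, where \<open>f\<^sub>i(S)\<close> counts the sets all of whose vertices lie in \<open>S\<close> or are
  precolored \<open>i\<close>.

  For arbitrary \<open>k\<close>, the covers \<open>S\<^sub>1 \<union> \<dots> \<union> S\<^sub>k = U\<close> are summed with weights
  \<open>\<Prod>\<^sub>i W\<^bsup>|S\<^sub>i|\<^esup> z\<^bsup>f\<^sub>i(S\<^sub>i)\<^esup>\<close> by a fast zeta transform, a pointwise product and a Moebius transform on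
  the subsets of \<open>U\<close>. With \<open>z\<close> and \<open>W\<close> large powers of two of polynomial length, the generating
  polynomial becomes a single number, from which the best partition is read off by a division
  with remainder.

  For \<open>k = 3\<close>, some class has at most \<open>n'/3\<close> vertices, and there are at most \<open>1.89\<^bsup>n'\<^esup>\<close> candidates for
  it. Once it is fixed, the sets that can still become monochromatic in one of the two other colors
  form a bipartite conflict graph, and the best completion is a maximum independent set. Its size
  follows from a maximum matching, which an auction computes in polynomial time.\<close>

section \<open>Cost of programs\<close>

text \<open>Logarithmic cost is the obstacle that shapes the programs. If every stored number stays
  below \<open>2 ^ D\<close> with \<open>D\<close> polynomial in the number of vertices, the cost is
  the number of elementary steps up to a polynomial factor; this is what makes packing a whole
  generating polynomial into one number affordable. It also forbids reading the target in full,
  since its length is not bounded in terms of \<open>n\<close>. The base 1.89 rounds up the cube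
  root of 27/4, about 1.8899. Sifting the small sets out of all \<open>2 ^ n'\<close> subsets would
  already exceed that bound. They are listed by adding one vertex at a time instead: subsets of
  small sets are small, so the list never leaves the family and the work stays proportional to its
  final length. An auction is convenient because it needs array scans only, no augmenting paths, and
  because prices that only rise and never exceed \<open>m + 1\<close> give a number of sweeps known
  in advance.\<close>

lemma len_le: "m < 2 ^ D \<Longrightarrow> len m \<le> Suc D"
  unfolding len_def by (simp add: floorlog_le_iff)

lemma len_mono: "a \<le> b \<Longrightarrow> len a \<le> len b"
  unfolding len_def by (simp add: floorlog_mono)

lemma lt_power_floorlog: "m < 2 ^ floorlog 2 m"
  using floorlog_le_iff[of 2 m "floorlog 2 m"] by simp

lemma len_add: "len (a + b) \<le> len a + len b"
proof -
  have "a + b < 2 ^ (floorlog 2 a + floorlog 2 b + 1)"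
  proof -
    have "a < 2 ^ (floorlog 2 a + floorlog 2 b)" "b < 2 ^ (floorlog 2 a + floorlog 2 b)"
      by (rule less_le_trans[OF lt_power_floorlog], simp)+
    then show ?thesis by simp
  qed
  then have "len (a + b) \<le> Suc (floorlog 2 a + floorlog 2 b + 1)" by (rule len_le)
  then show ?thesis by (simp add: len_def)
qed

lemma len_mult: "len (a * b) \<le> len a + len b"
proof -
  have "a * b < 2 ^ (floorlog 2 a + floorlog 2 b)"
    unfolding power_add by (intro mult_strict_mono' lt_power_floorlog) auto
  then have "len (a * b) \<le> Suc (floorlog 2 a + floorlog 2 b)" by (rule len_le)
  then show ?thesis by (simp add: len_def)
qed

section \<open>Word length and the cost of a single step\<close>

definition bounded_state :: "nat \<Rightarrow> state \<Rightarrow> bool" where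
  "bounded_state D s \<longleftrightarrow> (\<forall>x i. s x i < 2 ^ D)"

text \<open>Measures the length of a value in units of \<open>Suc D\<close>. Only stored numbers are
  bounded by \<open>2 ^ D\<close>; an intermediate product may be longer, so the sizes of the
  operands are added, while \<open>Get\<close> starts again at 1.\<close>

fun asize :: "aexp \<Rightarrow> nat" where
  "asize (Const m) = len m"
| "asize (Get x a) = 1"
| "asize (Add a b) = asize a + asize b"
| "asize (Sub a b) = asize a + asize b"
| "asize (Mul a b) = asize a + asize b"
| "asize (Quot a b) = asize a + asize b"
| "asize (Rem a b) = asize a + asize b"

fun aweight :: "aexp \<Rightarrow> nat" where
  "aweight (Const m) = len m"
| "aweight (Get x a) = aweight a + asize a + 1"
| "aweight (Add a b) = aweight a + aweight b + asize a + asize b"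
| "aweight (Sub a b) = aweight a + aweight b + asize a + asize b"
| "aweight (Mul a b) = aweight a + aweight b + asize a * asize b"
| "aweight (Quot a b) = aweight a + aweight b + asize a * asize b"
| "aweight (Rem a b) = aweight a + aweight b + asize a * asize b"

fun bweight :: "bexp \<Rightarrow> nat" where
  "bweight (Less a b) = aweight a + aweight b + asize a + asize b"
| "bweight (Equal a b) = aweight a + aweight b + asize a + asize b"
| "bweight (Neg b) = bweight b + 1"
| "bweight (Conj b b') = bweight b + bweight b' + 1"

fun cweight :: "com \<Rightarrow> nat" where
  "cweight Skip = 1"
| "cweight (Assign x i a) = aweight i + aweight a + asize i + asize a"
| "cweight (Seq p q) = cweight p + cweight q"
| "cweight (If b p q) = bweight b + 1 + cweight p + cweight q"
| "cweight (While b p) = bweight b + 1 + cweight p"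

fun writes :: "com \<Rightarrow> vname set" where
  "writes Skip = {}"
| "writes (Assign x i a) = {x}"
| "writes (Seq p q) = writes p \<union> writes q"
| "writes (If b p q) = writes p \<union> writes q"
| "writes (While b p) = writes p"

lemma len_aval: "bounded_state D s \<Longrightarrow> len (aval a s) \<le> asize a * Suc D"
proof (induction a)
  case (Get x a)
  then show ?case by (simp add: bounded_state_def len_le del: mult_Suc_right)
next
  case (Add a b)
  then show ?case using len_add[of "aval a s" "aval b s"] by (simp add: algebra_simps)
next
  case (Sub a b)
  then show ?case using len_mono[of "aval a s - aval b s" "aval a s"] by (simp add: algebra_simps)
next
  case (Mul a b)
  then show ?case using len_mult[of "aval a s" "aval b s"] by (simp add: algebra_simps)
next
  case (Quot a b)
  then show ?case using len_mono[of "aval a s div aval b s" "aval a s"] by (simp add: algebra_simps)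
next
  case (Rem a b)
  then show ?case using len_mono[of "aval a s mod aval b s" "aval a s"] by (simp add: algebra_simps)
qed simp

text \<open>The square stems from multiplication and division, which are charged a product of two
  lengths; all other charges are linear in \<open>Suc D\<close>.\<close>

lemma acost_le: "bounded_state D s \<Longrightarrow> acost a s \<le> aweight a * (Suc D)\<^sup>2"
proof -
  define d where "d = Suc D"
  have d: "d \<le> d\<^sup>2" by (simp add: power2_eq_square d_def)
  assume bs: "bounded_state D s"
  have l: "len (aval b s) \<le> asize b * d" for b using len_aval[OF bs] by (simp add: d_def)
  have l2: "len (aval b s) \<le> asize b * d\<^sup>2" for b
    by (rule order_trans[OF l]) (simp add: d)
  have lm: "len (aval b s) * len (aval c s) \<le> asize b * asize c * d\<^sup>2" for b c
    using mult_mono[OF l[of b] l[of c]] by (simp add: power2_eq_square algebra_simps)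
  have "acost a s \<le> aweight a * d\<^sup>2"
  proof (induction a)
    case (Const m)
    then show ?case by (simp add: d_def)
  next
    case (Get x a)
    have "len (s x (aval a s)) \<le> d\<^sup>2" using bs d
      by (metis bounded_state_def d_def le_trans len_le)
    then show ?case using Get l2[of a] by (simp add: algebra_simps)
  next
    case (Add a b)
    then show ?case using l2[of a] l2[of b] by (simp add: algebra_simps)
  next
    case (Sub a b)
    then show ?case using l2[of a] l2[of b] by (simp add: algebra_simps)
  next
    case (Mul a b)
    then show ?case using lm[of a b] by (simp add: algebra_simps)
  next
    case (Quot a b)
    then show ?case using lm[of a b] by (simp add: algebra_simps)
  next
    case (Rem a b)
    then show ?case using lm[of a b] by (simp add: algebra_simps)
  qed
  then show ?thesis by (simp add: d_def)
qed

lemma len_aval_square: "bounded_state D s \<Longrightarrow> len (aval a s) \<le> asize a * (Suc D)\<^sup>2"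
  by (rule order_trans[OF len_aval]) (auto simp: power2_eq_square)

lemma one_le_Suc_square: "1 \<le> (Suc D)\<^sup>2"
  by simp

lemma bcost_le: "bounded_state D s \<Longrightarrow> bcost b s \<le> bweight b * (Suc D)\<^sup>2"
proof (induction b)
  case (Less a b)
  then show ?case using acost_le[of D s a] acost_le[of D s b] len_aval_square[of D s a] len_aval_square[of D s b]
    by (simp add: algebra_simps)
next
  case (Equal a b)
  then show ?case using acost_le[of D s a] acost_le[of D s b] len_aval_square[of D s a] len_aval_square[of D s b]
    by (simp add: algebra_simps)
next
  case (Neg b)
  then show ?case using one_le_Suc_square[of D]
    unfolding bcost.simps bweight.simps add_mult_distrib by linarith
next
  case (Conj b b')
  then show ?case using one_le_Suc_square[of D]
    unfolding bcost.simps bweight.simps add_mult_distrib by linarith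
qed

section \<open>A step-counting program logic\<close>

definition frame :: "vname set \<Rightarrow> state \<Rightarrow> state \<Rightarrow> bool" where
  "frame X s s' \<longleftrightarrow> (\<forall>y. y \<notin> X \<longrightarrow> s' y = s y)"

lemma frameD: "frame X s s' \<Longrightarrow> y \<notin> X \<Longrightarrow> s' y = s y"
  by (simp add: frame_def)

lemma frame_trans: "frame X s s' \<Longrightarrow> frame X s' s'' \<Longrightarrow> frame X s s''"
  by (simp add: frame_def)

lemma exec_frame: "exec c s t s' \<Longrightarrow> frame (writes c) s s'"
  by (induction rule: exec.induct) (auto simp: frame_def)

text \<open>As long as all stored numbers stay below \<open>2 ^ D\<close>, a program is charged at most
  \<open>cweight c * (D + 1)\<^sup>2\<close> per elementary step, so it suffices to count steps.\<close>

definition ok :: "nat \<Rightarrow> com \<Rightarrow> nat \<Rightarrow> (state \<Rightarrow> bool) \<Rightarrow> state \<Rightarrow> bool" where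
  "ok D c N Q s \<longleftrightarrow> (bounded_state D s \<longrightarrow>
     (\<exists>t s'. exec c s t s' \<and> bounded_state D s' \<and> t \<le> N * (cweight c * (Suc D)\<^sup>2) \<and> Q s'))"

text \<open>The frame of the program is handed over to the new postcondition, so specifications need
  not mention the variables that a program leaves alone.\<close>

lemma ok_conseq:
  assumes "ok D c N Q s" "N \<le> N'" "\<And>s'. frame (writes c) s s' \<Longrightarrow> Q s' \<Longrightarrow> Q' s'"
  shows "ok D c N' Q' s"
  unfolding ok_def
proof
  assume "bounded_state D s"
  with assms(1) obtain t s' where *: "exec c s t s'" "bounded_state D s'"
    "t \<le> N * (cweight c * (Suc D)\<^sup>2)" "Q s'" unfolding ok_def by blast
  moreover have "t \<le> N' * (cweight c * (Suc D)\<^sup>2)"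
    by (rule order_trans[OF *(3)]) (intro mult_right_mono assms(2), simp)
  ultimately show "\<exists>t s'. exec c s t s' \<and> bounded_state D s' \<and> t \<le> N' * (cweight c * (Suc D)\<^sup>2) \<and> Q' s'"
    using assms(3) exec_frame by blast
qed

lemma ok_steps: "ok D c N Q s \<Longrightarrow> N \<le> N' \<Longrightarrow> ok D c N' Q s"
  by (rule ok_conseq)

lemma ok_post: "ok D c N Q s \<Longrightarrow> (\<And>s'. frame (writes c) s s' \<Longrightarrow> Q s' \<Longrightarrow> Q' s') \<Longrightarrow> ok D c N Q' s"
  by (rule ok_conseq[OF _ order_refl])

lemma ok_Skip: "Q s \<Longrightarrow> ok D Skip 1 Q s"
  unfolding ok_def by (auto intro!: exI exec.Skip)

lemma ok_Assign:
  assumes "aval a s < 2 ^ D" "Q (s(x := (s x)(aval i s := aval a s)))"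
  shows "ok D (Assign x i a) 1 Q s"
  unfolding ok_def
proof
  assume bs: "bounded_state D s"
  have "acost i s + acost a s + len (aval i s) + len (aval a s)
      \<le> 1 * (cweight (Assign x i a) * (Suc D)\<^sup>2)"
    using acost_le[OF bs, of i] acost_le[OF bs, of a] len_aval_square[OF bs, of i]
      len_aval_square[OF bs, of a] by (simp add: algebra_simps)
  moreover have "bounded_state D (s(x := (s x)(aval i s := aval a s)))"
    using bs assms(1) by (auto simp: bounded_state_def)
  ultimately show "\<exists>t s'. exec (Assign x i a) s t s' \<and> bounded_state D s' \<and>
      t \<le> 1 * (cweight (Assign x i a) * (Suc D)\<^sup>2) \<and> Q s'"
    using assms(2) exec.Assign by blast
qed

lemma ok_Seq:
  assumes "ok D p N (\<lambda>s'. ok D q N' Q s') s"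
  shows "ok D (Seq p q) (N + N') Q s"
  unfolding ok_def
proof
  assume "bounded_state D s"
  with assms obtain t s' where 1: "exec p s t s'" "bounded_state D s'"
    "t \<le> N * (cweight p * (Suc D)\<^sup>2)" "ok D q N' Q s'" unfolding ok_def[of D p] by blast
  then obtain t' s'' where 2: "exec q s' t' s''" "bounded_state D s''"
    "t' \<le> N' * (cweight q * (Suc D)\<^sup>2)" "Q s''" unfolding ok_def by blast
  have "t + t' \<le> (N + N') * (cweight (Seq p q) * (Suc D)\<^sup>2)"
    using 1(3) 2(3) by (simp add: algebra_simps)
  then show "\<exists>t s'. exec (Seq p q) s t s' \<and> bounded_state D s' \<and>
      t \<le> (N + N') * (cweight (Seq p q) * (Suc D)\<^sup>2) \<and> Q s'"
    using exec.Seq[OF 1(1) 2(1)] 2 by blast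
qed

text \<open>Both branches are paid for, which keeps the step count independent of the state; the
  additional 1 pays for the test.\<close>

lemma ok_If:
  assumes "bval b s \<Longrightarrow> ok D p N Q s" "\<not> bval b s \<Longrightarrow> ok D q N' Q s"
  shows "ok D (If b p q) (N + N' + 1) Q s"
  unfolding ok_def
proof
  assume bs: "bounded_state D s"
  have b: "bcost b s + 1 \<le> (bweight b + 1) * (Suc D)\<^sup>2"
    using bcost_le[OF bs, of b] one_le_Suc_square[of D] unfolding add_mult_distrib by linarith
  define d where "d = (Suc D)\<^sup>2"
  show "\<exists>t s'. exec (If b p q) s t s' \<and> bounded_state D s' \<and>
      t \<le> (N + N' + 1) * (cweight (If b p q) * (Suc D)\<^sup>2) \<and> Q s'"
  proof (cases "bval b s")
    case True
    with assms(1) bs obtain t s' where 1: "exec p s t s'" "bounded_state D s'"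
      "t \<le> N * (cweight p * (Suc D)\<^sup>2)" "Q s'" unfolding ok_def by blast
    have "bcost b s + 1 + t \<le> (N + N' + 1) * (cweight (If b p q) * (Suc D)\<^sup>2)"
      using b 1(3) unfolding d_def[symmetric] by (simp add: algebra_simps)
    then show ?thesis using exec.IfTrue[OF True 1(1)] 1 by blast
  next
    case False
    with assms(2) bs obtain t s' where 1: "exec q s t s'" "bounded_state D s'"
      "t \<le> N' * (cweight q * (Suc D)\<^sup>2)" "Q s'" unfolding ok_def by blast
    have "bcost b s + 1 + t \<le> (N + N' + 1) * (cweight (If b p q) * (Suc D)\<^sup>2)"
      using b 1(3) unfolding d_def[symmetric] by (simp add: algebra_simps)
    then show ?thesis using exec.IfFalse[OF False 1(1)] 1 by blast
  qed
qed

text \<open>The index of the invariant counts the completed rounds. In place of a variant, invariant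
  and guard together must imply that fewer than \<open>H\<close> rounds have passed.\<close>

lemma ok_While:
  assumes I0: "I 0 s"
    and step: "\<And>i s'. frame (writes p) s s' \<Longrightarrow> I i s' \<Longrightarrow> bval b s' \<Longrightarrow>
           i < H \<and> ok D p N (I (Suc i)) s'"
    and fin: "\<And>i s'. frame (writes p) s s' \<Longrightarrow> I i s' \<Longrightarrow> \<not> bval b s' \<Longrightarrow> Q s'"
  shows "ok D (While b p) (H * (N + 1) + 1) Q s"
proof -
  have gen: "ok D (While b p) ((H - i) * (N + 1) + 1) Q s'"
    if "frame (writes p) s s'" "I i s'" for i s'
    using that
  proof (induction "H - i" arbitrary: i s' rule: less_induct)
    case less
    define d where "d = (Suc D)\<^sup>2"
    show ?case unfolding ok_def
    proof
      assume bs: "bounded_state D s'"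
      have b: "bcost b s' + 1 \<le> (bweight b + 1) * (Suc D)\<^sup>2"
        using bcost_le[OF bs, of b] one_le_Suc_square[of D] unfolding add_mult_distrib by linarith
      show "\<exists>t s''. exec (While b p) s' t s'' \<and> bounded_state D s'' \<and>
          t \<le> ((H - i) * (N + 1) + 1) * (cweight (While b p) * (Suc D)\<^sup>2) \<and> Q s''"
      proof (cases "bval b s'")
        case True
        from step[OF less.prems True] have iH: "i < H" and o: "ok D p N (I (Suc i)) s'" by auto
        from o bs obtain t s1 where 1: "exec p s' t s1" "bounded_state D s1"
          "t \<le> N * (cweight p * (Suc D)\<^sup>2)" "I (Suc i) s1" unfolding ok_def by blast
        have fr: "frame (writes p) s s1"
          using frame_trans[OF less.prems(1) exec_frame[OF 1(1)]] .
        have "ok D (While b p) ((H - Suc i) * (N + 1) + 1) Q s1"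
          by (rule less.hyps) (use iH fr 1 in auto)
        with 1(2) obtain t' s2 where 2: "exec (While b p) s1 t' s2" "bounded_state D s2"
          "t' \<le> ((H - Suc i) * (N + 1) + 1) * (cweight (While b p) * (Suc D)\<^sup>2)" "Q s2"
          unfolding ok_def by blast
        have H: "H - i = Suc (H - Suc i)" using iH by simp
        have "bcost b s' + 1 + t + t' \<le> ((H - i) * (N + 1) + 1) * (cweight (While b p) * (Suc D)\<^sup>2)"
          using b 1(3) 2(3) unfolding d_def[symmetric] H by (simp add: algebra_simps)
        then show ?thesis using exec.WhileTrue[OF True 1(1) 2(1)] 2 by blast
      next
        case False
        have "bcost b s' + 1 \<le> 1 * (cweight (While b p) * (Suc D)\<^sup>2)"
          using b unfolding d_def[symmetric] by (simp add: algebra_simps)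
        also have "\<dots> \<le> ((H - i) * (N + 1) + 1) * (cweight (While b p) * (Suc D)\<^sup>2)"
          by (intro mult_right_mono) auto
        finally show ?thesis using exec.WhileFalse[OF False] fin[OF less.prems False] bs by blast
      qed
    qed
  qed
  show ?thesis using gen[of s 0] I0 by (simp add: frame_def)
qed

abbreviation V :: "vname \<Rightarrow> aexp" where "V x \<equiv> Get x (Const 0)"

abbreviation assign_scalar :: "vname \<Rightarrow> aexp \<Rightarrow> com" (infix "::=" 62) where
  "x ::= a \<equiv> Assign x (Const 0) a"

notation Seq (infixr ";;" 60)

abbreviation put :: "vname \<Rightarrow> nat \<Rightarrow> state \<Rightarrow> state" where "put x v s \<equiv> s(x := (s x)(0 := v))"

definition For :: "vname \<Rightarrow> aexp \<Rightarrow> com \<Rightarrow> com" where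
  "For x h p = x ::= Const 0 ;; While (Less (V x) h) (p ;; x ::= Add (V x) (Const 1))"

lemma writes_For [simp]: "writes (For x h p) = insert x (writes p)"
  by (auto simp: For_def)

text \<open>The bound \<open>h\<close> is evaluated anew in every round, so its value has to be
  \<open>H\<close> in all states that the loop can reach. The counter ends at \<open>H\<close>,
  which \<open>HD\<close> makes storable. The invariant after a round is demanded for the state with
  the counter already increased.\<close>

lemma ok_For:
  assumes x: "x \<notin> writes p"
    and h: "\<And>s'. frame (insert x (writes p)) s s' \<Longrightarrow> aval h s' = H"
    and HD: "H < 2 ^ D"
    and I0: "I 0 (s(x := (s x)(0 := 0)))"
    and step: "\<And>i s'. frame (insert x (writes p)) s s' \<Longrightarrow> i < H \<Longrightarrow> s' x 0 = i \<Longrightarrow> I i s' \<Longrightarrow>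
           ok D p N (\<lambda>s''. I (Suc i) (s''(x := (s'' x)(0 := Suc i)))) s'"
    and fin: "\<And>s'. frame (insert x (writes p)) s s' \<Longrightarrow> s' x 0 = H \<Longrightarrow> I H s' \<Longrightarrow> Q s'"
  shows "ok D (For x h p) (H * (N + 2) + 2) Q s"
proof -
  let ?s = "s(x := (s x)(0 := 0))"
  have w: "writes (p ;; x ::= Add (V x) (Const 1)) = insert x (writes p)" by auto
  have fr: "frame (insert x (writes p)) s s'" if "frame (insert x (writes p)) ?s s'" for s'
    using that by (auto simp: frame_def)
  have "ok D (While (Less (V x) h) (p ;; x ::= Add (V x) (Const 1))) (H * (N + 1 + 1) + 1) Q ?s"
  proof (rule ok_While[where I = "\<lambda>i s'. i \<le> H \<and> s' x 0 = i \<and> I i s'"], unfold w)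
    show "0 \<le> H \<and> ?s x 0 = 0 \<and> I 0 ?s" using I0 by simp
  next
    fix i s'
    assume f: "frame (insert x (writes p)) ?s s'" and I: "i \<le> H \<and> s' x 0 = i \<and> I i s'"
      and b: "bval (Less (V x) h) s'"
    have iH: "i < H" using b I h[OF fr[OF f]] by simp
    have "ok D p N (\<lambda>s''. I (Suc i) (s''(x := (s'' x)(0 := Suc i)))) s'"
      by (rule step) (use fr f I iH in auto)
    then have "ok D (p ;; x ::= Add (V x) (Const 1)) (N + 1)
       (\<lambda>s'. Suc i \<le> H \<and> s' x 0 = Suc i \<and> I (Suc i) s') s'"
    proof (rule ok_Seq[OF ok_post], goal_cases)
      case (1 s'')
      then have "s'' x 0 = i" using x I by (simp add: frame_def)
      then show ?case using 1 iH HD by (intro ok_Assign) auto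
    qed
    with iH show "i < H \<and> ok D (p ;; x ::= Add (V x) (Const 1)) (N + 1)
       (\<lambda>s'. Suc i \<le> H \<and> s' x 0 = Suc i \<and> I (Suc i) s') s'" by simp
  next
    fix i s'
    assume f: "frame (insert x (writes p)) ?s s'" and I: "i \<le> H \<and> s' x 0 = i \<and> I i s'"
      and b: "\<not> bval (Less (V x) h) s'"
    have "i = H" using b I h[OF fr[OF f]] by simp
    then show "Q s'" using fin[OF fr[OF f]] I by simp
  qed
  then have "ok D (For x h p) (1 + (H * (N + 1 + 1) + 1)) Q s"
    unfolding For_def by (intro ok_Seq ok_Assign) auto
  then show ?thesis by simp
qed

section \<open>Zeta transform and partitions\<close>

text \<open>\<open>J\<close> is the set of coordinates that an in-place transform has already processed.\<close>

definition partial_zeta :: "('a set \<Rightarrow> nat) \<Rightarrow> 'a set \<Rightarrow> 'a set \<Rightarrow> nat" where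
  "partial_zeta g J Y = (\<Sum>S | S \<subseteq> Y \<and> Y - J \<subseteq> S. g S)"

lemma partial_zeta_empty: "partial_zeta g {} Y = g Y"
proof -
  have "{S. S \<subseteq> Y \<and> Y - {} \<subseteq> S} = {Y}" by auto
  then show ?thesis by (simp add: partial_zeta_def)
qed

lemma partial_zeta_full: "Y \<subseteq> J \<Longrightarrow> partial_zeta g J Y = (\<Sum>S\<in>Pow Y. g S)"
  unfolding partial_zeta_def by (rule sum.cong) auto

text \<open>Coordinates in \<open>J\<close> are free, the others must agree with \<open>Y\<close>.
  Freeing \<open>x\<close> adds the sets without \<open>x\<close>, and these are the ones counted
  for \<open>Y - {x}\<close>.\<close>

lemma partial_zeta_insert_in:
  assumes "finite Y" "x \<in> Y" "x \<notin> J"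
  shows "partial_zeta g (insert x J) Y = partial_zeta g J Y + partial_zeta g J (Y - {x})"
proof -
  have "{S. S \<subseteq> Y \<and> Y - insert x J \<subseteq> S} =
     {S. S \<subseteq> Y \<and> Y - J \<subseteq> S} \<union> {S. S \<subseteq> Y - {x} \<and> Y - {x} - J \<subseteq> S}"
    using assms by auto
  moreover have "{S. S \<subseteq> Y \<and> Y - J \<subseteq> S} \<inter> {S. S \<subseteq> Y - {x} \<and> Y - {x} - J \<subseteq> S} = {}"
    using assms by auto
  ultimately show ?thesis using assms(1)
    by (simp add: partial_zeta_def sum.union_disjoint)
qed

lemma partial_zeta_insert_out:
  assumes "x \<notin> Y"
  shows "partial_zeta g (insert x J) Y = partial_zeta g J Y"
proof -
  have "Y - insert x J = Y - J" using assms by auto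
  then show ?thesis by (simp add: partial_zeta_def)
qed

definition partial_covers :: "'i set \<Rightarrow> 'a set \<Rightarrow> 'a set \<Rightarrow> ('i \<Rightarrow> 'a set) set" where
  "partial_covers K J Y = {\<sigma> \<in> K \<rightarrow>\<^sub>E Pow Y. J \<inter> Y \<subseteq> \<Union> (\<sigma> ` K)}"

text \<open>The intermediate tables of the Moebius transform. For \<open>J = {}\<close> the sum runs
  over all tuples of subsets of \<open>Y\<close> and factors into a product of zeta transforms; for
  \<open>J = Y\<close> it runs over the covers of \<open>Y\<close>.\<close>

definition cover_sum :: "'i set \<Rightarrow> (('i \<Rightarrow> 'a set) \<Rightarrow> nat) \<Rightarrow> 'a set \<Rightarrow> 'a set \<Rightarrow> nat" where
  "cover_sum K w J Y = (\<Sum>\<sigma>\<in>partial_covers K J Y. w \<sigma>)"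

lemma finite_partial_covers: "finite K \<Longrightarrow> finite Y \<Longrightarrow> finite (partial_covers K J Y)"
  unfolding partial_covers_def by (simp add: finite_PiE)

lemma cover_sum_empty:
  assumes "finite K" "finite Y"
  shows "cover_sum K (\<lambda>\<sigma>. \<Prod>i\<in>K. g i (\<sigma> i)) {} Y = (\<Prod>i\<in>K. \<Sum>S\<in>Pow Y. g i S)"
proof -
  have "partial_covers K {} Y = K \<rightarrow>\<^sub>E Pow Y" by (auto simp: partial_covers_def)
  then show ?thesis using assms
    by (simp add: cover_sum_def prod_sum_PiE)
qed

text \<open>A tuple that covers \<open>J \<inter> Y\<close> but misses \<open>x\<close> is the same
  as a tuple of subsets of \<open>Y - {x}\<close>. The sum subtracted is thus a part of the other
  one, so subtraction of natural numbers is exact and the signs of inclusion-exclusion never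
  appear.\<close>

lemma cover_sum_insert_in:
  assumes "finite K" "finite Y" "x \<in> Y" "x \<notin> J"
  shows "cover_sum K w (insert x J) Y = cover_sum K w J Y - cover_sum K w J (Y - {x})"
proof -
  have sub: "partial_covers K J (Y - {x}) \<subseteq> partial_covers K J Y"
  proof
    fix \<sigma> assume s: "\<sigma> \<in> partial_covers K J (Y - {x})"
    then have "\<sigma> \<in> K \<rightarrow>\<^sub>E Pow Y" unfolding partial_covers_def by (auto simp: PiE_def Pi_def)
    moreover have "J \<inter> Y = J \<inter> (Y - {x})" using assms by auto
    ultimately show "\<sigma> \<in> partial_covers K J Y" using s by (simp add: partial_covers_def)
  qed
  have "partial_covers K (insert x J) Y = partial_covers K J Y - partial_covers K J (Y - {x})"
  proof (intro equalityI subsetI)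
    fix \<sigma> assume "\<sigma> \<in> partial_covers K (insert x J) Y"
    then show "\<sigma> \<in> partial_covers K J Y - partial_covers K J (Y - {x})"
      using assms(3) by (fastforce simp: partial_covers_def PiE_def Pi_def)
  next
    fix \<sigma> assume a: "\<sigma> \<in> partial_covers K J Y - partial_covers K J (Y - {x})"
    have "J \<inter> (Y - {x}) = J \<inter> Y" using assms by auto
    with a have "\<sigma> \<notin> K \<rightarrow>\<^sub>E Pow (Y - {x})" "\<sigma> \<in> K \<rightarrow>\<^sub>E Pow Y"
      by (auto simp: partial_covers_def)
    then obtain i where "i \<in> K" "x \<in> \<sigma> i" by (auto simp: PiE_def Pi_def)
    then show "\<sigma> \<in> partial_covers K (insert x J) Y" using a by (auto simp: partial_covers_def)
  qed
  then show ?thesis unfolding cover_sum_def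
    using sum_diff_nat[OF finite_subset[OF sub finite_partial_covers[OF assms(1,2)]] sub] by simp
qed

lemma cover_sum_insert_out:
  assumes "x \<notin> Y"
  shows "cover_sum K w (insert x J) Y = cover_sum K w J Y"
proof -
  have "insert x J \<inter> Y = J \<inter> Y" using assms by auto
  then show ?thesis by (simp add: cover_sum_def partial_covers_def)
qed

lemma cover_sum_le:
  assumes "finite K" "finite Y" "\<And>\<sigma>. \<sigma> \<in> K \<rightarrow>\<^sub>E Pow Y \<Longrightarrow> w \<sigma> \<le> B"
  shows "cover_sum K w J Y \<le> (2 ^ card Y) ^ card K * B"
proof -
  have "cover_sum K w J Y \<le> card (partial_covers K J Y) * B"
    unfolding cover_sum_def
    using sum_bounded_above[of "partial_covers K J Y" w B] assms(3)
    by (auto simp: partial_covers_def)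
  also have "card (partial_covers K J Y) \<le> card (K \<rightarrow>\<^sub>E Pow Y)"
    by (rule card_mono) (use assms in \<open>auto simp: partial_covers_def finite_PiE\<close>)
  also have "card (K \<rightarrow>\<^sub>E Pow Y) = (2 ^ card Y) ^ card K"
    using assms by (simp add: card_PiE card_Pow)
  finally show ?thesis by simp
qed

text \<open>Covers that are not partitions have total size above \<open>card U\<close> and vanish modulo
  \<open>W ^ (card U + 1)\<close>. The base \<open>z\<close> exceeds the number of covers, hence the leading power of
  \<open>z\<close> survives the summation.\<close>

lemma cover_sum_threshold:
  fixes f :: "'i \<Rightarrow> 'a set \<Rightarrow> nat"
  assumes fin: "finite K" "finite U"
    and z: "(2 ^ card U) ^ card K < z"
    and B: "\<And>\<sigma>. (\<Sum>i\<in>K. f i (\<sigma> i)) \<le> B"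
    and W: "W = z ^ Suc B"
  shows "W ^ card U * z ^ t \<le> cover_sum K (\<lambda>\<sigma>. \<Prod>i\<in>K. W ^ card (\<sigma> i) * z ^ f i (\<sigma> i)) U U mod W ^ Suc (card U)
    \<longleftrightarrow> (\<exists>\<sigma>\<in>K \<rightarrow>\<^sub>E Pow U. U \<subseteq> \<Union> (\<sigma> ` K) \<and> (\<Sum>i\<in>K. card (\<sigma> i)) = card U \<and> t \<le> (\<Sum>i\<in>K. f i (\<sigma> i)))"
    (is "_ \<le> ?R mod _ \<longleftrightarrow> _")
proof -
  let ?c = "\<lambda>\<sigma>. \<Sum>i\<in>K. card (\<sigma> i)"
  let ?f = "\<lambda>\<sigma>. \<Sum>i\<in>K. f i (\<sigma> i)"
  define u where "u = card U"
  define C where "C = partial_covers K U U"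
  define P where "P = {\<sigma> \<in> C. ?c \<sigma> = u}"
  define Q where "Q = (\<Sum>\<sigma>\<in>P. z ^ ?f \<sigma>)"
  have z0: "z > 0" using z by simp
  have W0: "W > 0" using z0 W by simp
  have finC: "finite C" unfolding C_def using fin by (rule finite_partial_covers)
  have finP: "finite P" using finC by (simp add: P_def)
  have w: "(\<Prod>i\<in>K. W ^ card (\<sigma> i) * z ^ f i (\<sigma> i)) = W ^ ?c \<sigma> * z ^ ?f \<sigma>" for \<sigma>
    by (simp add: prod.distrib power_sum)
  have ge: "u \<le> ?c \<sigma>" if "\<sigma> \<in> C" for \<sigma>
  proof -
    have s: "U = (\<Union>i\<in>K. \<sigma> i)" using that by (auto simp: C_def partial_covers_def PiE_def Pi_def)
    show ?thesis unfolding u_def by (subst s) (rule card_UN_le[OF fin(1)])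
  qed
  have cardP: "card P \<le> (2 ^ card U) ^ card K"
  proof -
    have "card P \<le> card (K \<rightarrow>\<^sub>E Pow U)"
      by (rule card_mono) (use fin in \<open>auto simp: P_def C_def partial_covers_def finite_PiE\<close>)
    then show ?thesis using fin by (simp add: card_PiE card_Pow)
  qed
  \<comment> \<open>Fewer than \<open>z\<close> summands, each at most \<open>z ^ B\<close>: this is
    the reason for \<open>W = z ^ Suc B\<close>. As \<open>Q\<close> is below \<open>W\<close>, it
    is a single digit in base \<open>W\<close>.\<close>
  have "Q \<le> card P * z ^ B" unfolding Q_def
    using sum_bounded_above[of P "\<lambda>\<sigma>. z ^ ?f \<sigma>" "z ^ B"] B z0 by (simp add: power_increasing)
  also have "\<dots> < W" using cardP z z0 by (simp add: W)
  finally have QW: "Q < W" .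
  have "?R = (\<Sum>\<sigma>\<in>P. W ^ ?c \<sigma> * z ^ ?f \<sigma>) + (\<Sum>\<sigma>\<in>C - P. W ^ ?c \<sigma> * z ^ ?f \<sigma>)"
    unfolding cover_sum_def w C_def[symmetric] using finC
    by (metis (no_types, lifting) P_def add.commute mem_Collect_eq subsetI sum.subset_diff)
  also have "(\<Sum>\<sigma>\<in>P. W ^ ?c \<sigma> * z ^ ?f \<sigma>) = W ^ u * Q"
    unfolding Q_def sum_distrib_left by (rule sum.cong) (auto simp: P_def)
  also have "(\<Sum>\<sigma>\<in>C - P. W ^ ?c \<sigma> * z ^ ?f \<sigma>) =
      W ^ Suc u * (\<Sum>\<sigma>\<in>C - P. W ^ (?c \<sigma> - Suc u) * z ^ ?f \<sigma>)"
    unfolding sum_distrib_left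
  proof (rule sum.cong, goal_cases)
    case (2 \<sigma>)
    then have "Suc u \<le> ?c \<sigma>" using ge[of \<sigma>] by (auto simp: P_def)
    then have "W ^ ?c \<sigma> = W ^ Suc u * W ^ (?c \<sigma> - Suc u)"
      by (metis le_add_diff_inverse power_add)
    then show ?case by (simp only: mult.assoc)
  qed simp
  finally have "?R mod W ^ Suc u = (W ^ u * Q) mod W ^ Suc u" by simp
  also have "\<dots> = W ^ u * Q" using QW W0 by (intro mod_less) simp
  finally have R: "?R mod W ^ Suc u = W ^ u * Q" .
  have "W ^ u * z ^ t \<le> ?R mod W ^ Suc u \<longleftrightarrow> z ^ t \<le> Q"
    unfolding R using W0 by simp
  also have "\<dots> \<longleftrightarrow> (\<exists>\<sigma>\<in>P. t \<le> ?f \<sigma>)"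
  proof
    assume "z ^ t \<le> Q"
    show "\<exists>\<sigma>\<in>P. t \<le> ?f \<sigma>"
    proof (rule ccontr)
      assume "\<not> ?thesis"
      then have lt: "?f \<sigma> < t" if "\<sigma> \<in> P" for \<sigma> using that by (auto simp: not_le)
      show False
      proof (cases "P = {}")
        case True
        then show False using \<open>z ^ t \<le> Q\<close> z0 by (simp add: Q_def)
      next
        case False
        then obtain t' where t: "t = Suc t'" using lt by (cases t) auto
        have "Q \<le> card P * z ^ t'" unfolding Q_def
          using sum_bounded_above[of P "\<lambda>\<sigma>. z ^ ?f \<sigma>" "z ^ t'"] lt z0 t
          by (simp add: power_increasing less_Suc_eq_le)
        also have "\<dots> < z ^ t" using cardP z z0 by (simp add: t)
        finally show False using \<open>z ^ t \<le> Q\<close> by simp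
      qed
    qed
  next
    assume "\<exists>\<sigma>\<in>P. t \<le> ?f \<sigma>"
    then obtain \<sigma> where s: "\<sigma> \<in> P" "t \<le> ?f \<sigma>" by blast
    have "z ^ t \<le> z ^ ?f \<sigma>" using s z0 by (simp add: power_increasing)
    also have "\<dots> \<le> Q" unfolding Q_def using s finP by (intro member_le_sum) auto
    finally show "z ^ t \<le> Q" .
  qed
  finally show ?thesis unfolding u_def[symmetric] P_def C_def partial_covers_def by auto
qed

section \<open>Bipartite matching by an auction\<close>

text \<open>The bidders \<open>L\<close> and the goods \<open>R\<close> are indexed by numbers below \<open>m\<close>. An unmatched bidder
  (\<open>mt l = 0\<close>) takes a cheapest neighbouring good, possibly from its owner \<open>ow r - 1\<close>
  (\<open>ow r = 0\<close> for unowned goods), and its price \<open>pr r\<close> goes up by one. Goods of price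
  \<open>m + 1\<close> are not for sale.\<close>

locale auction =
  fixes m :: nat and L R :: "nat set" and cf :: "nat \<Rightarrow> nat \<Rightarrow> bool"
  assumes L: "L \<subseteq> {..<m}" and R: "R \<subseteq> {..<m}"
begin

text \<open>The last clause is complementary slackness up to one unit: an owned good costs at most
  one more than any other neighbour of its owner. Goods with a positive price stay owned. Indices
  outside \<open>L\<close> count as matched and those outside \<open>R\<close> carry the prohibitive
  price \<open>m + 1\<close>, so the loops can run over all numbers below \<open>m\<close> without
  testing membership.\<close>

definition invar :: "(nat \<Rightarrow> nat) \<Rightarrow> (nat \<Rightarrow> nat) \<Rightarrow> (nat \<Rightarrow> nat) \<Rightarrow> bool" where
  "invar mt ow pr \<longleftrightarrow>
     (\<forall>j<m. mt j \<le> 1 \<and> (j \<notin> L \<longrightarrow> mt j = 1) \<and> (j \<in> L \<and> mt j = 1 \<longrightarrow> (\<exists>r\<in>R. ow r = Suc j))) \<and>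
     (\<forall>r<m. pr r \<le> m + 1 \<and> (r \<notin> R \<longrightarrow> pr r = m + 1 \<and> ow r = 0) \<and> (r \<in> R \<and> 0 < pr r \<longrightarrow> 0 < ow r)) \<and>
     (\<forall>r\<in>R. \<forall>j. ow r = Suc j \<longrightarrow> j \<in> L \<and> mt j = 1 \<and> cf j r \<and>
        (\<forall>r'\<in>R. cf j r' \<longrightarrow> pr r \<le> pr r' + 1) \<and> (\<forall>r'\<in>R. ow r' = Suc j \<longrightarrow> r' = r))"

definition final :: "(nat \<Rightarrow> nat) \<Rightarrow> (nat \<Rightarrow> nat) \<Rightarrow> bool" where
  "final mt pr \<longleftrightarrow> (\<forall>j<m. mt j = 0 \<longrightarrow> (\<forall>r<m. cf j r \<longrightarrow> m + 1 \<le> pr r))"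

lemma invar_init:
  assumes "\<And>j. j < m \<Longrightarrow> mt j = of_bool (j \<notin> L)"
    and "\<And>r. r < m \<Longrightarrow> pr r = (if r \<in> R then 0 else m + 1)"
    and "\<And>r. r < m \<Longrightarrow> ow r = 0"
  shows "invar mt ow pr"
  using assms L R by (auto simp: invar_def)

lemma invar_not_in_R: "invar mt ow pr \<Longrightarrow> r < m \<Longrightarrow> r \<notin> R \<Longrightarrow> pr r = m + 1 \<and> ow r = 0"
  unfolding invar_def by blast

text \<open>The new owner took a cheapest neighbour, so a rise by one keeps its slackness. For the
  other owners a higher price of \<open>b\<close> only relaxes the condition, and the previous owner
  of \<open>b\<close> drops out.\<close>

lemma invar_step:
  assumes inv: "invar mt ow pr" and j: "j < m" "mt j = 0"
    and b: "b < m" "cf j b" "pr b < m + 1" and min: "\<And>r. r < m \<Longrightarrow> cf j r \<Longrightarrow> pr b \<le> pr r"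
    and mt': "mt' = (if 0 < ow b then mt(ow b - 1 := 0) else mt)(j := 1)"
  shows "invar mt' (ow(b := Suc j)) (pr(b := pr b + 1))"
proof -
  have jL: "j \<in> L" using inv j by (auto simp: invar_def)
  have bR: "b \<in> R" using invar_not_in_R[OF inv b(1)] b(3) by auto
  have own: "r' = r" if "r \<in> R" "r' \<in> R" "ow r = Suc i" "ow r' = Suc i" for r r' i
    using inv that unfolding invar_def by blast
  have owj: "ow r \<noteq> Suc j" if "r \<in> R" for r
    using inv that j unfolding invar_def by force
  have mt'1: "mt' i = mt i" if "i \<noteq> j" "ow b \<noteq> Suc i" for i
    using that by (auto simp: mt')
  have mt'0: "mt' i = 0" if "i \<noteq> j" "ow b = Suc i" for i
    using that by (auto simp: mt')
  have mt'j: "mt' j = 1" by (simp add: mt')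
  show ?thesis unfolding invar_def
  proof (intro conjI allI impI ballI)
    fix i assume i: "i < m"
    show "mt' i \<le> 1" using inv i by (auto simp: invar_def mt')
    { assume "i \<notin> L"
      then have "i \<noteq> j" "ow b \<noteq> Suc i" "mt i = 1" using inv i jL bR by (auto simp: invar_def)
      then show "mt' i = 1" using mt'1 by simp }
    assume i1: "i \<in> L \<and> mt' i = 1"
    show "\<exists>r\<in>R. (ow(b := Suc j)) r = Suc i"
    proof (cases "i = j")
      case True
      then show ?thesis using bR by auto
    next
      case False
      then have "ow b \<noteq> Suc i" using i1 mt'0 by fastforce
      moreover from this have "mt i = 1" using False i1 mt'1 by simp
      then obtain r where "r \<in> R" "ow r = Suc i" using inv i1 i unfolding invar_def by blast
      ultimately show ?thesis by (intro bexI[of _ r]) auto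
    qed
  next
    fix r assume r: "r < m"
    show "(pr(b := pr b + 1)) r \<le> m + 1" using inv r b by (auto simp: invar_def)
    { assume "r \<notin> R"
      then show "(pr(b := pr b + 1)) r = m + 1" "(ow(b := Suc j)) r = 0"
        using inv r bR by (auto simp: invar_def) }
    assume "r \<in> R \<and> 0 < (pr(b := pr b + 1)) r"
    then show "0 < (ow(b := Suc j)) r" using inv r by (auto simp: invar_def split: if_splits)
  next
    fix r i assume r: "r \<in> R" and o: "(ow(b := Suc j)) r = Suc i"
    have c: "(i = j \<and> r = b) \<or> (r \<noteq> b \<and> ow r = Suc i \<and> i \<noteq> j)" using o owj[OF r] by (auto split: if_splits)
    show "i \<in> L" "cf i r" using c inv r jL b by (auto simp: invar_def)
    show "mt' i = 1"
    proof (cases "i = j")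
      case False
      then have "ow r = Suc i" "r \<noteq> b" using c by auto
      then have "ow b \<noteq> Suc i" using own[OF r bR] by auto
      then show ?thesis using mt'1[of i] False \<open>ow r = Suc i\<close> inv r unfolding invar_def by metis
    qed (simp add: mt'j)
    { fix r' assume r': "r' \<in> R" "cf i r'"
      then have "r' < m" using R by auto
      show "(pr(b := pr b + 1)) r \<le> (pr(b := pr b + 1)) r' + 1"
      proof (cases "r = b")
        case True
        then have "i = j" using c by auto
        then have "pr b \<le> pr r'" using min[OF \<open>r' < m\<close>] r' by simp
        then show ?thesis using True by simp
      next
        case False
        then have "pr r \<le> pr r' + 1" using c inv r r' unfolding invar_def by blast
        then show ?thesis using False by (cases "r' = b") auto
      qed }
    fix r' assume r': "r' \<in> R" "(ow(b := Suc j)) r' = Suc i"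
    then show "r' = r" using c own[OF r r'(1)] owj[OF r'(1)] by (auto split: if_splits)
  qed
qed

text \<open>Weak duality. A matched good lies outside \<open>B\<close>, or its owner lies outside
  \<open>A\<close>; since owners are distinct, the matching has at most
  \<open>card (R - B) + card (L - A)\<close> edges.\<close>

lemma matched_le:
  assumes inv: "invar mt ow pr" and A: "A \<subseteq> L" and B: "B \<subseteq> R"
    and ind: "\<And>l r. l \<in> A \<Longrightarrow> r \<in> B \<Longrightarrow> \<not> cf l r"
  shows "card A + card B + card {r. r < m \<and> 0 < ow r} \<le> card L + card R"
proof -
  let ?M = "{r. r < m \<and> 0 < ow r}"
  have fin: "finite L" "finite R" using L R by (auto intro: finite_subset)
  have MR: "?M \<subseteq> R" using invar_not_in_R[OF inv] by fastforce
  have "card ?M = card (?M - B) + card (?M \<inter> B)"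
    using card_Int_Diff[of ?M B] by simp
  also have "card (?M - B) \<le> card (R - B)"
    by (rule card_mono) (use fin MR in auto)
  also have "card (?M \<inter> B) \<le> card (L - A)"
  proof (rule card_inj_on_le[where f = "\<lambda>r. ow r - 1"])
    have o: "ow r = Suc (ow r - 1)" "r \<in> R" if "r \<in> ?M" for r using that MR by auto
    show "inj_on (\<lambda>r. ow r - 1) (?M \<inter> B)"
    proof (rule inj_onI)
      fix r r' assume "r \<in> ?M \<inter> B" "r' \<in> ?M \<inter> B" "ow r - 1 = ow r' - 1"
      then show "r = r'" using o[of r] o[of r'] inv unfolding invar_def by (metis IntD1)
    qed
    show "(\<lambda>r. ow r - 1) ` (?M \<inter> B) \<subseteq> L - A"
    proof
      fix l assume "l \<in> (\<lambda>r. ow r - 1) ` (?M \<inter> B)"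
      then obtain r where r: "r \<in> ?M" "r \<in> B" "l = ow r - 1" by auto
      then have "l \<in> L" "cf l r" using o[of r] inv unfolding invar_def by blast+
      then show "l \<in> L - A" using ind r by auto
    qed
  qed (use fin in simp)
  finally have "card ?M \<le> card (R - B) + card (L - A)" by simp
  moreover have "card (R - B) + card B = card R" "card (L - A) + card A = card L"
    using A B fin by (simp_all add: card_Diff_subset finite_subset card_mono)
  ultimately show ?thesis by simp
qed

text \<open>Some price \<open>p \<le> m + 1\<close> is not taken. As no matched bidder could save more than one unit by
  switching, no matched edge crosses this gap, which yields a vertex cover as large as the matching.\<close>

lemma matched_ge:
  assumes inv: "invar mt ow pr" and fl: "final mt pr"
  obtains A B where "A \<subseteq> L" "B \<subseteq> R" "\<And>l r. l \<in> A \<Longrightarrow> r \<in> B \<Longrightarrow> \<not> cf l r"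
    "card L + card R \<le> card A + card B + card {r. r < m \<and> 0 < ow r}"
proof -
  let ?M = "{r. r < m \<and> 0 < ow r}"
  have fin: "finite L" "finite R" using L R by (auto intro: finite_subset)
  \<comment> \<open>Pigeonhole: at most \<open>m\<close> of the \<open>m + 1\<close> candidates are
    prices. \<open>1 \<le> p\<close> makes every good outside the set \<open>B\<close> below an
    owned one, and \<open>p \<le> m + 1\<close> puts every unmatched bidder into
    \<open>A\<close>.\<close>
  have "card (pr ` R) \<le> m"
    using card_image_le[OF fin(2), of pr] card_mono[OF _ R] by simp
  then have "\<not> {1..m+1} \<subseteq> pr ` R"
    using card_mono[of "pr ` R" "{1..m+1}"] fin(2) by auto
  then obtain p where p: "1 \<le> p" "p \<le> m + 1" "p \<notin> pr ` R" by (auto simp only: subset_iff atLeastAtMost_iff)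
  define B where "B = {r \<in> R. pr r < p}"
  define A where "A = {l \<in> L. \<forall>r\<in>R. cf l r \<longrightarrow> p \<le> pr r}"
  have AB: "A \<subseteq> L" "B \<subseteq> R" by (auto simp: A_def B_def)
  have ind: "\<not> cf l r" if "l \<in> A" "r \<in> B" for l r using that by (auto simp: A_def B_def)
  have "R - B \<subseteq> ?M - B"
  proof
    fix r assume r: "r \<in> R - B"
    then have "0 < pr r" "r < m" using p R by (auto simp: B_def)
    then show "r \<in> ?M - B" using r inv by (auto simp: invar_def)
  qed
  then have 1: "card (R - B) \<le> card (?M - B)" by (intro card_mono) auto
  have "L - A \<subseteq> (\<lambda>r. ow r - 1) ` (?M \<inter> B)"
  proof
    fix l assume l: "l \<in> L - A"
    then have lm: "l < m" using L by auto
    from l obtain r where r: "r \<in> R" "cf l r" "pr r < p" by (auto simp: A_def not_le)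
    then have "mt l \<noteq> 0" using fl lm p R unfolding final_def by fastforce
    then have "mt l = 1" using inv lm unfolding invar_def by (metis le_antisym less_one not_le)
    then obtain r' where r': "r' \<in> R" "ow r' = Suc l" using inv l lm unfolding invar_def by blast
    then have "pr r' \<le> pr r + 1" using inv r unfolding invar_def by blast
    moreover have "pr r' \<noteq> p" using p(3) r' by auto
    ultimately have "pr r' < p" using r by linarith
    then show "l \<in> (\<lambda>r. ow r - 1) ` (?M \<inter> B)"
      using r' R by (intro image_eqI[of _ _ r']) (auto simp: B_def)
  qed
  then have "card (L - A) \<le> card ((\<lambda>r. ow r - 1) ` (?M \<inter> B))" by (intro card_mono) auto
  also have "\<dots> \<le> card (?M \<inter> B)" by (rule card_image_le) simp
  finally have 2: "card (L - A) \<le> card (?M \<inter> B)" .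
  have "card ?M = card (?M - B) + card (?M \<inter> B)"
    using card_Int_Diff[of ?M B] by simp
  moreover have "card (R - B) + card B = card R" "card (L - A) + card A = card L"
    using AB fin by (simp_all add: card_Diff_subset finite_subset card_mono)
  ultimately have "card L + card R \<le> card A + card B + card ?M" using 1 2 by simp
  then show thesis using that AB ind by blast
qed

end

section \<open>Small subsets\<close>

text \<open>Weighting subsets of size \<open>i\<close> by \<open>2 ^ (u/3 - i) \<ge> 1\<close> gives the bound
  \<open>(3/2 * 2 powr (1/3)) ^ u\<close>, and \<open>(3/2) ^ 3 * 2 = 6.75 < 1.89 ^ 3\<close>. Cubing avoids the roots.\<close>

lemma card_small_subsets:
  assumes "finite U"
  shows "real (card {S. S \<subseteq> U \<and> 3 * card S \<le> card U}) \<le> 1.89 ^ card U"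
proof -
  let ?F = "{S. S \<subseteq> U \<and> 3 * card S \<le> card U}"
  define u where "u = card U"
  have p: "(x ^ a) ^ b = (x ^ b) ^ a" for x :: real and a b
    by (simp add: mult.commute flip: power_mult)
  have sub: "(\<Sum>S\<in>Pow U. (1/2::real) ^ card S) = (3/2) ^ card U"
    using prod_add[OF assms, of "\<lambda>_. 1/2::real" "\<lambda>_. 1"] by simp
  have "real (card ?F) * (1/2) ^ (u div 3) = (\<Sum>S\<in>?F. (1/2) ^ (u div 3))" by simp
  also have "\<dots> \<le> (\<Sum>S\<in>?F. (1/2) ^ card S)"
    by (intro sum_mono power_decreasing) (auto simp: u_def)
  also have "\<dots> \<le> (\<Sum>S\<in>Pow U. (1/2) ^ card S)"
    by (intro sum_mono2) (use assms in auto)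
  also have "\<dots> = (3/2) ^ u" using sub by (simp add: u_def)
  finally have "real (card ?F) \<le> (3/2) ^ u * 2 ^ (u div 3)"
    by (simp add: power_divide field_simps)
  then have "real (card ?F) ^ 3 \<le> ((3/2) ^ u * 2 ^ (u div 3)) ^ 3"
    by (intro power_mono) auto
  also have "\<dots> = ((3/2) ^ 3) ^ u * 2 ^ (3 * (u div 3))"
    by (simp only: power_mult_distrib p[of "3/2" u 3] power_mult[of 2 3 "u div 3"] p[of 2 "u div 3" 3])
  also have "\<dots> = (27/8) ^ u * 2 ^ (3 * (u div 3))"
    by (simp add: power3_eq_cube)
  also have "\<dots> \<le> (27/8) ^ u * 2 ^ u"
    by (intro mult_left_mono power_increasing) auto
  also have "\<dots> = (27/4) ^ u" by (simp add: power_mult_distrib[symmetric])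
  also have "\<dots> \<le> (1.89 ^ 3) ^ u" by (intro power_mono) (auto simp: power3_eq_cube)
  also have "\<dots> = (1.89 ^ u) ^ 3" by (rule p)
  finally show ?thesis unfolding u_def by (rule power_le_imp_le_base[of _ 2, simplified]) simp_all
qed

section \<open>Precolored set families\<close>

text \<open>Both problems ask for an extension of the precoloring \<open>col\<close> (with \<open>0\<close> for
  uncolored vertices) that makes many of the sets \<open>{x. mem j x}\<close>, for the valid indices
  \<open>j < m\<close>, monochromatic: edges for MHE, closed neighborhoods for MHV.\<close>

locale set_family =
  fixes n m k :: nat and val :: "nat \<Rightarrow> bool" and mem :: "nat \<Rightarrow> nat \<Rightarrow> bool" and col :: "nat \<Rightarrow> nat"
  assumes col_le: "x < n \<Longrightarrow> col x \<le> k"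
begin

text \<open>A number \<open>X < 2 ^ card free\<close> encodes the subset \<open>dec X\<close> of \<open>free\<close>: bit \<open>rk x\<close> stands for \<open>x\<close>.\<close>

definition free :: "nat set" where "free = {x. x < n \<and> col x = 0}"
definition rk :: "nat \<Rightarrow> nat" where "rk x = card {y. y < x \<and> col y = 0}"
definition dec :: "nat \<Rightarrow> nat set" where "dec X = {x \<in> free. odd (X div 2 ^ rk x)}"

definition sat :: "nat \<Rightarrow> nat set \<Rightarrow> nat \<Rightarrow> bool" where
  "sat i S j \<longleftrightarrow> val j \<and> (\<forall>x<n. mem j x \<longrightarrow> col x = i \<or> x \<in> S)"

definition sats :: "nat \<Rightarrow> nat set \<Rightarrow> nat set" where "sats i S = {j. j < m \<and> sat i S j}"

definition ext :: "(nat \<Rightarrow> nat) \<Rightarrow> bool" where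
  "ext c \<longleftrightarrow> (\<forall>x<n. c x \<in> {1..k} \<and> (col x \<noteq> 0 \<longrightarrow> c x = col x))"

definition cls :: "(nat \<Rightarrow> nat) \<Rightarrow> nat \<Rightarrow> nat set" where "cls c i = {x \<in> free. c x = i}"

definition score :: "(nat \<Rightarrow> nat) \<Rightarrow> nat" where "score c = (\<Sum>i=1..k. card (sats i (cls c i)))"

definition good :: "nat \<Rightarrow> bool" where "good t \<longleftrightarrow> (\<exists>c. ext c \<and> t \<le> score c)"

lemma finite_free [simp]: "finite free" by (simp add: free_def)

lemma finite_sats [simp]: "finite (sats i S)" by (simp add: sats_def)

lemma sats_subset: "sats i S \<subseteq> {..<m}" by (auto simp: sats_def)

lemma card_sats_le: "card (sats i S) \<le> m"
  using card_mono[OF _ sats_subset] by simp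

lemma card_free_le: "card free \<le> n"
  using card_mono[of "{..<n}" free] by (auto simp: free_def)

lemma free_lt: "x \<in> free \<Longrightarrow> x < n" by (simp add: free_def)

lemma cls_subset: "cls c i \<subseteq> free" by (auto simp: cls_def)

section \<open>Ranks and bit masks of the uncolored vertices\<close>

lemma rk_Suc: "rk (Suc x) = (if col x = 0 then Suc (rk x) else rk x)"
proof -
  have "{y. y < Suc x \<and> col y = 0} = (if col x = 0 then {x} else {}) \<union> {y. y < x \<and> col y = 0}"
    by (auto simp: less_Suc_eq)
  then show ?thesis by (simp add: rk_def)
qed

lemma rk_0 [simp]: "rk 0 = 0" by (simp add: rk_def)

lemma rk_n: "rk n = card free" by (simp add: rk_def free_def)

lemma rk_mono: "x \<le> y \<Longrightarrow> rk x \<le> rk y"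
  unfolding rk_def by (intro card_mono) auto

lemma rk_lt: "x \<in> free \<Longrightarrow> x < y \<Longrightarrow> rk x < rk y"
  using rk_mono[of "Suc x" y] by (simp add: rk_Suc free_def)

lemma bij_rk: "bij_betw rk free {..<card free}"
proof -
  have inj: "inj_on rk free" by (rule inj_onI) (metis rk_lt linorder_neqE_nat less_irrefl)
  have "rk ` free \<subseteq> {..<card free}" using rk_lt[of _ n] by (auto simp: rk_n free_lt)
  moreover have "card (rk ` free) = card free" by (rule card_image[OF inj])
  ultimately have "rk ` free = {..<card free}" by (metis card_lessThan card_subset_eq finite_lessThan)
  with inj show ?thesis by (simp add: bij_betw_def)
qed

lemma rk_free: "x \<in> free \<Longrightarrow> rk x < card free"
  using bij_rk by (auto simp: bij_betw_def)

lemma dec_set_decode: "dec X = {x \<in> free. rk x \<in> set_decode X}"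
  by (simp add: dec_def set_decode_def)

lemma set_decode_subset: "X < 2 ^ u \<Longrightarrow> set_decode X \<subseteq> {..<u}"
proof
  fix i assume X: "X < 2 ^ u" and i: "i \<in> set_decode X"
  show "i \<in> {..<u}"
  proof (rule ccontr)
    assume "i \<notin> {..<u}"
    then have "X < 2 ^ i" using X less_le_trans[of X "2 ^ u" "2 ^ i"] by simp
    then show False using i by (simp add: set_decode_def)
  qed
qed

lemma less_power_iff_set_decode: "X < 2 ^ u \<longleftrightarrow> set_decode X \<subseteq> {..<u}"
proof
  assume "set_decode X \<subseteq> {..<u}"
  then have "(\<Sum>i\<in>set_decode X. 2 ^ i) \<le> (\<Sum>i<u. 2 ^ i :: nat)" by (intro sum_mono2) auto
  then have "X \<le> (\<Sum>i<u. 2 ^ i)" using set_decode_inverse[of X] by (simp add: set_encode_def)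
  also have "\<dots> < 2 ^ u" by (induction u) auto
  finally show "X < 2 ^ u" .
qed (rule set_decode_subset)

lemma dec_subset: "dec X \<subseteq> free" by (auto simp: dec_def)

lemma finite_dec [simp]: "finite (dec X)" by (rule finite_subset[OF dec_subset finite_free])

lemma dec_0 [simp]: "dec 0 = {}" by (simp add: dec_def)

text \<open>The machine has no bit operations. A single vertex is removed from or added to a mask by
  subtracting or adding its power of two, which is free of carries because the bit is known.\<close>

lemma dec_diff:
  assumes X: "X < 2 ^ card free" and x: "x \<in> dec X"
  shows "2 ^ rk x \<le> X" "dec (X - 2 ^ rk x) = dec X - {x}"
proof -
  have "odd (X div 2 ^ rk x)" using x by (simp add: dec_def)
  then have 1: "X div 2 ^ rk x \<noteq> 0" by (metis even_zero)
  then show le: "2 ^ rk x \<le> X" by (simp add: div_eq_0_iff)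
  define Z where "Z = X - 2 ^ rk x"
  have XZ: "X = 2 ^ rk x + Z" using le by (simp add: Z_def)
  have "Suc (Z div 2 ^ rk x) = X div 2 ^ rk x" unfolding XZ by (simp add: div_add_self1)
  then have "even (Z div 2 ^ rk x)" using \<open>odd (X div 2 ^ rk x)\<close> by (metis even_Suc)
  then have "rk x \<notin> set_decode Z" by (simp add: set_decode_def)
  then have s: "set_decode X = insert (rk x) (set_decode Z)" "rk x \<notin> set_decode Z"
    unfolding XZ by (simp_all add: set_decode_plus_power_2)
  have "rk y = rk x \<longleftrightarrow> y = x" if "y \<in> free" for y
    using that x dec_subset bij_rk by (auto simp: bij_betw_def inj_on_def)
  then show "dec (X - 2 ^ rk x) = dec X - {x}"
    using s by (auto simp: dec_set_decode Z_def[symmetric])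
qed

lemma dec_add:
  assumes X: "X < 2 ^ card free" and x: "x \<in> free" "x \<notin> dec X"
  shows "X + 2 ^ rk x < 2 ^ card free" "dec (X + 2 ^ rk x) = insert x (dec X)"
proof -
  have "rk x \<notin> set_decode X" using x by (simp add: dec_set_decode)
  then have s: "set_decode (X + 2 ^ rk x) = insert (rk x) (set_decode X)"
    by (metis add.commute set_decode_plus_power_2)
  then show "X + 2 ^ rk x < 2 ^ card free"
    using X rk_free[OF x(1)] by (simp add: less_power_iff_set_decode)
  have "rk y = rk x \<longleftrightarrow> y = x" if "y \<in> free" for y
    using that x bij_rk by (auto simp: bij_betw_def inj_on_def)
  then show "dec (X + 2 ^ rk x) = insert x (dec X)"
    using s x by (auto simp: dec_set_decode)
qed

section \<open>Colorings as partitions and as independent sets\<close>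

lemma sat_cls: "ext c \<Longrightarrow> i \<noteq> 0 \<Longrightarrow> sat i (cls c i) j \<longleftrightarrow> val j \<and> (\<forall>x<n. mem j x \<longrightarrow> c x = i)"
proof -
  assume "ext c" "i \<noteq> 0"
  then have "col x = i \<or> x \<in> cls c i \<longleftrightarrow> c x = i" if "x < n" for x
    using that by (cases "col x = 0") (auto simp: ext_def cls_def free_def)
  then show ?thesis by (auto simp: sat_def)
qed

text \<open>A cover whose sizes add up to \<open>card free\<close> is a partition. To see this,
  color each vertex by some set containing it: the resulting classes lie inside the sets
  \<open>\<sigma> i\<close> and have the same total size, hence they are equal to them.\<close>

lemma good_partition:
  "good t \<longleftrightarrow> (\<exists>\<sigma>\<in>{1..k} \<rightarrow>\<^sub>E Pow free. free \<subseteq> \<Union> (\<sigma> ` {1..k}) \<and>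
     (\<Sum>i\<in>{1..k}. card (\<sigma> i)) = card free \<and> t \<le> (\<Sum>i\<in>{1..k}. card (sats i (\<sigma> i))))"
    (is "_ \<longleftrightarrow> (\<exists>\<sigma>\<in>_. ?P \<sigma>)")
proof
  assume "good t"
  then obtain c where c: "ext c" "t \<le> score c" by (auto simp: good_def)
  define \<sigma> where "\<sigma> = restrict (cls c) {1..k}"
  have s: "\<sigma> i = cls c i" if "i \<in> {1..k}" for i using that by (simp add: \<sigma>_def)
  have U: "(\<Union>i\<in>{1..k}. cls c i) = free"
    using c(1) by (auto simp: cls_def ext_def free_def)
  have "(\<Sum>i\<in>{1..k}. card (cls c i)) = card free"
    unfolding U[symmetric] by (subst card_UN_disjoint) (auto simp: cls_def)
  then have "?P \<sigma>" using c(2) U s by (simp add: score_def)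
  moreover have "\<sigma> \<in> {1..k} \<rightarrow>\<^sub>E Pow free" using cls_subset by (auto simp: \<sigma>_def)
  ultimately show "\<exists>\<sigma>\<in>{1..k} \<rightarrow>\<^sub>E Pow free. ?P \<sigma>" by blast
next
  assume "\<exists>\<sigma>\<in>{1..k} \<rightarrow>\<^sub>E Pow free. ?P \<sigma>"
  then obtain \<sigma> where sub: "\<And>i. i \<in> {1..k} \<Longrightarrow> \<sigma> i \<subseteq> free" and P: "?P \<sigma>"
    by (auto simp: PiE_def Pi_def)
  define c where "c x = (if col x \<noteq> 0 then col x else SOME i. i \<in> {1..k} \<and> x \<in> \<sigma> i)" for x
  have c: "c x \<in> {1..k} \<and> x \<in> \<sigma> (c x)" if "x \<in> free" for x
  proof -
    have "\<exists>i. i \<in> {1..k} \<and> x \<in> \<sigma> i" using conjunct1[OF P] that by blast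
    from someI_ex[OF this] show ?thesis using that by (simp add: c_def free_def)
  qed
  have "ext c" unfolding ext_def
  proof (intro allI impI conjI)
    fix x assume x: "x < n"
    show "c x \<in> {1..k}"
    proof (cases "col x = 0")
      case True
      then show ?thesis using c x by (simp add: free_def)
    next
      case False
      then show ?thesis using col_le[OF x] by (simp add: c_def)
    qed
  qed (simp add: c_def)
  have le: "cls c i \<subseteq> \<sigma> i" for i using c by (auto simp: cls_def)
  have fin: "finite (\<sigma> i)" if "i \<in> {1..k}" for i using sub[OF that] by (rule finite_subset) simp
  have U: "(\<Union>i\<in>{1..k}. cls c i) = free" using c by (auto simp: cls_def)
  have "(\<Sum>i\<in>{1..k}. card (cls c i)) = card free"
    unfolding U[symmetric] by (subst card_UN_disjoint) (auto simp: cls_def)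
  then have "card (cls c i) = card (\<sigma> i)" if "i \<in> {1..k}" for i
    using sum_mono_inv[of "\<lambda>i. card (cls c i)" "{1..k}" "\<lambda>i. card (\<sigma> i)" i] P that
      card_mono[OF fin le] by auto
  then have "cls c i = \<sigma> i" if "i \<in> {1..k}" for i
    using that card_subset_eq[OF fin le] by simp
  then have "t \<le> score c" using P by (simp add: score_def)
  with \<open>ext c\<close> show "good t" by (auto simp: good_def)
qed

lemma three_distinct:
  assumes "{i, a, b} = {1, 2, 3::nat}"
  shows "i \<noteq> a \<and> i \<noteq> b \<and> a \<noteq> b"
proof -
  have "card {i, a, b} = 3" by (simp add: assms)
  then show ?thesis by (auto simp: card_insert_if split: if_splits)
qed

definition conflict :: "nat \<Rightarrow> nat \<Rightarrow> bool" where
  "conflict j r \<longleftrightarrow> (\<exists>x<n. mem j x \<and> mem r x)"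

text \<open>Once the first color class is fixed to \<open>S\<close>, the sets that are monochromatic in one of the
  other two colors form an independent set in the bipartite conflict graph, and conversely.\<close>

lemma three_coloring_independent:
  assumes k: "k = 3" and abi: "{i, a, b} = {1, 2, 3}" and c: "ext c" and S: "cls c i = S"
  obtains A B where "A \<subseteq> sats a (free - S)" "B \<subseteq> sats b (free - S)"
    "\<And>l r. l \<in> A \<Longrightarrow> r \<in> B \<Longrightarrow> \<not> conflict l r" "score c = card (sats i S) + card A + card B"
proof
  have ne: "i \<noteq> a" "i \<noteq> b" "a \<noteq> b" using three_distinct[OF abi] by auto
  have "a \<in> {1, 2, 3}" "b \<in> {1, 2, 3}" using abi by auto
  then have ne0: "a \<noteq> 0" "b \<noteq> 0" by auto
  show "sats a (cls c a) \<subseteq> sats a (free - S)" "sats b (cls c b) \<subseteq> sats b (free - S)"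
    using ne S by (auto simp: sats_def sat_def cls_def)
  show "\<not> conflict l r" if "l \<in> sats a (cls c a)" "r \<in> sats b (cls c b)" for l r
  proof -
    have "\<forall>x<n. mem l x \<longrightarrow> c x = a" "\<forall>x<n. mem r x \<longrightarrow> c x = b"
      using that sat_cls[OF c ne0(1)] sat_cls[OF c ne0(2)] by (simp_all add: sats_def)
    then show ?thesis using ne(3) by (metis conflict_def)
  qed
  have "{1..k} = {i, a, b}" unfolding k abi by auto
  then show "score c = card (sats i S) + card (sats a (cls c a)) + card (sats b (cls c b))"
    using ne S by (simp add: score_def)
qed

lemma independent_three_coloring:
  assumes k: "k = 3" and abi: "{i, a, b} = {1, 2, 3}" and S: "S \<subseteq> free"
    and A: "A \<subseteq> sats a (free - S)" and B: "B \<subseteq> sats b (free - S)"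
    and ind: "\<And>l r. l \<in> A \<Longrightarrow> r \<in> B \<Longrightarrow> \<not> conflict l r"
  obtains c where "ext c" "card (sats i S) + card A + card B \<le> score c"
proof
  have ne: "i \<noteq> a" "i \<noteq> b" "a \<noteq> b" using three_distinct[OF abi] by auto
  \<comment> \<open>Color \<open>a\<close> goes only where a set of \<open>A\<close> requires it,
    and \<open>b\<close> is the default outside \<open>S\<close>. By independence no uncolored
    vertex of a set in \<open>B\<close> receives \<open>a\<close>.\<close>
  define c where "c x = (if col x \<noteq> 0 then col x else if x \<in> S then i
     else if \<exists>l\<in>A. mem l x then a else b)" for x
  have "i \<in> {1, 2, 3}" "a \<in> {1, 2, 3}" "b \<in> {1, 2, 3}" using abi by auto
  then have "i \<in> {1..k}" "a \<in> {1..k}" "b \<in> {1..k}" using k by auto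
  then show "ext c" using col_le by (auto simp: ext_def c_def)
  have "cls c i = S" using S ne by (auto simp: cls_def c_def free_def)
  moreover have "card A \<le> card (sats a (cls c a))"
  proof (rule card_mono)
    show "A \<subseteq> sats a (cls c a)"
    proof
      fix l assume l: "l \<in> A"
      then have *: "col x = a \<or> x \<in> free - S" if "x < n" "mem l x" for x
        using that A by (auto simp: sats_def sat_def)
      have "col x = a \<or> x \<in> cls c a" if "x < n" "mem l x" for x
        using that l *[OF that] by (auto simp: cls_def c_def free_def)
      then show "l \<in> sats a (cls c a)" using l A by (auto simp: sats_def sat_def)
    qed
  qed simp
  moreover have "card B \<le> card (sats b (cls c b))"
  proof (rule card_mono)
    show "B \<subseteq> sats b (cls c b)"
    proof
      fix r assume r: "r \<in> B"
      then have nA: "\<not> (\<exists>l\<in>A. mem l x)" if "x < n" "mem r x" for x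
        using that ind by (auto simp: conflict_def)
      have *: "col x = b \<or> x \<in> free - S" if "x < n" "mem r x" for x
        using that r B by (auto simp: sats_def sat_def)
      have "col x = b \<or> x \<in> cls c b" if "x < n" "mem r x" for x
        using nA[OF that] *[OF that] by (auto simp: cls_def c_def free_def)
      then show "r \<in> sats b (cls c b)" using r B by (auto simp: sats_def sat_def)
    qed
  qed simp
  moreover have "{1..k} = {i, a, b}" unfolding k abi by auto
  ultimately show "card (sats i S) + card A + card B \<le> score c"
    using ne by (simp add: score_def)
qed

lemma small_class:
  assumes "ext c" "k = 3"
  obtains i where "i \<in> {1, 2, 3}" "3 * card (cls c i) \<le> card free"
proof -
  have U: "(\<Union>i\<in>{1..k}. cls c i) = free"
    using assms(1) by (auto simp: cls_def ext_def free_def)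
  have "(\<Sum>i\<in>{1..k}. card (cls c i)) = card free"
    unfolding U[symmetric] by (subst card_UN_disjoint) (auto simp: cls_def)
  then have "card (cls c 1) + card (cls c 2) + card (cls c 3) = card free"
    using assms(2) by (simp add: eval_nat_numeral)
  then have "3 * card (cls c 1) \<le> card free \<or> 3 * card (cls c 2) \<le> card free \<or> 3 * card (cls c 3) \<le> card free"
    by linarith
  then show thesis using that by auto
qed

lemma ext_exists: "1 \<le> k \<Longrightarrow> \<exists>c. ext c"
  using col_le by (intro exI[of _ "\<lambda>x. if col x = 0 then 1 else col x"]) (auto simp: ext_def)

end

section \<open>Counting satisfied sets\<close>

definition in_mask :: bexp where
  "in_mask = Conj (Equal (Get ''c'' (V ''x'')) (Const 0))
     (Equal (Rem (Quot (V ''X'') (Get ''w'' (V ''x''))) (Const 2)) (Const 1))"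

fun mask_test :: "bool \<Rightarrow> bexp" where
  "mask_test True = in_mask"
| "mask_test False = Conj (Equal (Get ''c'' (V ''x'')) (Const 0)) (Neg in_mask)"

definition test :: "bool \<Rightarrow> com" where
  "test b = ''t'' ::= Get ''v'' (V ''j'') ;;
     For ''x'' (V ''n'')
       (If (Conj (Equal (Get ''h'' (Add (Mul (V ''j'') (V ''n'')) (V ''x''))) (Const 1))
             (Conj (Neg (Equal (Get ''c'' (V ''x'')) (V ''i''))) (Neg (mask_test b))))
          (''t'' ::= Const 0) Skip)"

text \<open>The count is added to \<open>s\<close>, so that consecutive calls accumulate. The array
  \<open>a\<close> receives the characteristic function of the satisfied sets, from which the
  auction later takes its bidders and goods.\<close>

definition count :: "bool \<Rightarrow> vname \<Rightarrow> com" where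
  "count b a = For ''j'' (V ''m'') (test b ;; Assign a (V ''j'') (V ''t'') ;; ''s'' ::= Add (V ''s'') (V ''t''))"

lemma writes_test [simp]: "writes (test b) = {''t'', ''x''}"
  by (auto simp: test_def)

lemma writes_count [simp]: "writes (count b a) = {''t'', ''x'', ''j'', ''s'', a}"
  by (auto simp: count_def)

definition env_names :: "vname set" where [simp]:
  "env_names = {''n'', ''m'', ''u'', ''P'', ''c'', ''w'', ''v'', ''h''}"

context set_family
begin

text \<open>The tables derived from the input. The search programs never write to
  \<open>env_names\<close>, so \<open>env\<close> passes through every loop by its frame
  alone.\<close>

definition env :: "state \<Rightarrow> bool" where
  "env s \<longleftrightarrow> s ''n'' 0 = n \<and> s ''m'' 0 = m \<and> s ''u'' 0 = card free \<and> s ''P'' 0 = 2 ^ card free \<and>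
     (\<forall>x<n. s ''c'' x = col x) \<and> (\<forall>x\<in>free. s ''w'' x = 2 ^ rk x) \<and>
     (\<forall>j<m. s ''v'' j = of_bool (val j)) \<and> (\<forall>j<m. \<forall>x<n. s ''h'' (j * n + x) = of_bool (mem j x))"

lemma env_frame: "frame X s s' \<Longrightarrow> X \<inter> env_names = {} \<Longrightarrow> env s' = env s"
proof -
  assume "frame X s s'" "X \<inter> env_names = {}"
  then have "\<forall>y\<in>env_names. s' y = s y" by (auto simp: frame_def)
  then show ?thesis unfolding env_def env_names_def by simp
qed

lemma env_mono: "env s \<Longrightarrow> frame X s s' \<Longrightarrow> X \<inter> env_names = {} \<Longrightarrow> env s'"
  by (simp add: env_frame)

lemma env_upd [simp]: "y \<notin> env_names \<Longrightarrow> env (s(y := f)) = env s"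
  by (rule env_frame[of "{y}"]) (auto simp: frame_def)

lemma bval_in_mask: "env s \<Longrightarrow> s ''x'' 0 < n \<Longrightarrow> bval in_mask s \<longleftrightarrow> s ''x'' 0 \<in> dec (s ''X'' 0)"
  by (auto simp: in_mask_def env_def dec_def free_def odd_iff_mod_2_eq_one)

fun mask_set :: "bool \<Rightarrow> nat \<Rightarrow> nat set" where
  "mask_set True X = dec X"
| "mask_set False X = free - dec X"

lemma bval_mask_test:
  "env s \<Longrightarrow> s ''x'' 0 < n \<Longrightarrow> bval (mask_test b) s \<longleftrightarrow> s ''x'' 0 \<in> mask_set b (s ''X'' 0)"
  by (cases b) (auto simp: bval_in_mask, auto simp: env_def free_def)

lemma ok_test:
  assumes e: "env s" and j: "s ''j'' 0 < m" and D: "n < 2 ^ D" "0 < D"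
  shows "ok D (test b) (n * 5 + 3)
    (\<lambda>s'. s' ''t'' 0 = of_bool (sat (s ''i'' 0) (mask_set b (s ''X'' 0)) (s ''j'' 0))) s"
  unfolding test_def
proof (rule ok_steps, rule ok_Seq, rule ok_Assign)
  let ?j = "s ''j'' 0" and ?S = "mask_set b (s ''X'' 0)"
  have v: "s ''v'' ?j = of_bool (val ?j)" using e j by (simp add: env_def)
  have one: "(1::nat) < 2 ^ D" using D one_less_power[of "2::nat" D] by simp
  show "aval (Get ''v'' (V ''j'')) s < 2 ^ D" using v one by simp
  let ?s = "s(''t'' := (s ''t'')(aval (Const 0) s := aval (Get ''v'' (V ''j'')) s))"
  show "ok D (For ''x'' (V ''n'')
       (If (Conj (Equal (Get ''h'' (Add (Mul (V ''j'') (V ''n'')) (V ''x''))) (Const 1))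
             (Conj (Neg (Equal (Get ''c'' (V ''x'')) (V ''i''))) (Neg (mask_test b))))
          (''t'' ::= Const 0) Skip)) (n * ((1 + 1 + 1) + 2) + 2)
     (\<lambda>s'. s' ''t'' 0 = of_bool (sat (s ''i'' 0) ?S ?j)) ?s"
  proof (rule ok_For[where I = "\<lambda>i s'. s' ''t'' 0 =
       of_bool (val ?j \<and> (\<forall>x<i. mem ?j x \<longrightarrow> col x = s ''i'' 0 \<or> x \<in> ?S))"])
    fix s' assume f: "frame (insert ''x'' (writes (If (Conj (Equal (Get ''h'' (Add (Mul (V ''j'') (V ''n'')) (V ''x''))) (Const 1))
             (Conj (Neg (Equal (Get ''c'' (V ''x'')) (V ''i''))) (Neg (mask_test b))))
          (''t'' ::= Const 0) Skip))) ?s s'"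
    have e': "env s'" using env_frame[OF f] e by simp
    show "aval (V ''n'') s' = n" using e' by (simp add: env_def)
    note fr = frameD[OF f]
    {
      fix i assume i: "i < n" "s' ''x'' 0 = i"
        and I: "s' ''t'' 0 = of_bool (val ?j \<and> (\<forall>x<i. mem ?j x \<longrightarrow> col x = s ''i'' 0 \<or> x \<in> ?S))"
      have 1: "s' ''c'' i = col i" "s' ''h'' (?j * n + i) = of_bool (mem ?j i)" "s' ''n'' 0 = n"
        using e' i j by (simp_all add: env_def)
      have 2: "bval (mask_test b) s' \<longleftrightarrow> i \<in> ?S" using bval_mask_test[OF e'] i by (simp add: fr)
      show "ok D (If (Conj (Equal (Get ''h'' (Add (Mul (V ''j'') (V ''n'')) (V ''x''))) (Const 1))
             (Conj (Neg (Equal (Get ''c'' (V ''x'')) (V ''i''))) (Neg (mask_test b))))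
          (''t'' ::= Const 0) Skip) (1 + 1 + 1)
         (\<lambda>s''. (put ''x'' (Suc i) s'') ''t'' 0 =
             of_bool (val ?j \<and> (\<forall>x<Suc i. mem ?j x \<longrightarrow> col x = s ''i'' 0 \<or> x \<in> ?S))) s'"
        by (intro ok_If ok_Assign ok_Skip) (use I 1 2 i in \<open>auto simp: fr less_Suc_eq\<close>)
    }
  qed (use D v in \<open>auto simp: sat_def\<close>)
qed simp

lemma ok_count:
  assumes e: "env s" and D: "n < 2 ^ D" "0 < D" "m < 2 ^ D" "s ''s'' 0 + m < 2 ^ D"
    and a: "a \<notin> env_names \<union> {''t'', ''x'', ''j'', ''s'', ''i'', ''X''}"
  shows "ok D (count b a) (m * (n * 5 + 7) + 2)
    (\<lambda>s'. s' ''s'' 0 = s ''s'' 0 + card (sats (s ''i'' 0) (mask_set b (s ''X'' 0))) \<and>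
       (\<forall>j<m. s' a j = of_bool (j \<in> sats (s ''i'' 0) (mask_set b (s ''X'' 0))))) s"
proof -
  let ?S = "mask_set b (s ''X'' 0)" and ?i = "s ''i'' 0"
  let ?body = "test b ;; Assign a (V ''j'') (V ''t'') ;; ''s'' ::= Add (V ''s'') (V ''t'')"
  have a': "a \<noteq> ''n''" "a \<noteq> ''m''" "a \<noteq> ''t''" "a \<noteq> ''x''" "a \<noteq> ''j''" "a \<noteq> ''s''" "a \<noteq> ''i''" "a \<noteq> ''X''"
    using a by auto
  define C where "C i = card {j. j < i \<and> sat ?i ?S j}" for i
  have card_le: "C i \<le> i" for i
    using card_mono[of "{..<i}" "{j. j < i \<and> sat ?i ?S j}"] by (auto simp: C_def)
  have card_Suc: "C (Suc i) = C i + of_bool (sat ?i ?S i)" for i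
  proof -
    have "{j. j < Suc i \<and> sat ?i ?S j} = {j. j < i \<and> sat ?i ?S j} \<union> (if sat ?i ?S i then {i} else {})"
      by (auto simp: less_Suc_eq)
    then show ?thesis by (simp add: C_def)
  qed
  have C: "C 0 = 0" "C m = card (sats ?i ?S)" by (simp_all add: C_def sats_def)
  have "ok D (count b a) (m * ((n * 5 + 3) + (1 + 1) + 2) + 2)
    (\<lambda>s'. s' ''s'' 0 = s ''s'' 0 + card (sats ?i ?S) \<and> (\<forall>j<m. s' a j = of_bool (j \<in> sats ?i ?S))) s"
    unfolding count_def
  proof (rule ok_For[where I = "\<lambda>i s'. s' ''s'' 0 = s ''s'' 0 + C i \<and>
       (\<forall>j<i. s' a j = of_bool (sat ?i ?S j))"])
    fix s' assume f: "frame (insert ''j'' (writes ?body)) s s'"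
    have e': "env s'" by (rule env_mono[OF _ f]) (use e a in auto)
    show "aval (V ''m'') s' = m" using e' by (simp add: env_def)
    note fr = frameD[OF f]
    {
      fix i assume i: "i < m" "s' ''j'' 0 = i"
        and I: "s' ''s'' 0 = s ''s'' 0 + C i \<and>
          (\<forall>j<i. s' a j = of_bool (sat ?i ?S j))"
      have ix: "s' ''i'' 0 = ?i" "s' ''X'' 0 = s ''X'' 0" using a' by (simp_all add: fr)
      show "ok D ?body ((n * 5 + 3) + (1 + 1))
         (\<lambda>s''. (put ''j'' (Suc i) s'') ''s'' 0 = s ''s'' 0 + C (Suc i) \<and>
          (\<forall>j<Suc i. (put ''j'' (Suc i) s'') a j = of_bool (sat ?i ?S j))) s'"
      proof (rule ok_Seq, rule ok_post[OF ok_test[OF e']])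
        show "s' ''j'' 0 < m" using i by simp
        fix s'' assume f2: "frame (writes (test b)) s' s''"
          and t: "s'' ''t'' 0 = of_bool (sat (s' ''i'' 0) (mask_set b (s' ''X'' 0)) (s' ''j'' 0))"
        note fr2 = frameD[OF f2]
        have ss: "s'' ''s'' 0 = s' ''s'' 0" "s'' ''j'' 0 = i" "s'' a = s' a" using a' i by (simp_all add: fr2)
        have lt: "s ''s'' 0 + C i + 1 < 2 ^ D"
          using card_le[of i] i D(4) by simp
        have t': "s'' ''t'' 0 = of_bool (sat ?i ?S i)" using t ix i by simp
        show "ok D (Assign a (V ''j'') (V ''t'') ;; ''s'' ::= Add (V ''s'') (V ''t'')) (1 + 1)
         (\<lambda>s''. (put ''j'' (Suc i) s'') ''s'' 0 = s ''s'' 0 + C (Suc i) \<and>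
          (\<forall>j<Suc i. (put ''j'' (Suc i) s'') a j = of_bool (sat ?i ?S j))) s''"
          by (intro ok_Seq ok_Assign) (use a' t' ss I lt in \<open>auto simp: card_Suc less_Suc_eq\<close>)
      qed (use D in auto)
    }
  qed (use a' D C in \<open>auto simp: sats_def\<close>)
  then show ?thesis by (rule ok_steps) (simp add: algebra_simps)
qed

end

section \<open>Inclusion-exclusion with long numbers\<close>

definition mul_pow :: "vname \<Rightarrow> vname \<Rightarrow> aexp \<Rightarrow> com" where
  "mul_pow y b h = For ''q'' h (y ::= Mul (V y) (V b))"

text \<open>With \<open>Add\<close> this is the zeta transform, with \<open>Sub\<close> the Moebius
  transform. Both work in place on a table indexed by masks, one uncolored vertex per round.\<close>

definition transform :: "vname \<Rightarrow> (aexp \<Rightarrow> aexp \<Rightarrow> aexp) \<Rightarrow> com" where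
  "transform A f = For ''x'' (V ''n'') (If (Equal (Get ''c'' (V ''x'')) (Const 0))
     (For ''X'' (V ''P'') (If in_mask
        (Assign A (V ''X'') (f (Get A (V ''X'')) (Get A (Sub (V ''X'') (Get ''w'' (V ''x'')))))) Skip)) Skip)"

definition weights :: com where
  "weights = For ''X'' (V ''P'')
     (''s'' ::= Const 0 ;; count True ''f'' ;; ''a'' ::= Const 1 ;;
      For ''x'' (V ''n'') (If in_mask (''a'' ::= Mul (V ''a'') (V ''W'')) Skip) ;;
      mul_pow ''a'' ''z'' (V ''s'') ;; Assign ''A'' (V ''X'') (V ''a''))"

text \<open>\<open>U\<close> and \<open>G\<close> hold \<open>W ^ u\<close> and \<open>W ^ u * z ^ g\<close> for the target \<open>g\<close>; \<open>T\<close> accumulates the product of the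
  zeta transforms \<open>A\<close> of the color classes.\<close>

definition partition_search :: "nat \<Rightarrow> com" where
  "partition_search k =
     ''b'' ::= Const 2 ;; ''z'' ::= Const 2 ;; mul_pow ''z'' ''b'' (Mul (Const k) (V ''n'')) ;;
     ''W'' ::= V ''z'' ;; mul_pow ''W'' ''z'' (Mul (Const k) (V ''m'')) ;;
     ''U'' ::= Const 1 ;; mul_pow ''U'' ''W'' (V ''u'') ;;
     ''G'' ::= V ''U'' ;; mul_pow ''G'' ''z'' (V ''g'') ;;
     For ''X'' (V ''P'') (Assign ''T'' (V ''X'') (Const 1)) ;;
     For ''o'' (Const k)
       (''i'' ::= Add (V ''o'') (Const 1) ;; weights ;; transform ''A'' Add ;;
        For ''X'' (V ''P'') (Assign ''T'' (V ''X'') (Mul (Get ''T'' (V ''X'')) (Get ''A'' (V ''X''))))) ;;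
     transform ''T'' Sub ;;
     If (Less (Rem (Get ''T'' (Sub (V ''P'') (Const 1))) (Mul (V ''U'') (V ''W''))) (V ''G''))
       (''out'' ::= Const 0) (''out'' ::= Const 1)"

lemma writes_mul_pow [simp]: "writes (mul_pow y b h) = {''q'', y}"
  by (auto simp: mul_pow_def)

lemma writes_transform [simp]: "writes (transform A f) = {''x'', ''X'', A}"
  by (auto simp: transform_def)

lemma writes_weights [simp]: "writes weights = {''X'', ''s'', ''t'', ''x'', ''j'', ''f'', ''a'', ''q'', ''A''}"
  by (auto simp: weights_def)

lemma ok_mul_pow:
  assumes n: "y \<noteq> b" "y \<noteq> ''q''" "b \<noteq> ''q''"
    and h: "\<And>s'. frame {''q'', y} s s' \<Longrightarrow> aval h s' = H" and HD: "H < 2 ^ D"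
    and b: "0 < s b 0" and D: "s y 0 * s b 0 ^ H < 2 ^ D"
  shows "ok D (mul_pow y b h) (H * 3 + 2) (\<lambda>s'. s' y 0 = s y 0 * s b 0 ^ H) s"
proof -
  have "ok D (mul_pow y b h) (H * (1 + 2) + 2) (\<lambda>s'. s' y 0 = s y 0 * s b 0 ^ H) s"
    unfolding mul_pow_def
  proof (rule ok_For[where I = "\<lambda>i s'. s' y 0 = s y 0 * s b 0 ^ i"])
    fix i s' assume f: "frame (insert ''q'' (writes (y ::= Mul (V y) (V b)))) s s'" and i: "i < H"
      and I: "s' y 0 = s y 0 * s b 0 ^ i"
    have b': "s' b 0 = s b 0" using frameD[OF f, of b] n by simp
    have "s b 0 ^ Suc i \<le> s b 0 ^ H" using b i by (intro power_increasing) auto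
    then have "s y 0 * s b 0 ^ Suc i < 2 ^ D" using D by (meson le_less_trans mult_le_mono2)
    then show "ok D (y ::= Mul (V y) (V b)) 1
       (\<lambda>s''. (put ''q'' (Suc i) s'') y 0 = s y 0 * s b 0 ^ Suc i) s'"
      by (intro ok_Assign) (use n I b' in \<open>auto simp: algebra_simps\<close>)
  qed (use n HD in \<open>auto intro!: h simp: insert_commute\<close>)
  then show ?thesis by (rule ok_steps) simp
qed

context set_family
begin

lemma dec_full: "dec (2 ^ card free - 1) = free"
proof -
  have "odd ((2 ^ card free - 1) div 2 ^ rk x :: nat)" if "x \<in> free" for x
    using rk_free[OF that] bit_mask_iff[of "card free" "rk x", where ?'a = nat]
    by (simp add: bit_iff_odd mask_eq_exp_minus_1)
  then show ?thesis by (auto simp: dec_def)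
qed

lemma ok_transform:
  assumes e: "env s" and D: "n < 2 ^ D" "2 ^ card free < (2 :: nat) ^ D"
    and A: "A \<notin> env_names \<union> {''x'', ''X''}"
    and f: "\<And>a b s. aval (f a b) s = h (aval a s) (aval b s)"
    and ins: "\<And>J Y x. Y \<subseteq> free \<Longrightarrow> x \<in> Y \<Longrightarrow> x \<notin> J \<Longrightarrow> G (insert x J) Y = h (G J Y) (G J (Y - {x}))"
    and outs: "\<And>J Y x. x \<notin> Y \<Longrightarrow> G (insert x J) Y = G J Y"
    and bound: "\<And>J Y. Y \<subseteq> free \<Longrightarrow> G J Y < 2 ^ D"
    and init: "\<And>X. X < 2 ^ card free \<Longrightarrow> s A X = G {} (dec X)"
  shows "ok D (transform A f) (n * (2 ^ card free * 5 + 6) + 2)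
     (\<lambda>s'. \<forall>X<2 ^ card free. s' A X = G free (dec X)) s"
proof -
  let ?P = "2 ^ card free :: nat"
  let ?upd = "If in_mask
        (Assign A (V ''X'') (f (Get A (V ''X'')) (Get A (Sub (V ''X'') (Get ''w'' (V ''x'')))))) Skip"
  let ?inner = "For ''X'' (V ''P'') ?upd"
  let ?body = "If (Equal (Get ''c'' (V ''x'')) (Const 0)) ?inner Skip"
  let ?J = "\<lambda>x. {y \<in> free. y < x}"
  have A': "A \<noteq> ''x''" "A \<noteq> ''X''" "A \<noteq> ''n''" "A \<noteq> ''P''" "A \<noteq> ''c''" "A \<noteq> ''w''"
    using A by auto
  have J_Suc: "?J (Suc x) = (if x \<in> free then insert x (?J x) else ?J x)" for x
    by (auto simp: less_Suc_eq)
  have Jn: "?J n = free" by (auto simp: free_def)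
  have "ok D (transform A f) (n * (((?P * ((1 + 1 + 1) + 2) + 2) + 1 + 1) + 2) + 2)
     (\<lambda>s'. \<forall>X<?P. s' A X = G free (dec X)) s"
    unfolding transform_def
  proof (rule ok_For[where I = "\<lambda>x s'. \<forall>X<?P. s' A X = G (?J x) (dec X)"])
    fix s' assume fr: "frame (insert ''x'' (writes ?body)) s s'"
    have e': "env s'" by (rule env_mono[OF _ fr]) (use e A in auto)
    show "aval (V ''n'') s' = n" using e' by (simp add: env_def)
    fix x assume x: "x < n" "s' ''x'' 0 = x" and I: "\<forall>X<?P. s' A X = G (?J x) (dec X)"
    have c: "s' ''c'' x = col x" using e' x by (simp add: env_def)
    show "ok D ?body ((?P * ((1 + 1 + 1) + 2) + 2) + 1 + 1)
      (\<lambda>s''. \<forall>X<?P. (put ''x'' (Suc x) s'') A X = G (?J (Suc x)) (dec X)) s'"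
    proof (rule ok_If)
      assume "bval (Equal (Get ''c'' (V ''x'')) (Const 0)) s'"
      then have xf: "x \<in> free" using x c by (simp add: free_def)
      have w: "s' ''w'' x = 2 ^ rk x" using e' xf by (simp add: env_def)
      show "ok D ?inner (?P * ((1 + 1 + 1) + 2) + 2)
        (\<lambda>s''. \<forall>X<?P. (put ''x'' (Suc x) s'') A X = G (?J (Suc x)) (dec X)) s'"
      proof (rule ok_For[where I = "\<lambda>Y s''. \<forall>X<?P. s'' A X =
            (if X < Y then G (?J (Suc x)) (dec X) else G (?J x) (dec X))"])
        fix s'' assume fr2: "frame (insert ''X'' (writes ?upd)) s' s''"
        have e'': "env s''" by (rule env_mono[OF _ fr2]) (use e' A in auto)
        show "aval (V ''P'') s'' = ?P" using e'' by (simp add: env_def)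
        have x2: "s'' ''x'' 0 = x" "s'' ''w'' x = 2 ^ rk x"
          using frameD[OF fr2, of "''x''"] frameD[OF fr2, of "''w''"] A' x w by simp_all
        fix Y assume Y: "Y < ?P" "s'' ''X'' 0 = Y" and I2: "\<forall>X<?P. s'' A X =
            (if X < Y then G (?J (Suc x)) (dec X) else G (?J x) (dec X))"
        have b: "bval in_mask s'' \<longleftrightarrow> x \<in> dec Y" using bval_in_mask[OF e''] x2 x Y by simp
        have new: "G (?J (Suc x)) (dec Y) = (if x \<in> dec Y then h (G (?J x) (dec Y)) (G (?J x) (dec Y - {x}))
            else G (?J x) (dec Y))"
          using xf ins[OF dec_subset, of x Y "?J x"] outs[of x "dec Y" "?J x"] by (simp add: J_Suc)
        \<comment> \<open>The entry for \<open>dec Y - {x}\<close> has a smaller index and was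
          therefore already visited in this round. As this set does not contain \<open>x\<close>,
          the visit left its value unchanged, so updating in place is sound.\<close>
        have old: "s'' A (Y - 2 ^ rk x) = G (?J x) (dec Y - {x})" if "x \<in> dec Y"
        proof -
          have d: "2 ^ rk x \<le> Y" "dec (Y - 2 ^ rk x) = dec Y - {x}" using dec_diff[OF Y(1) that] by auto
          have "Y - 2 ^ rk x < Y" using d(1) by (metis diff_less less_le_trans zero_less_numeral zero_less_power)
          then have "s'' A (Y - 2 ^ rk x) = G (?J (Suc x)) (dec Y - {x})" using I2 Y d(2) by simp
          also have "\<dots> = G (?J x) (dec Y - {x})" using outs[of x "dec Y - {x}"] xf by (simp add: J_Suc)
          finally show ?thesis .
        qed
        have lt: "G (?J (Suc x)) (dec Y) < 2 ^ D" by (rule bound[OF dec_subset])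
        show "ok D ?upd (1 + 1 + 1) (\<lambda>s3. \<forall>X<?P. (put ''X'' (Suc Y) s3) A X =
            (if X < Suc Y then G (?J (Suc x)) (dec X) else G (?J x) (dec X))) s''"
          by (intro ok_If ok_Assign ok_Skip)
            (use b new old lt A' I2 Y x2 in \<open>auto simp: f less_Suc_eq\<close>)
      qed (use A' D I in auto)
    next
      assume "\<not> bval (Equal (Get ''c'' (V ''x'')) (Const 0)) s'"
      then have "x \<notin> free" using x c by (simp add: free_def)
      then show "ok D Skip 1
        (\<lambda>s''. \<forall>X<?P. (put ''x'' (Suc x) s'') A X = G (?J (Suc x)) (dec X)) s'"
        using I A' by (intro ok_Skip) (simp add: J_Suc)
    qed
  qed (use A' D init Jn in auto)
  then show ?thesis by (rule ok_steps) (simp add: algebra_simps)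
qed

lemma ok_weights:
  assumes e: "env s" and D: "n < 2 ^ D" "0 < D" "m < 2 ^ D" "2 ^ card free < (2 :: nat) ^ D"
    and W: "s ''W'' 0 = W" "0 < W" and z: "s ''z'' 0 = z" "0 < z"
    and big: "W ^ card free * z ^ m < 2 ^ D"
  shows "ok D weights (2 ^ card free * (m * (n * 5 + 7) + n * 5 + m * 3 + 11) + 2)
     (\<lambda>s'. \<forall>X<2 ^ card free. s' ''A'' X = W ^ card (dec X) * z ^ card (sats (s ''i'' 0) (dec X))) s"
proof -
  let ?P = "2 ^ card free :: nat" and ?i = "s ''i'' 0"
  let ?step = "If in_mask (''a'' ::= Mul (V ''a'') (V ''W'')) Skip"
  let ?body = "''s'' ::= Const 0 ;; count True ''f'' ;; ''a'' ::= Const 1 ;;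
      For ''x'' (V ''n'') ?step ;;
      mul_pow ''a'' ''z'' (V ''s'') ;; Assign ''A'' (V ''X'') (V ''a'')"
  let ?N = "1 + ((m * (n * 5 + 7) + 2) + (1 + ((n * ((1 + 1 + 1) + 2) + 2) + ((m * 3 + 2) + 1))))"
  let ?g = "\<lambda>X. W ^ card (dec X) * z ^ card (sats ?i (dec X))"
  have D1: "(1::nat) < 2 ^ D" using D one_less_power[of "2::nat" D] by simp
  have "ok D weights (?P * (?N + 2) + 2) (\<lambda>s'. \<forall>X<?P. s' ''A'' X = ?g X) s"
    unfolding weights_def
  proof (rule ok_For[where I = "\<lambda>Y s'. \<forall>X<Y. s' ''A'' X = ?g X"])
    fix s' assume f: "frame (insert ''X'' (writes ?body)) s s'"
    have e': "env s'" by (rule env_mono[OF _ f]) (use e in auto)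
    show "aval (V ''P'') s' = ?P" using e' by (simp add: env_def)
    note fr = frameD[OF f]
    fix Y assume Y: "Y < ?P" "s' ''X'' 0 = Y" and I: "\<forall>X<Y. s' ''A'' X = ?g X"
    let ?cnt = "card (sats ?i (dec Y))"
    have cY: "card (dec Y) \<le> card free" by (rule card_mono[OF finite_free dec_subset])
    show "ok D ?body ?N (\<lambda>s2. \<forall>X<Suc Y. (put ''X'' (Suc Y) s2) ''A'' X = ?g X) s'"
    proof (rule ok_Seq, rule ok_Assign)
      let ?s = "s'(''s'' := (s' ''s'')(aval (Const 0) s' := aval (Const 0) s'))"
      have e2: "env ?s" using e' by simp
      show "ok D (count True ''f'' ;; ''a'' ::= Const 1 ;; For ''x'' (V ''n'') ?step ;;
          mul_pow ''a'' ''z'' (V ''s'') ;; Assign ''A'' (V ''X'') (V ''a''))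
        ((m * (n * 5 + 7) + 2) + (1 + ((n * ((1 + 1 + 1) + 2) + 2) + ((m * 3 + 2) + 1))))
        (\<lambda>s2. \<forall>X<Suc Y. (put ''X'' (Suc Y) s2) ''A'' X = ?g X) ?s"
      proof (rule ok_Seq, rule ok_post[OF ok_count[OF e2]])
        fix s2 assume f2: "frame (writes (count True ''f'')) ?s s2"
          and q: "s2 ''s'' 0 = ?s ''s'' 0 + card (sats (?s ''i'' 0) (mask_set True (?s ''X'' 0))) \<and>
            (\<forall>j<m. s2 ''f'' j = of_bool (j \<in> sats (?s ''i'' 0) (mask_set True (?s ''X'' 0))))"
        note fr2 = frameD[OF f2]
        have e3: "env s2" by (rule env_mono[OF _ f2]) (use e2 in auto)
        have v2: "s2 ''s'' 0 = ?cnt" "s2 ''X'' 0 = Y" "s2 ''W'' 0 = W" "s2 ''z'' 0 = z" "s2 ''A'' = s' ''A''"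
          using q Y W z by (simp_all add: fr2 fr)
        have cm: "?cnt \<le> m" by (rule card_sats_le)
        show "ok D (''a'' ::= Const 1 ;; For ''x'' (V ''n'') ?step ;;
            mul_pow ''a'' ''z'' (V ''s'') ;; Assign ''A'' (V ''X'') (V ''a''))
          (1 + ((n * ((1 + 1 + 1) + 2) + 2) + ((m * 3 + 2) + 1)))
          (\<lambda>s2. \<forall>X<Suc Y. (put ''X'' (Suc Y) s2) ''A'' X = ?g X) s2"
        proof (rule ok_Seq, rule ok_Assign)
          let ?t = "s2(''a'' := (s2 ''a'')(aval (Const 0) s2 := aval (Const 1) s2))"
          have e4: "env ?t" using e3 by simp
          show "ok D (For ''x'' (V ''n'') ?step ;; mul_pow ''a'' ''z'' (V ''s'') ;; Assign ''A'' (V ''X'') (V ''a''))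
            ((n * ((1 + 1 + 1) + 2) + 2) + ((m * 3 + 2) + 1))
            (\<lambda>s2. \<forall>X<Suc Y. (put ''X'' (Suc Y) s2) ''A'' X = ?g X) ?t"
          proof (rule ok_Seq, rule ok_For[where I = "\<lambda>x t. t ''a'' 0 = W ^ card {y \<in> dec Y. y < x}"])
            fix t assume f3: "frame (insert ''x'' (writes ?step)) ?t t"
            note fr3 = frameD[OF f3]
            have e5: "env t" by (rule env_mono[OF _ f3]) (use e4 in auto)
            show "aval (V ''n'') t = n" using e5 by (simp add: env_def)
            have v3: "t ''X'' 0 = Y" "t ''W'' 0 = W" "t ''z'' 0 = z" "t ''s'' 0 = ?cnt" "t ''A'' = s' ''A''"
              using v2 by (simp_all add: fr3)
            {
              fix x assume x: "x < n" "t ''x'' 0 = x" and I3: "t ''a'' 0 = W ^ card {y \<in> dec Y. y < x}"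
              have b: "bval in_mask t \<longleftrightarrow> x \<in> dec Y" using bval_in_mask[OF e5] x v3 by simp
              have "{y \<in> dec Y. y < Suc x} = (if x \<in> dec Y then insert x {y \<in> dec Y. y < x} else {y \<in> dec Y. y < x})"
                by (auto simp: less_Suc_eq)
              then have c: "card {y \<in> dec Y. y < Suc x} = (if x \<in> dec Y then Suc (card {y \<in> dec Y. y < x}) else card {y \<in> dec Y. y < x})"
                by simp
              have "card {y \<in> dec Y. y < Suc x} \<le> card free"
                by (rule card_mono[OF finite_free]) (use dec_subset in auto)
              then have "W ^ card {y \<in> dec Y. y < Suc x} \<le> W ^ card free" using W by (intro power_increasing) auto
              also have "\<dots> \<le> W ^ card free * z ^ m" using z by simp
              finally have lt: "W ^ card {y \<in> dec Y. y < Suc x} < 2 ^ D" using big by simp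
              show "ok D ?step (1 + 1 + 1)
                (\<lambda>t'. (put ''x'' (Suc x) t') ''a'' 0 = W ^ card {y \<in> dec Y. y < Suc x}) t"
                by (intro ok_If ok_Assign ok_Skip) (use b c lt I3 v3 in \<open>auto simp: mult.commute\<close>)
            }
            assume x: "t ''x'' 0 = n" and I3: "t ''a'' 0 = W ^ card {y \<in> dec Y. y < n}"
            have "{y \<in> dec Y. y < n} = dec Y" using dec_subset free_lt by auto
            then have a3: "t ''a'' 0 = W ^ card (dec Y)" using I3 by simp
            have "W ^ card (dec Y) * z ^ ?cnt \<le> W ^ card free * z ^ m"
              using W z cY cm by (intro mult_mono power_increasing) auto
            then have lt: "W ^ card (dec Y) * z ^ ?cnt < 2 ^ D" using big by simp
            show "ok D (mul_pow ''a'' ''z'' (V ''s'') ;; Assign ''A'' (V ''X'') (V ''a'')) ((m * 3 + 2) + 1)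
              (\<lambda>s2. \<forall>X<Suc Y. (put ''X'' (Suc Y) s2) ''A'' X = ?g X) t"
            proof (rule ok_Seq, rule ok_conseq[OF ok_mul_pow[where H = ?cnt]])
              show "aval (V ''s'') t' = ?cnt" if "frame {''q'', ''a''} t t'" for t'
                using v3 by (simp add: frameD[OF that])
              fix t' assume f4: "frame (writes (mul_pow ''a'' ''z'' (V ''s''))) t t'"
                and q4: "t' ''a'' 0 = t ''a'' 0 * t ''z'' 0 ^ ?cnt"
              have v4: "t' ''a'' 0 = ?g Y" "t' ''X'' 0 = Y" "t' ''A'' = s' ''A''"
                using q4 a3 v3 by (simp_all add: frameD[OF f4])
              show "ok D (Assign ''A'' (V ''X'') (V ''a'')) 1
                (\<lambda>s2. \<forall>X<Suc Y. (put ''X'' (Suc Y) s2) ''A'' X = ?g X) t'"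
                by (rule ok_Assign) (use v4 lt I in \<open>auto simp: less_Suc_eq\<close>)
            qed (use cm D v3 a3 lt z in auto)
          qed (use D in auto)
        qed (use D1 in simp)
      qed (use D in auto)
    qed simp
  qed (use D in auto)
  then show ?thesis by (rule ok_steps) (simp add: algebra_simps)
qed


text \<open>The three bounds in \<open>big\<close> make \<open>W\<close>, \<open>G\<close> and the
  table \<open>T\<close> storable: an entry of \<open>T\<close> is a product of up to
  \<open>k\<close> zeta values, each a sum of at most \<open>2 ^ card free\<close> weights. The step
  count mirrors the nesting of the program.\<close>

lemma ok_partition_search:
  fixes z W :: nat
  assumes e: "env s" and g: "s ''g'' 0 = tg" and k: "1 \<le> k" and kD: "k < 2 ^ D"
    and D: "n < 2 ^ D" "1 < D" "m < 2 ^ D" "k * n < 2 ^ D" "k * m < 2 ^ D" "tg < 2 ^ D" "2 ^ card free < (2 :: nat) ^ D"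
    and z: "z = 2 * 2 ^ (k * n)" and W: "W = z ^ Suc (k * m)"
    and big: "W < 2 ^ D" "W ^ card free * z ^ tg < 2 ^ D" "(2 ^ card free * (W ^ card free * z ^ m)) ^ k < 2 ^ D"
    and N1: "N1 = 2 ^ card free * (m * (n * 5 + 7) + n * 5 + m * 3 + 11) + 2"
    and N2: "N2 = n * (2 ^ card free * 5 + 6) + 2"
  shows "ok D (partition_search k)
     (1 + (1 + ((k * n * 3 + 2) + (1 + ((k * m * 3 + 2) + (1 + ((card free * 3 + 2) + (1 + ((tg * 3 + 2) +
      ((2 ^ card free * (1 + 2) + 2) + ((k * ((1 + (N1 + (N2 + (2 ^ card free * (1 + 2) + 2)))) + 2) + 2) +
      (N2 + (1 + 1 + 1)))))))))))))
     (\<lambda>s'. s' ''out'' 0 = of_bool (good tg)) s"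
proof -
  let ?P = "2 ^ card free :: nat" and ?K = "{1..k}"
  let ?M = "?P * (W ^ card free * z ^ m)"
  define w where "w i S = W ^ card S * z ^ card (sats i S)" for i S
  have z0: "0 < z" by (simp add: z)
  have W0: "0 < W" using z0 by (simp add: W)
  have M1: "1 \<le> ?M" using z0 W0 by (simp add: Suc_le_eq)
  have Mk: "?M ^ i < 2 ^ D" if "i \<le> k" for i
    using big(3) power_increasing[OF that M1] by simp
  have M: "?M < 2 ^ D" using Mk[of 1] k by simp
  have w_le: "w i S \<le> W ^ card free * z ^ m" if "S \<subseteq> free" for i S
    unfolding w_def using that z0 W0 card_sats_le card_mono[OF finite_free that]
    by (intro mult_mono power_increasing) auto
  have zeta_le: "partial_zeta (w i) J Y \<le> ?M" if "Y \<subseteq> free" for i J Y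
  proof -
    have fY: "finite Y" using that by (rule finite_subset) simp
    have "partial_zeta (w i) J Y \<le> (\<Sum>S\<in>Pow Y. w i S)"
      unfolding partial_zeta_def by (rule sum_mono2) (use fY in auto)
    also have "\<dots> \<le> card (Pow Y) * (W ^ card free * z ^ m)"
      using sum_bounded_above[of "Pow Y" "w i" "W ^ card free * z ^ m"] w_le that by auto
    also have "card (Pow Y) \<le> ?P" using card_mono[OF finite_free that] fY by (simp add: card_Pow)
    finally show ?thesis by simp
  qed
  have wprod_le: "(\<Prod>i\<in>?K. w i (\<sigma> i)) \<le> (W ^ card free * z ^ m) ^ k" if "\<sigma> \<in> ?K \<rightarrow>\<^sub>E Pow Y" "Y \<subseteq> free" for \<sigma> Y
  proof -
    have "(\<Prod>i\<in>?K. w i (\<sigma> i)) \<le> (\<Prod>i\<in>?K. W ^ card free * z ^ m)"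
      by (rule prod_mono) (use that w_le in \<open>auto simp: PiE_def Pi_def\<close>)
    then show ?thesis by simp
  qed
  \<comment> \<open>Each stage of the Moebius transform is a sum of products of weights over some of
    the \<open>k\<close>-tuples of subsets, so the bound for the full product of zeta transforms
    also holds for it.\<close>
  have cov_le: "cover_sum ?K (\<lambda>\<sigma>. \<Prod>i\<in>?K. w i (\<sigma> i)) J Y < 2 ^ D" if "Y \<subseteq> free" for J Y
  proof -
    have fY: "finite Y" using that by (rule finite_subset) simp
    have "cover_sum ?K (\<lambda>\<sigma>. \<Prod>i\<in>?K. w i (\<sigma> i)) J Y \<le> (2 ^ card Y) ^ card ?K * (W ^ card free * z ^ m) ^ k"
      by (rule cover_sum_le) (use fY wprod_le that in auto)
    also have "\<dots> \<le> ?P ^ k * (W ^ card free * z ^ m) ^ k"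
      using card_mono[OF finite_free that] by (intro mult_right_mono) (auto intro!: power_mono)
    also have "\<dots> = ?M ^ k" by (rule power_mult_distrib[symmetric])
    finally show ?thesis using Mk[of k] by simp
  qed
  have kn: "card free \<le> n" by (rule card_free_le)
  have uD: "card free < 2 ^ D" using kn D by simp
  have D4: "(2::nat) < 2 ^ D" using D(2) power_strict_increasing[of 1 D "2::nat"] by simp
  have D1: "(1::nat) < 2 ^ D" using D4 by simp
  let ?TA = "For ''X'' (V ''P'') (Assign ''T'' (V ''X'') (Mul (Get ''T'' (V ''X'')) (Get ''A'' (V ''X''))))"
  let ?ob = "''i'' ::= Add (V ''o'') (Const 1) ;; weights ;; transform ''A'' Add ;; ?TA"
  let ?Q = "\<lambda>s'. s' ''out'' 0 = of_bool (good tg)"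
  let ?T = "\<lambda>o' X. \<Prod>i\<in>{1..o'}. \<Sum>S\<in>Pow (dec X). w i S"
  have T_le: "?T o' X \<le> ?M ^ o'" for o' X
  proof -
    have "?T o' X \<le> (\<Prod>i\<in>{1..o'}. ?M)"
      using zeta_le[OF dec_subset, of _ "dec X" X] by (intro prod_mono) (simp add: partial_zeta_full)
    then show ?thesis by simp
  qed
  \<comment> \<open>Collects the constants that the set-up phase computes. The loops write to none
    of them, so the main part is proved once for any state with this property.\<close>
  define ready where "ready s' \<longleftrightarrow> env s' \<and> s' ''z'' 0 = z \<and> s' ''W'' 0 = W \<and> s' ''U'' 0 = W ^ card free \<and>
     s' ''G'' 0 = W ^ card free * z ^ tg" for s'
  have ready_frame: "ready s''" if "ready s'" "frame X s' s''" "X \<inter> (env_names \<union> {''z'', ''W'', ''U'', ''G''}) = {}" for s' s'' X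
  proof -
    have "env s''" using that by (subst env_frame[OF that(2)]) (auto simp: ready_def)
    moreover have "s'' y = s' y" if "y \<in> {''z'', ''W'', ''U'', ''G''}" for y
      using frameD[OF \<open>frame X s' s''\<close>, of y] that \<open>X \<inter> _ = {}\<close> by auto
    ultimately show ?thesis using that(1) by (simp add: ready_def)
  qed

  have main: "ok D (For ''X'' (V ''P'') (Assign ''T'' (V ''X'') (Const 1)) ;;
     For ''o'' (Const k) ?ob ;; transform ''T'' Sub ;;
     If (Less (Rem (Get ''T'' (Sub (V ''P'') (Const 1))) (Mul (V ''U'') (V ''W''))) (V ''G''))
       (''out'' ::= Const 0) (''out'' ::= Const 1))
      ((?P * (1 + 2) + 2) + ((k * ((1 + (N1 + (N2 + (?P * (1 + 2) + 2)))) + 2) + 2) + (N2 + (1 + 1 + 1)))) ?Q s1"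
    if su: "ready s1" for s1
  proof (rule ok_Seq, rule ok_For[where I = "\<lambda>Y s'. \<forall>X<Y. s' ''T'' X = 1"])
    fix s' assume f: "frame (insert ''X'' (writes (Assign ''T'' (V ''X'') (Const 1)))) s1 s'"
    have su': "ready s'" by (rule ready_frame[OF su f]) simp
    show "aval (V ''P'') s' = ?P" using su' by (simp add: ready_def env_def)
    {
      fix Y assume "Y < ?P" "s' ''X'' 0 = Y" "\<forall>X<Y. s' ''T'' X = 1"
      then show "ok D (Assign ''T'' (V ''X'') (Const 1)) 1 (\<lambda>s''. \<forall>X<Suc Y. (put ''X'' (Suc Y) s'') ''T'' X = 1) s'"
        by (intro ok_Assign) (use D1 in \<open>auto simp: less_Suc_eq\<close>)
    }
    assume T: "\<forall>X<?P. s' ''T'' X = 1"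
    show "ok D (For ''o'' (Const k) ?ob ;; transform ''T'' Sub ;;
     If (Less (Rem (Get ''T'' (Sub (V ''P'') (Const 1))) (Mul (V ''U'') (V ''W''))) (V ''G''))
       (''out'' ::= Const 0) (''out'' ::= Const 1))
      ((k * ((1 + (N1 + (N2 + (?P * (1 + 2) + 2)))) + 2) + 2) + (N2 + (1 + 1 + 1))) ?Q s'"
    proof (rule ok_Seq, rule ok_For[where I = "\<lambda>o' s'. \<forall>X<?P. s' ''T'' X = ?T o' X"])
      fix s2 assume f2: "frame (insert ''o'' (writes ?ob)) s' s2"
      have su2: "ready s2" by (rule ready_frame[OF su' f2]) simp
      show "aval (Const k) s2 = k" by simp
      {
        fix o' assume o: "o' < k" "s2 ''o'' 0 = o'" and I: "\<forall>X<?P. s2 ''T'' X = ?T o' X"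
        show "ok D ?ob (1 + (N1 + (N2 + (?P * (1 + 2) + 2))))
          (\<lambda>s3. \<forall>X<?P. (put ''o'' (Suc o') s3) ''T'' X = ?T (Suc o') X) s2"
        proof (rule ok_Seq, rule ok_Assign)
          show "aval (Add (V ''o'') (Const 1)) s2 < 2 ^ D" using o kD by simp
          let ?s2 = "s2(''i'' := (s2 ''i'')(aval (Const 0) s2 := aval (Add (V ''o'') (Const 1)) s2))"
          have su3: "ready ?s2" by (rule ready_frame[OF su2, of "{''i''}"]) (simp_all add: frame_def)
          show "ok D (weights ;; transform ''A'' Add ;; ?TA) (N1 + (N2 + (?P * (1 + 2) + 2)))
             (\<lambda>s3. \<forall>X<?P. (put ''o'' (Suc o') s3) ''T'' X = ?T (Suc o') X) ?s2"
            unfolding N1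
          proof (rule ok_Seq, rule ok_post[OF ok_weights[where W = W and z = z]])
            fix s3 assume f3: "frame (writes weights) ?s2 s3"
              and q: "\<forall>X<?P. s3 ''A'' X = W ^ card (dec X) * z ^ card (sats (?s2 ''i'' 0) (dec X))"
            have su4: "ready s3" by (rule ready_frame[OF su3 f3]) simp
            have A3: "s3 ''A'' X = w (Suc o') (dec X)" if "X < ?P" for X using q that o by (simp add: w_def)
            have T3: "s3 ''T'' = s2 ''T''" using frameD[OF f3, of "''T''"] by simp
            show "ok D (transform ''A'' Add ;; ?TA) (N2 + (?P * (1 + 2) + 2))
               (\<lambda>s3. \<forall>X<?P. (put ''o'' (Suc o') s3) ''T'' X = ?T (Suc o') X) s3"
              unfolding N2
            proof (rule ok_Seq, rule ok_post[OF ok_transform[where G = "partial_zeta (w (Suc o'))" and h = "(+)"]])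
              fix s4 assume f4: "frame (writes (transform ''A'' Add)) s3 s4"
                and q4: "\<forall>X<?P. s4 ''A'' X = partial_zeta (w (Suc o')) free (dec X)"
              have su5: "ready s4" by (rule ready_frame[OF su4 f4]) simp
              have A4: "s4 ''A'' X = (\<Sum>S\<in>Pow (dec X). w (Suc o') S)" if "X < ?P" for X
                using q4 that partial_zeta_full[OF dec_subset] by simp
              have T4: "s4 ''T'' X = ?T o' X" if "X < ?P" for X
                using frameD[OF f4, of "''T''"] T3 I that by simp
              show "ok D ?TA (?P * (1 + 2) + 2)
                (\<lambda>s3. \<forall>X<?P. (put ''o'' (Suc o') s3) ''T'' X = ?T (Suc o') X) s4"
              proof (rule ok_For[where I = "\<lambda>Y s'. \<forall>X<?P. s' ''T'' X = (if X < Y then ?T (Suc o') X else ?T o' X)"])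
                fix s5 assume f5: "frame (insert ''X'' (writes (Assign ''T'' (V ''X'') (Mul (Get ''T'' (V ''X'')) (Get ''A'' (V ''X'')))))) s4 s5"
                have su6: "ready s5" by (rule ready_frame[OF su5 f5]) simp
                show "aval (V ''P'') s5 = ?P" using su6 by (simp add: ready_def env_def)
                fix Y assume Y: "Y < ?P" "s5 ''X'' 0 = Y"
                  and I5: "\<forall>X<?P. s5 ''T'' X = (if X < Y then ?T (Suc o') X else ?T o' X)"
                have A5: "s5 ''A'' Y = (\<Sum>S\<in>Pow (dec Y). w (Suc o') S)"
                  using A4 Y frameD[OF f5, of "''A''"] by simp
                have TS: "?T (Suc o') Y = ?T o' Y * (\<Sum>S\<in>Pow (dec Y). w (Suc o') S)" by simp
                have lt: "?T (Suc o') Y < 2 ^ D" using T_le[of Y "Suc o'"] Mk[of "Suc o'"] o by (meson Suc_leI le_less_trans)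
                show "ok D (Assign ''T'' (V ''X'') (Mul (Get ''T'' (V ''X'')) (Get ''A'' (V ''X'')))) 1
                  (\<lambda>s'. \<forall>X<?P. (put ''X'' (Suc Y) s') ''T'' X = (if X < Suc Y then ?T (Suc o') X else ?T o' X)) s5"
                  by (intro ok_Assign) (use Y I5 A5 TS lt in \<open>auto simp: less_Suc_eq simp del: prod.atLeast1_atMost_eq\<close>)
              qed (use T4 D in auto)
            next
              show "env s3" using su4 by (simp add: ready_def)
              show "partial_zeta (w (Suc o')) J Y < 2 ^ D" if "Y \<subseteq> free" for J Y
                using zeta_le[OF that, of "Suc o'" J] M by simp
              show "partial_zeta (w (Suc o')) (insert x J) Y = partial_zeta (w (Suc o')) J Y + partial_zeta (w (Suc o')) J (Y - {x})"
                if "Y \<subseteq> free" "x \<in> Y" "x \<notin> J" for J Y x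
                using that by (intro partial_zeta_insert_in) (auto intro: finite_subset)
            qed (use D A3 in \<open>auto simp: partial_zeta_empty partial_zeta_insert_out\<close>)
          next
            show "W ^ card free * z ^ m < 2 ^ D" using M by (rule le_less_trans[rotated]) simp
          qed (use su3 D D1 W0 z0 in \<open>auto simp: ready_def\<close>)
        qed
      }
      assume I: "\<forall>X<?P. s2 ''T'' X = ?T k X"
      let ?w = "\<lambda>\<sigma>. \<Prod>i\<in>?K. w i (\<sigma> i)"
      show "ok D (transform ''T'' Sub ;;
        If (Less (Rem (Get ''T'' (Sub (V ''P'') (Const 1))) (Mul (V ''U'') (V ''W''))) (V ''G''))
          (''out'' ::= Const 0) (''out'' ::= Const 1)) (N2 + (1 + 1 + 1)) ?Q s2"
        unfolding N2
      proof (rule ok_Seq, rule ok_post[OF ok_transform[where G = "cover_sum ?K ?w" and h = "(-)"]])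
        fix s3 assume f3: "frame (writes (transform ''T'' Sub)) s2 s3"
          and q: "\<forall>X<?P. s3 ''T'' X = cover_sum ?K ?w free (dec X)"
        have su3: "ready s3" by (rule ready_frame[OF su2 f3]) simp
        \<comment> \<open>The mask \<open>P - 1\<close> has all \<open>card free\<close> bits set,
          so this entry belongs to the whole set of uncolored vertices.\<close>
        have R: "s3 ''T'' (?P - Suc 0) = cover_sum ?K ?w free free" using q dec_full by simp
        \<comment> \<open>There are \<open>2 ^ (k * card free)\<close> tuples of subsets, and
          \<open>z\<close> is twice \<open>2 ^ (k * n)\<close>.\<close>
        have "(2 ^ card free) ^ card ?K < z"
        proof -
          have "(2 ^ card free) ^ card ?K = (2::nat) ^ (k * card free)" by (simp add: mult.commute flip: power_mult)
          also have "\<dots> \<le> 2 ^ (k * n)" using kn by (intro power_increasing) auto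
          also have "\<dots> < z" by (simp add: z)
          finally show ?thesis .
        qed
        moreover have "(\<Sum>i\<in>?K. card (sats i (\<sigma> i))) \<le> k * m" for \<sigma>
          using sum_bounded_above[of ?K "\<lambda>i. card (sats i (\<sigma> i))" m] card_sats_le by simp
        ultimately have "W ^ card free * z ^ tg \<le> cover_sum ?K ?w free free mod W ^ Suc (card free) \<longleftrightarrow> good tg"
          unfolding good_partition w_def by (intro cover_sum_threshold) (simp_all add: W)
        then have "\<not> cover_sum ?K ?w free free mod (W ^ card free * W) < W ^ card free * z ^ tg \<longleftrightarrow> good tg"
          by (simp add: not_less mult.commute)
        then show "ok D (If (Less (Rem (Get ''T'' (Sub (V ''P'') (Const 1))) (Mul (V ''U'') (V ''W''))) (V ''G''))
          (''out'' ::= Const 0) (''out'' ::= Const 1)) (1 + 1 + 1) ?Q s3"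
          by (intro ok_If ok_Assign) (use su3 R D1 in \<open>auto simp: ready_def env_def\<close>)
      next
        show "env s2" using su2 by (simp add: ready_def)
        show "cover_sum ?K ?w (insert x J) Y = cover_sum ?K ?w J Y - cover_sum ?K ?w J (Y - {x})"
          if "Y \<subseteq> free" "x \<in> Y" "x \<notin> J" for J Y x
          using that by (intro cover_sum_insert_in) (auto intro: finite_subset)
        show "s2 ''T'' X = cover_sum ?K ?w {} (dec X)" if "X < ?P" for X
          using I that by (subst cover_sum_empty) auto
      qed (use D cov_le in \<open>auto simp: cover_sum_insert_out\<close>)
    qed (use T kD in auto)
  qed (use D in auto)
  have zW: "z \<le> W" using z0 by (simp add: W)
  have zD: "z < 2 ^ D" using zW big(1) by simp
  have UD: "W ^ card free < 2 ^ D"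
  proof (rule le_less_trans[OF _ big(2)])
    show "W ^ card free \<le> W ^ card free * z ^ tg" using z0 by simp
  qed
  let ?s1 = "put ''b'' 2 s"
  let ?s2 = "?s1(''z'' := (s ''z'')(0 := 2))"
  have e2: "env ?s2" using e by simp
  show ?thesis unfolding partition_search_def
  proof (rule ok_Seq, rule ok_Assign, goal_cases)
    case 2
    show ?case
    proof (rule ok_Seq, rule ok_Assign, goal_cases)
      case 2
      show ?case
      proof (simp only: aval.simps, rule ok_Seq, rule ok_post[OF ok_mul_pow[where H = "k * n"]], goal_cases)
        case (4 s')
        then show ?case using e2 frameD[OF 4, of "''n''"] by (simp add: env_def)
      next
        case (8 s3)
        note f3 = frameD[OF 8(1)]
        have e3: "env s3" by (rule env_mono[OF _ 8(1)]) (use e in auto)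
        have v3: "s3 ''z'' 0 = z" "s3 ''g'' 0 = tg" using 8(2) g by (simp_all add: f3 z)
        show ?case
        proof (rule ok_Seq, rule ok_Assign, goal_cases)
          case 2
          let ?s4 = "put ''W'' z s3"
          have e4: "env ?s4" using e3 by simp
          show ?case unfolding aval.simps v3
          proof (rule ok_Seq, rule ok_post[OF ok_mul_pow[where H = "k * m"]], goal_cases)
            case (4 s')
            then show ?case using e4 frameD[OF 4, of "''m''"] by (simp add: env_def)
          next
            case (8 s5)
            note f5 = frameD[OF 8(1)]
            have e5: "env s5" by (rule env_mono[OF _ 8(1)]) (use e4 in auto)
            have v5: "s5 ''z'' 0 = z" "s5 ''g'' 0 = tg" "s5 ''W'' 0 = W" using 8(2) v3 by (simp_all add: f5 W)
            show ?case
            proof (rule ok_Seq, rule ok_Assign, goal_cases)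
              case 2
              let ?s6 = "put ''U'' 1 s5"
              have e6: "env ?s6" using e5 by simp
              show ?case unfolding aval.simps
              proof (rule ok_Seq, rule ok_post[OF ok_mul_pow[where H = "card free"]], goal_cases)
                case (4 s')
                then show ?case using e6 frameD[OF 4, of "''u''"] by (simp add: env_def)
              next
                case (8 s7)
                note f7 = frameD[OF 8(1)]
                have e7: "env s7" by (rule env_mono[OF _ 8(1)]) (use e6 in auto)
                have v7: "s7 ''z'' 0 = z" "s7 ''g'' 0 = tg" "s7 ''W'' 0 = W" "s7 ''U'' 0 = W ^ card free"
                  using 8(2) v5 by (simp_all add: f7)
                show ?case
                proof (rule ok_Seq, rule ok_Assign, goal_cases)
                  case 2
                  let ?s8 = "put ''G'' (W ^ card free) s7"
                  have e8: "env ?s8" using e7 by simp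
                  show ?case unfolding aval.simps v7
                  proof (rule ok_Seq, rule ok_post[OF ok_mul_pow[where H = tg]], goal_cases)
                    case (4 s')
                    then show ?case using v7 by (simp add: frameD[OF 4])
                  next
                    case (8 s9)
                    note f9 = frameD[OF 8(1)]
                    have e9: "env s9" by (rule env_mono[OF _ 8(1)]) (use e8 in auto)
                    have "ready s9" using e9 8(2) v7 by (simp add: ready_def f9)
                    then show ?case by (rule main)
                  qed (use v7 z0 D big in simp_all)
                qed (use v7 UD in simp)
              qed (use v5 W0 UD uD in simp_all)
            qed (use D1 in simp)
          qed (use v3 z0 big D in \<open>simp_all add: W\<close>)
        qed (use v3 zD in simp)
      qed (use zD D in \<open>simp_all add: z\<close>)
    qed (use D4 in simp)
  qed (use D4 in simp)
qed

end

section \<open>Three colors\<close>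

lemma of_bool_eq_Suc_0 [simp]: "of_bool b = Suc 0 \<longleftrightarrow> b"
  by (cases b) auto

text \<open>\<open>l\<close> lists the masks of all sets with at most a third of the uncolored vertices, \<open>d\<close> their sizes.\<close>

definition list_masks :: com where
  "list_masks = Assign ''l'' (Const 0) (Const 0) ;; Assign ''d'' (Const 0) (Const 0) ;; ''nl'' ::= Const 1 ;;
     For ''x'' (V ''n'') (If (Equal (Get ''c'' (V ''x'')) (Const 0))
       (''y'' ::= V ''nl'' ;;
        For ''q'' (V ''y'') (If (Neg (Less (V ''u'') (Mul (Const 3) (Add (Get ''d'' (V ''q'')) (Const 1)))))
          (Assign ''l'' (V ''nl'') (Add (Get ''l'' (V ''q'')) (Get ''w'' (V ''x''))) ;;
           Assign ''d'' (V ''nl'') (Add (Get ''d'' (V ''q'')) (Const 1)) ;;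
           ''nl'' ::= Add (V ''nl'') (Const 1)) Skip)) Skip)"

definition conflict_test :: com where
  "conflict_test = ''e'' ::= Const 0 ;;
     For ''x'' (V ''n'') (If (Conj (Equal (Get ''h'' (Add (Mul (V ''j'') (V ''n'')) (V ''x''))) (Const 1))
         (Equal (Get ''h'' (Add (Mul (V ''r'') (V ''n'')) (V ''x''))) (Const 1))) (''e'' ::= Const 1) Skip)"

text \<open>Starting from \<open>m + 1\<close> with a strict comparison excludes goods that are not
  for sale, among them all indices outside \<open>R\<close>. The index \<open>br\<close> is
  meaningful only if \<open>bp\<close> has dropped below \<open>m + 1\<close>.\<close>

definition cheapest :: com where
  "cheapest = ''bp'' ::= Add (V ''m'') (Const 1) ;;
     For ''r'' (V ''m'') (conflict_test ;;
       If (Conj (Equal (V ''e'') (Const 1)) (Less (Get ''pr'' (V ''r'')) (V ''bp'')))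
         (''bp'' ::= Get ''pr'' (V ''r'') ;; ''br'' ::= V ''r'') Skip)"

definition take_good :: com where
  "take_good =
     If (Less (Const 0) (Get ''ow'' (V ''br'')))
       (Assign ''mt'' (Sub (Get ''ow'' (V ''br'')) (Const 1)) (Const 0)) Skip ;;
     Assign ''ow'' (V ''br'') (Add (V ''j'') (Const 1)) ;; Assign ''mt'' (V ''j'') (Const 1) ;;
     Assign ''pr'' (V ''br'') (Add (V ''bp'') (Const 1))"

text \<open>A fixed number of sweeps replaces a termination test. A sweep without a raise shows that
  every unmatched bidder is priced out, and \<open>m\<close> prices of at most \<open>m + 1\<close>
  allow only \<open>m * (m + 1)\<close> raises.\<close>

definition run_auction :: com where
  "run_auction = For ''it'' (Add (Mul (V ''m'') (Add (V ''m'') (Const 1))) (Const 1))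
     (For ''j'' (V ''m'') (If (Equal (Get ''mt'' (V ''j'')) (Const 0))
        (cheapest ;; If (Less (V ''bp'') (Add (V ''m'') (Const 1))) take_good Skip) Skip))"

lemma writes_list_masks [simp]: "writes list_masks = {''l'', ''d'', ''nl'', ''x'', ''y'', ''q''}"
  by (auto simp: list_masks_def)

lemma writes_conflict_test [simp]: "writes conflict_test = {''e'', ''x''}"
  by (auto simp: conflict_test_def)

lemma writes_cheapest [simp]: "writes cheapest = {''bp'', ''r'', ''e'', ''x'', ''br''}"
  by (auto simp: cheapest_def)

lemma writes_take_good [simp]: "writes take_good = {''mt'', ''ow'', ''pr''}"
  by (auto simp: take_good_def)

lemma writes_run_auction [simp]:
  "writes run_auction = {''it'', ''j'', ''bp'', ''r'', ''e'', ''x'', ''br'', ''mt'', ''ow'', ''pr''}"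
  by (auto simp: run_auction_def)

context set_family
begin

definition small :: "nat set \<Rightarrow> nat set set" where
  "small J = {S. S \<subseteq> J \<and> 3 * card S \<le> card free}"

lemma finite_small: "J \<subseteq> free \<Longrightarrow> finite (small J)"
  by (rule finite_subset[of _ "Pow free"]) (auto simp: small_def)

lemma card_small_mono: "J \<subseteq> free \<Longrightarrow> card (small J) \<le> card (small free)"
  by (rule card_mono[OF finite_small]) (auto simp: small_def)

text \<open>Smallness is inherited by subsets: a small set containing \<open>x\<close> arises from a
  small set without \<open>x\<close>, so extending the list by one vertex misses nothing.\<close>

lemma small_insert:
  assumes "J \<subseteq> free" "x \<in> free" "x \<notin> J"
  shows "small (insert x J) = small J \<union> {insert x S |S. S \<in> small J \<and> 3 * (card S + 1) \<le> card free}"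
proof (intro equalityI subsetI)
  fix S assume S: "S \<in> small (insert x J)"
  show "S \<in> small J \<union> {insert x S |S. S \<in> small J \<and> 3 * (card S + 1) \<le> card free}"
  proof (cases "x \<in> S")
    case True
    have "finite S" using S assms finite_subset[of S free] by (auto simp: small_def)
    then have "card S = card (S - {x}) + 1" using True card.remove by fastforce
    moreover have "S = insert x (S - {x})" using True by auto
    ultimately show ?thesis using S by (auto simp: small_def intro!: exI[of _ "S - {x}"])
  next
    case False
    then show ?thesis using S by (auto simp: small_def)
  qed
next
  fix S assume "S \<in> small J \<union> {insert x S |S. S \<in> small J \<and> 3 * (card S + 1) \<le> card free}"
  then consider "S \<in> small J" | T where "S = insert x T" "T \<in> small J" "3 * (card T + 1) \<le> card free" by auto
  then show "S \<in> small (insert x J)"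
  proof cases
    case 2
    then have "finite T" "x \<notin> T" using assms finite_subset[of T free] by (auto simp: small_def)
    then show ?thesis using 2 by (auto simp: small_def)
  qed (auto simp: small_def)
qed

text \<open>At every stage the list enumerates a subfamily of \<open>small free\<close> without
  repetition. This bounds its length, and with it the running time, by the final number of
  sets.\<close>

lemma ok_list_masks:
  assumes e: "env s" and D: "n < 2 ^ D" "1 < D" "2 ^ card free < (2 :: nat) ^ D" "card (small free) < 2 ^ D"
  shows "ok D list_masks (n * (card (small free) * 7 + 7) + 5)
     (\<lambda>s'. bij_betw (\<lambda>q. dec (s' ''l'' q)) {..<s' ''nl'' 0} (small free) \<and>
        (\<forall>q<s' ''nl'' 0. s' ''l'' q < 2 ^ card free)) s"
proof -
  let ?P = "2 ^ card free :: nat" and ?B = "card (small free)"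
  let ?J = "\<lambda>x. {y \<in> free. y < x}"
  let ?upd = "If (Neg (Less (V ''u'') (Mul (Const 3) (Add (Get ''d'' (V ''q'')) (Const 1)))))
          (Assign ''l'' (V ''nl'') (Add (Get ''l'' (V ''q'')) (Get ''w'' (V ''x''))) ;;
           Assign ''d'' (V ''nl'') (Add (Get ''d'' (V ''q'')) (Const 1)) ;;
           ''nl'' ::= Add (V ''nl'') (Const 1)) Skip"
  let ?body = "If (Equal (Get ''c'' (V ''x'')) (Const 0)) (''y'' ::= V ''nl'' ;; For ''q'' (V ''y'') ?upd) Skip"
  let ?bij = "\<lambda>s F. bij_betw (\<lambda>q. dec (s ''l'' q)) {..<s ''nl'' 0} F \<and>
     (\<forall>q<s ''nl'' 0. s ''l'' q < ?P \<and> s ''d'' q = card (dec (s ''l'' q)))"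
  have JS: "?J x \<subseteq> free" for x by auto
  have J_Suc: "?J (Suc x) = (if x \<in> free then insert x (?J x) else ?J x)" for x
    by (auto simp: less_Suc_eq)
  have Jn: "?J n = free" by (auto simp: free_def)
  have small0: "small (?J 0) = {{}}" by (auto simp: small_def)
  have D1: "(1::nat) < 2 ^ D" using D(2) one_less_power[of "2::nat" D] by simp
  let ?s = "s(''l'' := (s ''l'')(0 := 0), ''d'' := (s ''d'')(0 := 0), ''nl'' := (s ''nl'')(0 := 1))"
  have "ok D (For ''x'' (V ''n'') ?body) (n * (((1 + (?B * ((3 + 1 + 1) + 2) + 2)) + 1 + 1) + 2) + 2)
     (\<lambda>s'. bij_betw (\<lambda>q. dec (s' ''l'' q)) {..<s' ''nl'' 0} (small free) \<and>
        (\<forall>q<s' ''nl'' 0. s' ''l'' q < ?P)) ?s"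
  proof (rule ok_For[where I = "\<lambda>x s'. ?bij s' (small (?J x))"])
    fix s1 assume f1: "frame (insert ''x'' (writes ?body)) ?s s1"
    have e1: "env s1" by (rule env_mono[OF _ f1]) (use e in auto)
    show "aval (V ''n'') s1 = n" using e1 by (simp add: env_def)
    {
      fix x assume x: "x < n" "s1 ''x'' 0 = x" and I: "?bij s1 (small (?J x))"
      have c: "s1 ''c'' x = col x" using e1 x by (simp add: env_def)
      \<comment> \<open>The length before \<open>x\<close> is treated. The program copies it to
        \<open>y\<close>, because \<open>nl\<close> grows while the old entries are being
        extended.\<close>
      define e0 where "e0 = s1 ''nl'' 0"
      have "e0 = card (small (?J x))" using bij_betw_same_card[OF conjunct1[OF I]] by (simp add: e0_def)
      then have e0: "e0 \<le> ?B" using card_small_mono[OF JS] by simp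
      show "ok D ?body ((1 + (?B * ((3 + 1 + 1) + 2) + 2)) + 1 + 1)
        (\<lambda>s2. ?bij (put ''x'' (Suc x) s2) (small (?J (Suc x)))) s1"
      proof (rule ok_If)
        assume "bval (Equal (Get ''c'' (V ''x'')) (Const 0)) s1"
        then have xf: "x \<in> free" using x c by (simp add: free_def)
        have xJ: "x \<notin> ?J x" by simp
        let ?ins = "\<lambda>q. {insert x (dec (s1 ''l'' p)) |p. p < q \<and> 3 * (card (dec (s1 ''l'' p)) + 1) \<le> card free}"
        let ?F = "\<lambda>q. small (?J x) \<union> ?ins q"
        have decJ: "dec (s1 ''l'' q) \<in> small (?J x)" if "q < e0" for q
          using I that by (auto simp: bij_betw_def e0_def)
        have notin: "x \<notin> dec (s1 ''l'' q)" if "q < e0" for q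
          using decJ[OF that] by (auto simp: small_def)
        have FB: "card (?F q) \<le> ?B" if "q \<le> e0" for q
        proof (rule card_mono[OF finite_small])
          have "?ins q \<subseteq> small (insert x (?J x))"
          proof
            fix S assume "S \<in> ?ins q"
            then obtain p where p: "S = insert x (dec (s1 ''l'' p))" "p < q"
              "3 * (card (dec (s1 ''l'' p)) + 1) \<le> card free" by blast
            then have "dec (s1 ''l'' p) \<in> small (?J x)" using decJ that by simp
            then show "S \<in> small (insert x (?J x))" unfolding small_insert[OF JS xf xJ] using p by blast
          qed
          moreover have "small (insert x (?J x)) \<subseteq> small free" using xf by (auto simp: small_def)
          moreover have "small (?J x) \<subseteq> small free" by (auto simp: small_def)
          ultimately show "?F q \<subseteq> small free" by blast
        qed simp
        have "ok D (''y'' ::= V ''nl'' ;; For ''q'' (V ''y'') ?upd) (1 + (e0 * ((3 + 1 + 1) + 2) + 2))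
          (\<lambda>s2. ?bij (put ''x'' (Suc x) s2) (small (?J (Suc x)))) s1"
        proof (rule ok_Seq, rule ok_Assign)
          show "aval (V ''nl'') s1 < 2 ^ D" using e0 D by (simp add: e0_def)
          let ?s1 = "s1(''y'' := (s1 ''y'')(aval (Const 0) s1 := aval (V ''nl'') s1))"
          show "ok D (For ''q'' (V ''y'') ?upd) (e0 * ((3 + 1 + 1) + 2) + 2)
            (\<lambda>s2. ?bij (put ''x'' (Suc x) s2) (small (?J (Suc x)))) ?s1"
          proof (rule ok_For[where I = "\<lambda>q s2. ?bij s2 (?F q) \<and> e0 \<le> s2 ''nl'' 0 \<and>
                (\<forall>p<e0. s2 ''l'' p = s1 ''l'' p)"])
            fix s2 assume f2: "frame (insert ''q'' (writes ?upd)) ?s1 s2"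
            note fr2 = frameD[OF f2]
            have e2: "env s2" by (rule env_mono[OF _ f2]) (use e1 in auto)
            show "aval (V ''y'') s2 = e0" by (simp add: fr2 e0_def)
            have v2: "s2 ''x'' 0 = x" "s2 ''w'' x = 2 ^ rk x" "s2 ''u'' 0 = card free"
              using x e2 xf by (simp_all add: fr2 env_def)
            {
              fix q assume q: "q < e0" "s2 ''q'' 0 = q" and I2: "?bij s2 (?F q) \<and> e0 \<le> s2 ''nl'' 0 \<and>
                (\<forall>p<e0. s2 ''l'' p = s1 ''l'' p)"
              let ?S = "dec (s1 ''l'' q)"
              define e' where "e' = s2 ''nl'' 0"
              have lq: "s2 ''l'' q = s1 ''l'' q" "s2 ''d'' q = card ?S" "s1 ''l'' q < ?P"
                using I2 I q by (auto simp: e0_def)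
              have ne: "q \<noteq> e'" "p \<noteq> e'" if "p < e0" for p using I2 q that by (auto simp: e'_def)
              have eF: "e' = card (?F q)" using bij_betw_same_card[OF conjunct1[OF conjunct1[OF I2]]] by (simp add: e'_def)
              have add: "s1 ''l'' q + 2 ^ rk x < ?P" "dec (s1 ''l'' q + 2 ^ rk x) = insert x ?S"
                using dec_add[OF lq(3) xf notin[OF q(1)]] by auto
              have ins_Suc: "?ins (Suc q) = (if 3 * (card ?S + 1) \<le> card free then {insert x ?S} else {}) \<union> ?ins q"
                by (auto simp: less_Suc_eq)
              have card': "card (insert x ?S) = Suc (card ?S)" using notin[OF q(1)] by simp
              show "ok D ?upd (3 + 1 + 1) (\<lambda>s3. ?bij (put ''q'' (Suc q) s3) (?F (Suc q)) \<and>
                 e0 \<le> (put ''q'' (Suc q) s3) ''nl'' 0 \<and>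
                 (\<forall>p<e0. (put ''q'' (Suc q) s3) ''l'' p = s1 ''l'' p)) s2"
              proof (cases "3 * (card ?S + 1) \<le> card free")
                case True
                \<comment> \<open>No repetition: the old entries do not contain \<open>x\<close>,
                  and inserting \<open>x\<close> into distinct sets without \<open>x\<close> gives
                  distinct sets.\<close>
                have new: "insert x ?S \<notin> ?F q"
                proof
                  assume "insert x ?S \<in> ?F q"
                  moreover have "insert x ?S \<notin> small (?J x)" by (auto simp: small_def)
                  ultimately obtain p where p: "p < q" "insert x ?S = insert x (dec (s1 ''l'' p))" by auto
                  then have "?S = dec (s1 ''l'' p)"
                    using notin[of p] notin[OF q(1)] q(1) by (metis insert_ident less_trans)
                  moreover have "inj_on (\<lambda>q. dec (s1 ''l'' q)) {..<e0}" using I by (simp add: bij_betw_def e0_def)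
                  ultimately show False using p q by (auto dest: inj_onD)
                qed
                have FS: "?F (Suc q) = insert (insert x ?S) (?F q)" using ins_Suc True by auto
                have "finite (?F q)" using bij_betw_finite[OF conjunct1[OF conjunct1[OF I2]]] by simp
                then have "card (?F (Suc q)) = Suc e'"
                  unfolding FS eF by (rule card_insert_disjoint) (rule new)
                then have e'B: "Suc e' \<le> ?B" using FB[OF Suc_leI[OF q(1)]] by (simp only:)
                let ?l = "(s2 ''l'')(e' := s1 ''l'' q + 2 ^ rk x)"
                have "bij_betw (\<lambda>p. dec (?l p)) {..<Suc e'} (?F (Suc q))"
                  unfolding FS lessThan_Suc
                proof -
                  have b: "bij_betw (\<lambda>p. dec (?l p)) {..<e'} (?F q)"
                    using I2 by (subst bij_betw_cong[of _ _ "\<lambda>p. dec (s2 ''l'' p)"]) (auto simp: e'_def)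
                  have "bij_betw (\<lambda>p. dec (?l p)) ({..<e'} \<union> {e'}) (?F q \<union> {insert x ?S})"
                    by (rule bij_betw_combine[OF b]) (use new add in auto)
                  then show "bij_betw (\<lambda>p. dec (?l p)) (insert e' {..<e'}) (insert (insert x ?S) (?F q))" by simp
                qed
                then have b': "bij_betw (\<lambda>p. dec (?l p)) {..<Suc (s2 ''nl'' 0)} (?F (Suc q))" by (simp add: e'_def)
                have cond: "bval (Neg (Less (V ''u'') (Mul (Const 3) (Add (Get ''d'' (V ''q'')) (Const 1))))) s2"
                  using True q lq v2 by simp
                have lt: "s1 ''l'' q + 2 ^ rk x < 2 ^ D" using add(1) D(3) by (rule less_trans)
                have "Suc (card ?S) \<le> 3 * (card ?S + 1)" by simp
                also note True
                also note card_free_le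
                finally have "Suc (card ?S) \<le> n" .
                then have lt': "Suc (card ?S) < 2 ^ D" using D(1) by (rule le_less_trans)
                have lt'': "Suc e' < 2 ^ D" using e'B D by simp
                have "ok D (Assign ''l'' (V ''nl'') (Add (Get ''l'' (V ''q'')) (Get ''w'' (V ''x''))) ;;
                   Assign ''d'' (V ''nl'') (Add (Get ''d'' (V ''q'')) (Const 1)) ;;
                   ''nl'' ::= Add (V ''nl'') (Const 1)) (1 + (1 + 1)) (\<lambda>s3. ?bij (put ''q'' (Suc q) s3) (?F (Suc q)) \<and>
                 e0 \<le> (put ''q'' (Suc q) s3) ''nl'' 0 \<and>
                 (\<forall>p<e0. (put ''q'' (Suc q) s3) ''l'' p = s1 ''l'' p)) s2"
                proof (intro ok_Seq ok_Assign, goal_cases)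
                  case 4
                  have "bij_betw (\<lambda>p. dec (((s2 ''l'')(s2 ''nl'' 0 := s1 ''l'' q + 2 ^ rk x)) p)) {..<Suc (s2 ''nl'' 0)} (?F (Suc q))"
                    using b' by (simp add: e'_def)
                  moreover have "\<forall>p<Suc e'. ?l p < ?P \<and> ((s2 ''d'')(e' := Suc (card ?S))) p = card (dec (?l p))"
                    using I2 add card' by (auto simp: less_Suc_eq e'_def)
                  ultimately show ?case using I2 q lq v2 ne by (simp add: e'_def)
                qed (use q lq v2 lt lt' lt'' ne in \<open>simp_all add: e'_def\<close>)
                then show ?thesis using cond by (intro ok_If) (auto intro: ok_steps)
              next
                case False
                then have "?F (Suc q) = ?F q" using ins_Suc by auto
                moreover have "\<not> bval (Neg (Less (V ''u'') (Mul (Const 3) (Add (Get ''d'' (V ''q'')) (Const 1))))) s2"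
                  using False q lq v2 by simp
                ultimately show ?thesis using I2 by (intro ok_If ok_Skip) auto
              qed
            }
            assume I2: "?bij s2 (?F e0) \<and> e0 \<le> s2 ''nl'' 0 \<and> (\<forall>p<e0. s2 ''l'' p = s1 ''l'' p)"
            have im: "(\<lambda>q. dec (s1 ''l'' q)) ` {..<e0} = small (?J x)" using I by (simp add: bij_betw_def e0_def)
            have "?ins e0 = {insert x S |S. S \<in> small (?J x) \<and> 3 * (card S + 1) \<le> card free}"
              unfolding im[symmetric] by auto
            then have "?F e0 = small (?J (Suc x))" using small_insert[OF JS xf xJ] xf by (simp only: J_Suc if_True)
            then show "?bij (put ''x'' (Suc x) s2) (small (?J (Suc x)))" using I2 by simp
          next
            show "e0 < 2 ^ D" using e0 D by simp
            show "?bij (put ''q'' 0 ?s1) (?F 0) \<and> e0 \<le> (put ''q'' 0 ?s1) ''nl'' 0 \<and>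
                (\<forall>p<e0. (put ''q'' 0 ?s1) ''l'' p = s1 ''l'' p)"
              using I by (simp add: e0_def)
          qed simp
        qed
        then show "ok D (''y'' ::= V ''nl'' ;; For ''q'' (V ''y'') ?upd) (1 + (?B * ((3 + 1 + 1) + 2) + 2))
          (\<lambda>s2. ?bij (put ''x'' (Suc x) s2) (small (?J (Suc x)))) s1"
          by (rule ok_steps) (use e0 in simp)
      next
        assume "\<not> bval (Equal (Get ''c'' (V ''x'')) (Const 0)) s1"
        then have "x \<notin> free" using x c by (simp add: free_def)
        then show "ok D Skip 1 (\<lambda>s2. ?bij (put ''x'' (Suc x) s2) (small (?J (Suc x)))) s1"
          using I by (intro ok_Skip) (simp only: J_Suc if_False, simp)
      qed
    }
    assume I: "?bij s1 (small (?J n))"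
    then show "bij_betw (\<lambda>q. dec (s1 ''l'' q)) {..<s1 ''nl'' 0} (small free) \<and> (\<forall>q<s1 ''nl'' 0. s1 ''l'' q < ?P)"
      by (simp only: Jn) simp
  next
    \<comment> \<open>The list starts with the mask 0 alone, the empty set, which is the only subset
      of the empty prefix.\<close>
    show "?bij (put ''x'' 0 ?s) (small (?J 0))"
      unfolding small0 by (auto simp: bij_betw_def lessThan_Suc)
  qed (use D in auto)
  then have "ok D list_masks (1 + (1 + (1 + (n * (((1 + (?B * ((3 + 1 + 1) + 2) + 2)) + 1 + 1) + 2) + 2))))
     (\<lambda>s'. bij_betw (\<lambda>q. dec (s' ''l'' q)) {..<s' ''nl'' 0} (small free) \<and>
        (\<forall>q<s' ''nl'' 0. s' ''l'' q < ?P)) s"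
    unfolding list_masks_def by (intro ok_Seq ok_Assign) (use D1 in simp_all)
  then show ?thesis by (rule ok_steps) (simp add: algebra_simps)
qed

lemma ok_conflict_test:
  assumes e: "env s" and j: "s ''j'' 0 < m" "s ''r'' 0 < m" and D: "n < 2 ^ D" "0 < D"
  shows "ok D conflict_test (n * 5 + 3) (\<lambda>s'. s' ''e'' 0 = of_bool (conflict (s ''j'' 0) (s ''r'' 0))) s"
  unfolding conflict_test_def
proof (rule ok_steps, rule ok_Seq, rule ok_Assign)
  let ?j = "s ''j'' 0" and ?r = "s ''r'' 0"
  let ?s = "s(''e'' := (s ''e'')(aval (Const 0) s := aval (Const 0) s))"
  let ?b = "If (Conj (Equal (Get ''h'' (Add (Mul (V ''j'') (V ''n'')) (V ''x''))) (Const 1))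
         (Equal (Get ''h'' (Add (Mul (V ''r'') (V ''n'')) (V ''x''))) (Const 1))) (''e'' ::= Const 1) Skip"
  have D1: "(1::nat) < 2 ^ D" using D(2) one_less_power[of "2::nat" D] by simp
  show "ok D (For ''x'' (V ''n'') ?b) (n * ((1 + 1 + 1) + 2) + 2)
    (\<lambda>s'. s' ''e'' 0 = of_bool (conflict ?j ?r)) ?s"
  proof (rule ok_For[where I = "\<lambda>i s'. s' ''e'' 0 = of_bool (\<exists>x<i. mem ?j x \<and> mem ?r x)"])
    fix s' assume f: "frame (insert ''x'' (writes ?b)) ?s s'"
    note fr = frameD[OF f]
    have e': "env s'" by (rule env_mono[OF _ f]) (use e in auto)
    show "aval (V ''n'') s' = n" using e' by (simp add: env_def)
    fix i assume i: "i < n" "s' ''x'' 0 = i" and I: "s' ''e'' 0 = of_bool (\<exists>x<i. mem ?j x \<and> mem ?r x)"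
    have "s' ''h'' (?j * n + i) = of_bool (mem ?j i)" "s' ''h'' (?r * n + i) = of_bool (mem ?r i)" "s' ''n'' 0 = n"
      using e' i j by (simp_all add: env_def)
    then show "ok D ?b (1 + 1 + 1) (\<lambda>s''. (put ''x'' (Suc i) s'') ''e'' 0 =
        of_bool (\<exists>x<Suc i. mem ?j x \<and> mem ?r x)) s'"
      by (intro ok_If ok_Assign ok_Skip) (use I i D1 in \<open>auto simp: fr less_Suc_eq\<close>)
  qed (use D in \<open>auto simp: conflict_def\<close>)
qed simp_all

lemma ok_cheapest:
  assumes e: "env s" and j: "s ''j'' 0 < m" and D: "n < 2 ^ D" "0 < D" "m + 1 < 2 ^ D"
  shows "ok D cheapest (m * (n * 5 + 9) + 3)
    (\<lambda>s'. (\<forall>r<m. conflict (s ''j'' 0) r \<longrightarrow> s' ''bp'' 0 \<le> s ''pr'' r) \<and> s' ''bp'' 0 \<le> m + 1 \<and>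
       (s' ''bp'' 0 < m + 1 \<longrightarrow> s' ''br'' 0 < m \<and> conflict (s ''j'' 0) (s' ''br'' 0) \<and> s ''pr'' (s' ''br'' 0) = s' ''bp'' 0)) s"
  unfolding cheapest_def
proof (rule ok_steps, rule ok_Seq, rule ok_Assign)
  let ?j = "s ''j'' 0" and ?pr = "s ''pr''"
  have sm: "s ''m'' 0 = m" using e by (simp add: env_def)
  show "aval (Add (V ''m'') (Const 1)) s < 2 ^ D" using D sm by simp
  let ?s = "s(''bp'' := (s ''bp'')(aval (Const 0) s := aval (Add (V ''m'') (Const 1)) s))"
  let ?c = "If (Conj (Equal (V ''e'') (Const 1)) (Less (Get ''pr'' (V ''r'')) (V ''bp'')))
         (''bp'' ::= Get ''pr'' (V ''r'') ;; ''br'' ::= V ''r'') Skip"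
  let ?b = "conflict_test ;; ?c"
  let ?I = "\<lambda>i s'. (\<forall>r<i. conflict ?j r \<longrightarrow> s' ''bp'' 0 \<le> ?pr r) \<and> s' ''bp'' 0 \<le> m + 1 \<and>
       (s' ''bp'' 0 < m + 1 \<longrightarrow> s' ''br'' 0 < m \<and> conflict ?j (s' ''br'' 0) \<and> ?pr (s' ''br'' 0) = s' ''bp'' 0)"
  show "ok D (For ''r'' (V ''m'') ?b) (m * (((n * 5 + 3) + ((1 + 1) + 1 + 1)) + 2) + 2) (?I m) ?s"
  proof (rule ok_For[where I = ?I])
    fix s' assume f: "frame (insert ''r'' (writes ?b)) ?s s'"
    note fr = frameD[OF f]
    have e': "env s'" by (rule env_mono[OF _ f]) (use e in auto)
    show "aval (V ''m'') s' = m" using e' by (simp add: env_def)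
    {
      fix i assume i: "i < m" "s' ''r'' 0 = i" and I: "?I i s'"
      show "ok D ?b ((n * 5 + 3) + ((1 + 1) + 1 + 1)) (\<lambda>s''. ?I (Suc i) (put ''r'' (Suc i) s'')) s'"
      proof (rule ok_Seq, rule ok_post[OF ok_conflict_test[OF e']])
        fix s'' assume f2: "frame (writes conflict_test) s' s''"
          and q: "s'' ''e'' 0 = of_bool (conflict (s' ''j'' 0) (s' ''r'' 0))"
        have v: "s'' ''e'' 0 = of_bool (conflict ?j i)" "s'' ''r'' 0 = i" "s'' ''pr'' = ?pr"
          "s'' ''bp'' = s' ''bp''" "s'' ''br'' = s' ''br''"
          using q i by (simp_all add: fr frameD[OF f2])
        have "s' ''bp'' 0 \<le> m + 1" using I by simp
        then have lt: "s' ''bp'' 0 < 2 ^ D" "i < 2 ^ D" using D i by simp_all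
        have less: "\<forall>r<Suc i. conflict ?j r \<longrightarrow> ?pr i \<le> ?pr r" if "?pr i < s' ''bp'' 0"
        proof (intro allI impI)
          fix r assume "r < Suc i" "conflict ?j r"
          moreover have "s' ''bp'' 0 \<le> ?pr r" if "r < i" "conflict ?j r" using I that by blast
          ultimately show "?pr i \<le> ?pr r" using that by (cases "r = i") auto
        qed
        have geq: "\<forall>r<Suc i. conflict ?j r \<longrightarrow> s' ''bp'' 0 \<le> ?pr r" if "\<not> (conflict ?j i \<and> ?pr i < s' ''bp'' 0)"
        proof (intro allI impI)
          fix r assume "r < Suc i" "conflict ?j r"
          moreover have "s' ''bp'' 0 \<le> ?pr r" if "r < i" "conflict ?j r" using I that by blast
          ultimately show "s' ''bp'' 0 \<le> ?pr r" using that by (cases "r = i") auto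
        qed
        show "ok D ?c ((1 + 1) + 1 + 1) (\<lambda>s''. ?I (Suc i) (put ''r'' (Suc i) s'')) s''"
        proof (intro ok_If ok_Seq ok_Assign ok_Skip, goal_cases)
          case 3
          then have "conflict ?j i" "?pr i < s' ''bp'' 0" using v by simp_all
          with less show ?case using v I i by simp
        next
          case 4
          then have "\<not> (conflict ?j i \<and> ?pr i < s' ''bp'' 0)" using v by simp
          with geq I show ?case using v by simp
        qed (use v lt in simp_all)
      qed (use i j D in \<open>auto simp: fr\<close>)
    }
  qed (use sm D in auto)
qed simp

lemma ok_run_auction:
  assumes e: "env s" and D: "n < 2 ^ D" "0 < D" "m * (m + 1) + 1 < 2 ^ D" "m + 1 < 2 ^ D"
    and LR: "L \<subseteq> {..<m}" "R \<subseteq> {..<m}"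
    and inv: "auction.invar m L R conflict (s ''mt'') (s ''ow'') (s ''pr'')"
  shows "ok D run_auction ((m * (m + 1) + 1) * (m * (m * (n * 5 + 9) + 15) + 4) + 2)
    (\<lambda>s'. auction.invar m L R conflict (s' ''mt'') (s' ''ow'') (s' ''pr'') \<and>
       auction.final m conflict (s' ''mt'') (s' ''pr'')) s"
proof -
  interpret auction m L R conflict using LR by unfold_locales
  let ?inv = "\<lambda>s. invar (s ''mt'') (s ''ow'') (s ''pr'')"
  let ?fin = "\<lambda>s. final (s ''mt'') (s ''pr'')"
  let ?sum = "\<lambda>s. \<Sum>r<m. s ''pr'' r"
  let ?H = "m * (m + 1) + 1"
  let ?a = "If (Less (V ''bp'') (Add (V ''m'') (Const 1))) take_good Skip"
  let ?b = "If (Equal (Get ''mt'' (V ''j'')) (Const 0)) (cheapest ;; ?a) Skip"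
  let ?l = "For ''j'' (V ''m'') ?b"
  let ?done = "\<lambda>s j. s ''mt'' j = (0::nat) \<longrightarrow> (\<forall>r<m. conflict j r \<longrightarrow> m + 1 \<le> s ''pr'' r)"
  have D1: "(1::nat) < 2 ^ D" using D(2) one_less_power[of "2::nat" D] by simp
  have "ok D run_auction (?H * ((m * ((((m * (n * 5 + 9) + 3) + (((1 + 1 + 1) + (1 + (1 + 1))) + 1 + 1)) + 1 + 1) + 2) + 2) + 2) + 2)
    (\<lambda>s'. ?inv s' \<and> ?fin s') s"
    unfolding run_auction_def
  \<comment> \<open>The total price serves as the progress measure: it has grown with every sweep
    unless the auction is over.\<close>
  proof (rule ok_For[where I = "\<lambda>it s'. ?inv s' \<and> (it \<le> ?sum s' \<or> ?fin s')"])
    fix s1 assume f1: "frame (insert ''it'' (writes ?l)) s s1"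
    have e1: "env s1" by (rule env_mono[OF _ f1]) (use e in auto)
    show "aval (Add (Mul (V ''m'') (Add (V ''m'') (Const 1))) (Const 1)) s1 = ?H" using e1 by (simp add: env_def)
    {
      fix it assume it: "it < ?H" and I1: "?inv s1 \<and> (it \<le> ?sum s1 \<or> ?fin s1)"
      \<comment> \<open>Within a sweep, either the total price has already reached the next value,
        or all bidders visited so far are matched or priced out. If the second alternative survives
        the whole sweep, the state is final.\<close>
      let ?I = "\<lambda>j s'. ?inv s' \<and> (Suc it \<le> ?sum s' \<or> (it \<le> ?sum s' \<or> ?fin s') \<and> (\<forall>i<j. ?done s' i))"
      show "ok D ?l (m * ((((m * (n * 5 + 9) + 3) + (((1 + 1 + 1) + (1 + (1 + 1))) + 1 + 1)) + 1 + 1) + 2) + 2)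
        (\<lambda>s2. ?inv (put ''it'' (Suc it) s2) \<and>
          (Suc it \<le> ?sum (put ''it'' (Suc it) s2) \<or> ?fin (put ''it'' (Suc it) s2))) s1"
      proof (rule ok_For[where I = ?I])
        fix s2 assume f2: "frame (insert ''j'' (writes ?b)) s1 s2"
        have e2: "env s2" by (rule env_mono[OF _ f2]) (use e1 in auto)
        show "aval (V ''m'') s2 = m" using e2 by (simp add: env_def)
        {
          fix j assume j: "j < m" "s2 ''j'' 0 = j" and I: "?I j s2"
          show "ok D ?b (((m * (n * 5 + 9) + 3) + (((1 + 1 + 1) + (1 + (1 + 1))) + 1 + 1)) + 1 + 1)
            (\<lambda>s3. ?I (Suc j) (put ''j'' (Suc j) s3)) s2"
          proof (rule ok_If)
            assume "bval (Equal (Get ''mt'' (V ''j'')) (Const 0)) s2"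
            then have mt0: "s2 ''mt'' j = 0" using j by simp
            show "ok D (cheapest ;; ?a) ((m * (n * 5 + 9) + 3) + (((1 + 1 + 1) + (1 + (1 + 1))) + 1 + 1))
              (\<lambda>s3. ?I (Suc j) (put ''j'' (Suc j) s3)) s2"
            proof (rule ok_Seq, rule ok_post[OF ok_cheapest[OF e2]])
              fix s3 assume f3: "frame (writes cheapest) s2 s3"
                and q: "(\<forall>r<m. conflict (s2 ''j'' 0) r \<longrightarrow> s3 ''bp'' 0 \<le> s2 ''pr'' r) \<and> s3 ''bp'' 0 \<le> m + 1 \<and>
                  (s3 ''bp'' 0 < m + 1 \<longrightarrow> s3 ''br'' 0 < m \<and> conflict (s2 ''j'' 0) (s3 ''br'' 0) \<and>
                     s2 ''pr'' (s3 ''br'' 0) = s3 ''bp'' 0)"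
              have v: "s3 ''mt'' = s2 ''mt''" "s3 ''ow'' = s2 ''ow''" "s3 ''pr'' = s2 ''pr''" "s3 ''j'' 0 = j"
                using j by (simp_all add: frameD[OF f3])
              have e3: "env s3" by (rule env_mono[OF _ f3]) (use e2 in auto)
              have m3: "s3 ''m'' 0 = m" using e3 by (simp add: env_def)
              define b where "b = s3 ''br'' 0"
              show "ok D ?a (((1 + 1 + 1) + (1 + (1 + 1))) + 1 + 1)
                (\<lambda>s3. ?I (Suc j) (put ''j'' (Suc j) s3)) s3"
              proof (rule ok_If)
                assume "bval (Less (V ''bp'') (Add (V ''m'') (Const 1))) s3"
                then have bp: "s3 ''bp'' 0 < m + 1" using m3 by simp
                then have b: "b < m" "conflict j b" "s2 ''pr'' b = s3 ''bp'' 0" "s2 ''pr'' b < m + 1"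
                  using q j by (auto simp: b_def)
                let ?mt = "(if 0 < s2 ''ow'' b then (s2 ''mt'')(s2 ''ow'' b - 1 := 0) else s2 ''mt'')(j := 1)"
                let ?ow = "(s2 ''ow'')(b := Suc j)" and ?pr = "(s2 ''pr'')(b := s2 ''pr'' b + 1)"
                have inv': "invar ?mt ?ow ?pr"
                  by (rule invar_step[of "s2 ''mt''"]) (use I j mt0 b q in auto)
                have sum': "(\<Sum>r<m. ?pr r) = ?sum s2 + 1"
                  using b(1) by (simp add: sum.remove[of "{..<m}" b] cong: sum.cong_simp)
                \<comment> \<open>Bidder \<open>j\<close> can still afford \<open>b\<close>, so the
                  auction was not over. Hence the total price was at least \<open>it\<close>, and
                  this raise lifts it to \<open>Suc it\<close>.\<close>
                have "\<not> ?fin s2" using b j mt0 unfolding final_def by force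
                then have prog: "Suc it \<le> (\<Sum>r<m. ?pr r)" using I sum' by auto
                have lt: "Suc j < 2 ^ D" "Suc (s3 ''bp'' 0) < 2 ^ D" using j bp D by simp_all
                define inv'' where "inv'' mt ow pr \<longleftrightarrow> invar mt ow pr \<and> Suc it \<le> (\<Sum>r<m. pr r)" for mt ow pr
                have i2: "inv'' ?mt ?ow ?pr" using inv' prog by (simp add: inv''_def)
                have "ok D take_good ((1 + 1 + 1) + (1 + (1 + 1))) (\<lambda>s4. inv'' (s4 ''mt'') (s4 ''ow'') (s4 ''pr'')) s3"
                  unfolding take_good_def
                proof (intro ok_Seq ok_If ok_Assign ok_Skip, goal_cases)
                  case 5
                  then show ?case using i2 v b by (simp add: b_def[symmetric])
                next
                  case 9
                  then show ?case using i2 v b by (simp add: b_def[symmetric])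
                qed (use v lt D1 in simp_all)
                then show "ok D take_good ((1 + 1 + 1) + (1 + (1 + 1)))
                  (\<lambda>s3. ?I (Suc j) (put ''j'' (Suc j) s3)) s3"
                  by (rule ok_post) (auto simp: inv''_def)
              next
                assume "\<not> bval (Less (V ''bp'') (Add (V ''m'') (Const 1))) s3"
                then have "m + 1 \<le> s3 ''bp'' 0" using m3 by simp
                then have "?done s2 j" using q j by (meson order_trans)
                then have "?I (Suc j) s2" using I by (auto simp: less_Suc_eq)
                then show "ok D Skip 1 (\<lambda>s3. ?I (Suc j) (put ''j'' (Suc j) s3)) s3"
                  by (intro ok_Skip) (simp add: v)
              qed
            qed (use j D in auto)
          next
            assume "\<not> bval (Equal (Get ''mt'' (V ''j'')) (Const 0)) s2"
            then have "?I (Suc j) s2" using I j by (auto simp: less_Suc_eq)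
            then show "ok D Skip 1 (\<lambda>s3. ?I (Suc j) (put ''j'' (Suc j) s3)) s2"
              by (intro ok_Skip) simp
          qed
        }
        assume "?I m s2"
        then show "?inv (put ''it'' (Suc it) s2) \<and>
          (Suc it \<le> ?sum (put ''it'' (Suc it) s2) \<or> ?fin (put ''it'' (Suc it) s2))"
          by (auto simp: final_def)
      qed (use I1 D in auto)
    }
    assume I: "?inv s1 \<and> (?H \<le> ?sum s1 \<or> ?fin s1)"
    \<comment> \<open>The number of sweeps is one more than the largest possible total price, which
      rules out the first alternative of the invariant.\<close>
    have "?sum s1 \<le> (\<Sum>r<m. m + 1)" using I by (intro sum_mono) (auto simp: invar_def)
    then have "\<not> ?H \<le> ?sum s1" by simp
    then show "?inv s1 \<and> ?fin s1" using I by blast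
  next
    show "?H < 2 ^ D" by (fact D(3))
  qed (use inv in auto)
  then show ?thesis by (rule ok_steps) (simp add: algebra_simps)
qed

end

text \<open>The color of the fixed class is \<open>o + 1\<close>; the other two follow cyclically.
  The three counts accumulate in \<open>s\<close>. The arrays \<open>mt\<close> and
  \<open>pr\<close> serve at first as characteristic functions of the two sides of the conflict
  graph, that is, of the sets still possible in the complement of the mask.\<close>

definition count_classes :: com where
  "count_classes = ''s'' ::= Const 0 ;; ''X'' ::= Get ''l'' (V ''q'') ;;
     ''i'' ::= Add (V ''o'') (Const 1) ;; count True ''f'' ;;
     ''i'' ::= Add (Rem (Add (V ''o'') (Const 1)) (Const 3)) (Const 1) ;; count False ''mt'' ;;
     ''i'' ::= Add (Rem (Add (V ''o'') (Const 2)) (Const 3)) (Const 1) ;; count False ''pr''"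

text \<open>Turns the two characteristic functions into starting values of the auction: members of
  the left side become unmatched, members of the right side get price 0, and all other indices get
  the neutral values 1 and \<open>m + 1\<close>.\<close>

definition init_auction :: com where
  "init_auction = For ''j'' (V ''m'')
     (Assign ''mt'' (V ''j'') (Sub (Const 1) (Get ''mt'' (V ''j''))) ;;
      Assign ''pr'' (V ''j'') (Mul (Sub (Const 1) (Get ''pr'' (V ''j''))) (Add (V ''m'') (Const 1))) ;;
      Assign ''ow'' (V ''j'') (Const 0))"

definition subtract_matched :: com where
  "subtract_matched = For ''j'' (V ''m'')
     (If (Less (Const 0) (Get ''ow'' (V ''j''))) (''s'' ::= Sub (V ''s'') (Const 1)) Skip)"

definition try_class :: com where
  "try_class = count_classes ;; init_auction ;; run_auction ;; subtract_matched"

definition three_search :: com where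
  "three_search = list_masks ;; ''best'' ::= Const 0 ;;
     For ''o'' (Const 3) (For ''q'' (V ''nl'')
       (try_class ;; If (Less (V ''best'') (V ''s'')) (''best'' ::= V ''s'') Skip)) ;;
     If (Less (V ''best'') (V ''g'')) (''out'' ::= Const 0) (''out'' ::= Const 1)"

lemma writes_count_classes [simp]:
  "writes count_classes = {''X'', ''s'', ''i'', ''t'', ''x'', ''j'', ''f'', ''mt'', ''pr''}"
  by (auto simp: count_classes_def)

lemma writes_init_auction [simp]: "writes init_auction = {''j'', ''mt'', ''pr'', ''ow''}"
  by (auto simp: init_auction_def)

lemma writes_subtract_matched [simp]: "writes subtract_matched = {''j'', ''s''}"
  by (auto simp: subtract_matched_def)

lemma writes_try_class [simp]:
  "writes try_class = {''X'', ''s'', ''i'', ''t'', ''x'', ''j'', ''f'', ''mt'', ''pr'', ''ow'', ''it'', ''bp'', ''r'', ''e'', ''br''}"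
  by (auto simp: try_class_def)

context set_family
begin

lemma ok_count_classes:
  assumes e: "env s" and D: "n < 2 ^ D" "2 < D" "3 * m < 2 ^ D" "s ''l'' (s ''q'' 0) < 2 ^ D"
    and o: "o' < 3" "s ''o'' 0 = o'" and S: "S = dec (s ''l'' (s ''q'' 0))"
    and i: "i = o' + 1" "a = (o' + 1) mod 3 + 1" "b = (o' + 2) mod 3 + 1"
  shows "ok D count_classes (3 * (m * (n * 5 + 7) + 2) + 5)
     (\<lambda>s'. s' ''s'' 0 = card (sats i S) + card (sats a (free - S)) + card (sats b (free - S)) \<and>
        (\<forall>j<m. s' ''mt'' j = of_bool (j \<in> sats a (free - S)) \<and> s' ''pr'' j = of_bool (j \<in> sats b (free - S)))) s"
proof -
  let ?N = "m * (n * 5 + 7) + 2"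
  let ?Q = "\<lambda>s'. s' ''s'' 0 = card (sats i S) + card (sats a (free - S)) + card (sats b (free - S)) \<and>
        (\<forall>j<m. s' ''mt'' j = of_bool (j \<in> sats a (free - S)) \<and> s' ''pr'' j = of_bool (j \<in> sats b (free - S)))"
  have "(2::nat) ^ 2 < 2 ^ D" using D(2) by (intro power_strict_increasing) auto
  then have D4: "(4::nat) < 2 ^ D" by simp
  have mD: "m < 2 ^ D" using D(3) by simp
  have D0: "0 < D" using D(2) by simp
  let ?X = "s ''l'' (s ''q'' 0)"
  have c1: "card (sats i S) \<le> m" "card (sats a (free - S)) \<le> m" by (rule card_sats_le)+
  have "ok D count_classes (1 + (1 + (1 + (?N + (1 + (?N + (1 + ?N))))))) ?Q s"
    unfolding count_classes_def
  proof (rule ok_Seq, rule ok_Assign, goal_cases)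
    case 2
    show ?case
    proof (rule ok_Seq, rule ok_Assign, goal_cases)
      case 2
      show ?case
      proof (rule ok_Seq, rule ok_Assign, goal_cases)
        case 2
        let ?s1 = "s(''s'' := (s ''s'')(0 := 0), ''X'' := (s ''X'')(0 := ?X), ''i'' := (s ''i'')(0 := i))"
        have e1: "env ?s1" using e by simp
        have v1: "?s1 ''s'' 0 = 0" "?s1 ''i'' 0 = i" "?s1 ''X'' 0 = ?X" "?s1 ''o'' 0 = o'" using o by simp_all
        have "ok D (count True ''f'' ;;
           ''i'' ::= Add (Rem (Add (V ''o'') (Const 1)) (Const 3)) (Const 1) ;; count False ''mt'' ;;
           ''i'' ::= Add (Rem (Add (V ''o'') (Const 2)) (Const 3)) (Const 1) ;; count False ''pr'')
           (?N + (1 + (?N + (1 + ?N)))) ?Q ?s1"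
        proof (rule ok_Seq, rule ok_post[OF ok_count[OF e1]], goal_cases)
          case (6 s2)
          have e2: "env s2" by (rule env_mono[OF _ 6(1)]) (use e1 in auto)
          have v2: "s2 ''s'' 0 = card (sats i S)" "s2 ''X'' 0 = ?X" "s2 ''o'' 0 = o'"
            using 6(2) v1 S by (simp_all add: frameD[OF 6(1)])
          show ?case
          proof (rule ok_Seq, rule ok_Assign, goal_cases)
            case 2
            let ?s3 = "put ''i'' a s2"
            have e3: "env ?s3" using e2 by simp
            have "ok D (count False ''mt'' ;;
              ''i'' ::= Add (Rem (Add (V ''o'') (Const 2)) (Const 3)) (Const 1) ;; count False ''pr'') (?N + (1 + ?N)) ?Q ?s3"
            proof (rule ok_Seq, rule ok_post[OF ok_count[OF e3]], goal_cases)
              case (6 s4)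
              have e4: "env s4" by (rule env_mono[OF _ 6(1)]) (use e3 in auto)
              have v4: "s4 ''s'' 0 = card (sats i S) + card (sats a (free - S))" "s4 ''X'' 0 = ?X" "s4 ''o'' 0 = o'"
                "\<forall>j<m. s4 ''mt'' j = of_bool (j \<in> sats a (free - S))"
                using 6(2) v2 S by (simp_all add: frameD[OF 6(1)])
              show ?case
              proof (rule ok_Seq, rule ok_Assign, goal_cases)
                case 2
                let ?s5 = "put ''i'' b s4"
                have e5: "env ?s5" using e4 by simp
                have "ok D (count False ''pr'') ?N ?Q ?s5"
                proof (rule ok_post[OF ok_count[OF e5]], goal_cases)
                  case (6 s6)
                  then show ?case using v4 S by (simp add: frameD[OF 6(1)])
                qed (use D c1 D0 mD v4 in auto)
                then show ?case using v4 i by simp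
              qed (use v4 o D4 in simp)
            qed (use D c1 D0 mD v2 in auto)
            then show ?case using v2 i by simp
          qed (use v2 o D4 in simp)
        qed (use D D0 mD in auto)
        then show ?case using o i by simp
      qed (use o D4 in simp)
    qed (use D in simp)
  qed simp
  then show ?thesis by (rule ok_steps) simp
qed

lemma ok_init_auction:
  assumes e: "env s" and D: "0 < D" "m + 1 < 2 ^ D"
    and LR: "L \<subseteq> {..<m}" "R \<subseteq> {..<m}"
    and f: "\<forall>j<m. s ''mt'' j = of_bool (j \<in> L) \<and> s ''pr'' j = of_bool (j \<in> R)"
  shows "ok D init_auction (m * 5 + 2) (\<lambda>s'. auction.invar m L R conflict (s' ''mt'') (s' ''ow'') (s' ''pr'')) s"
proof -
  interpret auction m L R conflict using LR by unfold_locales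
  let ?b = "Assign ''mt'' (V ''j'') (Sub (Const 1) (Get ''mt'' (V ''j''))) ;;
      Assign ''pr'' (V ''j'') (Mul (Sub (Const 1) (Get ''pr'' (V ''j''))) (Add (V ''m'') (Const 1))) ;;
      Assign ''ow'' (V ''j'') (Const 0)"
  have D1: "(1::nat) < 2 ^ D" using D(1) one_less_power[of "2::nat" D] by simp
  have "ok D init_auction (m * ((1 + (1 + 1)) + 2) + 2) (\<lambda>s'. invar (s' ''mt'') (s' ''ow'') (s' ''pr'')) s"
    unfolding init_auction_def
  proof (rule ok_For[where I = "\<lambda>i s'. \<forall>j<m.
      (j < i \<longrightarrow> s' ''mt'' j = of_bool (j \<notin> L) \<and> s' ''pr'' j = (if j \<in> R then 0 else m + 1) \<and> s' ''ow'' j = 0) \<and>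
      (i \<le> j \<longrightarrow> s' ''mt'' j = of_bool (j \<in> L) \<and> s' ''pr'' j = of_bool (j \<in> R))"])
    fix s1 assume f1: "frame (insert ''j'' (writes ?b)) s s1"
    have e1: "env s1" by (rule env_mono[OF _ f1]) (use e in auto)
    then have m1: "s1 ''m'' 0 = m" by (simp add: env_def)
    then show "aval (V ''m'') s1 = m" by simp
    {
      fix i assume i: "i < m" "s1 ''j'' 0 = i" and I: "\<forall>j<m.
      (j < i \<longrightarrow> s1 ''mt'' j = of_bool (j \<notin> L) \<and> s1 ''pr'' j = (if j \<in> R then 0 else m + 1) \<and> s1 ''ow'' j = 0) \<and>
      (i \<le> j \<longrightarrow> s1 ''mt'' j = of_bool (j \<in> L) \<and> s1 ''pr'' j = of_bool (j \<in> R))"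
      have v: "s1 ''mt'' i = of_bool (i \<in> L)" "s1 ''pr'' i = of_bool (i \<in> R)" using I i by auto
      show "ok D ?b (1 + (1 + 1)) (\<lambda>s'. \<forall>j<m.
      (j < Suc i \<longrightarrow> (put ''j'' (Suc i) s') ''mt'' j = of_bool (j \<notin> L) \<and>
         (put ''j'' (Suc i) s') ''pr'' j = (if j \<in> R then 0 else m + 1) \<and>
         (put ''j'' (Suc i) s') ''ow'' j = 0) \<and>
      (Suc i \<le> j \<longrightarrow> (put ''j'' (Suc i) s') ''mt'' j = of_bool (j \<in> L) \<and>
         (put ''j'' (Suc i) s') ''pr'' j = of_bool (j \<in> R))) s1"
      proof (intro ok_Seq ok_Assign, goal_cases)
        case 4
        show ?case using I v i m1 by (auto simp: less_Suc_eq Suc_le_eq)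
      qed (use v i m1 D D1 in auto)
    }
    assume "\<forall>j<m.
      (j < m \<longrightarrow> s1 ''mt'' j = of_bool (j \<notin> L) \<and> s1 ''pr'' j = (if j \<in> R then 0 else m + 1) \<and> s1 ''ow'' j = 0) \<and>
      (m \<le> j \<longrightarrow> s1 ''mt'' j = of_bool (j \<in> L) \<and> s1 ''pr'' j = of_bool (j \<in> R))"
    then show "invar (s1 ''mt'') (s1 ''ow'') (s1 ''pr'')" by (intro invar_init) auto
  qed (use f D in auto)
  then show ?thesis by (rule ok_steps) simp
qed

lemma ok_subtract_matched:
  assumes e: "env s" and D: "m < 2 ^ D" "s ''s'' 0 < 2 ^ D"
  shows "ok D subtract_matched (m * 5 + 2) (\<lambda>s'. s' ''s'' 0 = s ''s'' 0 - card {r. r < m \<and> 0 < s ''ow'' r}) s"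
proof -
  let ?b = "If (Less (Const 0) (Get ''ow'' (V ''j''))) (''s'' ::= Sub (V ''s'') (Const 1)) Skip"
  define C where "C i = card {r. r < i \<and> 0 < s ''ow'' r}" for i
  have C_Suc: "C (Suc i) = C i + of_bool (0 < s ''ow'' i)" for i
  proof -
    have "{r. r < Suc i \<and> 0 < s ''ow'' r} = {r. r < i \<and> 0 < s ''ow'' r} \<union> (if 0 < s ''ow'' i then {i} else {})"
      by (auto simp: less_Suc_eq)
    then show ?thesis by (simp add: C_def)
  qed
  have "ok D subtract_matched (m * ((1 + 1 + 1) + 2) + 2) (\<lambda>s'. s' ''s'' 0 = s ''s'' 0 - C m) s"
    unfolding subtract_matched_def
  proof (rule ok_For[where I = "\<lambda>i s'. s' ''s'' 0 = s ''s'' 0 - C i"])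
    fix s1 assume f1: "frame (insert ''j'' (writes ?b)) s s1"
    have e1: "env s1" by (rule env_mono[OF _ f1]) (use e in auto)
    then show "aval (V ''m'') s1 = m" by (simp add: env_def)
    fix i assume i: "i < m" "s1 ''j'' 0 = i" and I: "s1 ''s'' 0 = s ''s'' 0 - C i"
    have "s1 ''ow'' = s ''ow''" by (simp add: frameD[OF f1])
    then show "ok D ?b (1 + 1 + 1) (\<lambda>s'. (put ''j'' (Suc i) s') ''s'' 0 = s ''s'' 0 - C (Suc i)) s1"
      by (intro ok_If ok_Assign ok_Skip) (use i I D in \<open>auto simp: C_Suc\<close>)
  qed (use D in \<open>auto simp: C_def\<close>)
  then show ?thesis unfolding C_def by (rule ok_steps) simp
qed

text \<open>By Koenig's theorem the vertices of the conflict graph minus the matched goods count a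
  maximum independent set. The result dominates every coloring with class \<open>S\<close>;
  conversely it only has to be attained by some extension, which suffices for a maximum over all
  candidates.\<close>

lemma ok_try_class:
  assumes k: "k = 3" and e: "env s"
    and D: "n < 2 ^ D" "2 < D" "3 * m + 1 < 2 ^ D" "m * (m + 1) + 1 < 2 ^ D" "s ''l'' (s ''q'' 0) < 2 ^ D"
    and o: "o' < 3" "s ''o'' 0 = o'" and S: "S = dec (s ''l'' (s ''q'' 0))"
    and N: "N = (3 * (m * (n * 5 + 7) + 2) + 5) + ((m * 5 + 2) +
       (((m * (m + 1) + 1) * (m * (m * (n * 5 + 9) + 15) + 4) + 2) + (m * 5 + 2)))"
  shows "ok D try_class N (\<lambda>s'. (\<forall>c. ext c \<and> cls c (Suc o') = S \<longrightarrow> score c \<le> s' ''s'' 0) \<and>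
     (\<exists>c. ext c \<and> s' ''s'' 0 \<le> score c) \<and> s' ''s'' 0 < 2 ^ D) s"
proof -
  define i a b where iab: "i = o' + 1" "a = (o' + 1) mod 3 + 1" "b = (o' + 2) mod 3 + 1"
  define L R where LR: "L = sats a (free - S)" "R = sats b (free - S)"
  have "o' = 0 \<or> o' = 1 \<or> o' = 2" using o by linarith
  then have abi: "{i, a, b} = {1, 2, 3}" by (elim disjE) (auto simp: iab)
  have LRm: "L \<subseteq> {..<m}" "R \<subseteq> {..<m}" unfolding LR by (rule sats_subset)+
  interpret auction m L R conflict using LRm by unfold_locales
  let ?v = "card (sats i S) + card L + card R"
  have vm: "?v \<le> 3 * m" using card_sats_le[of i S] card_sats_le[of a "free - S"] card_sats_le[of b "free - S"]
    by (simp add: LR)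
  have mD: "m + 1 < 2 ^ D" "3 * m < 2 ^ D" using D(3) by simp_all
  show ?thesis unfolding try_class_def N
  proof (rule ok_Seq, rule ok_post[OF ok_count_classes[OF e D(1,2) mD(2) D(5) o S iab]], goal_cases)
    case (1 s1)
    have e1: "env s1" by (rule env_mono[OF _ 1(1)]) (use e in auto)
    have f1: "\<forall>j<m. s1 ''mt'' j = of_bool (j \<in> L) \<and> s1 ''pr'' j = of_bool (j \<in> R)" and s1: "s1 ''s'' 0 = ?v"
      using 1(2) by (auto simp: LR)
    show ?case
    proof (rule ok_Seq, rule ok_post[OF ok_init_auction[OF e1 _ mD(1) LRm f1]], goal_cases)
      case (2 s2)
      have e2: "env s2" by (rule env_mono[OF _ 2(1)]) (use e1 in auto)
      have s2: "s2 ''s'' 0 = ?v" using s1 by (simp add: frameD[OF 2(1)])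
      show ?case
      proof (rule ok_Seq, rule ok_post[OF ok_run_auction[OF e2 D(1) _ D(4) mD(1) LRm 2(2)]], goal_cases)
        case (2 s3)
        have e3: "env s3" by (rule env_mono[OF _ 2(1)]) (use e2 in auto)
        have s3: "s3 ''s'' 0 = ?v" using s2 by (simp add: frameD[OF 2(1)])
        let ?M = "card {r. r < m \<and> 0 < s3 ''ow'' r}"
        have M: "?M \<le> card L + card R" using matched_le[OF conjunct1[OF 2(2)], of "{}" "{}"] by simp
        have vD: "?v < 2 ^ D" using vm mD by simp
        show ?case
        proof (rule ok_post[OF ok_subtract_matched[OF e3]], goal_cases)
          case (3 s4)
          have s4: "s4 ''s'' 0 = ?v - ?M" using 3(2) s3 by simp
          have "score c \<le> ?v - ?M" if c: "ext c" "cls c i = S" for c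
          proof -
            obtain A B where AB: "A \<subseteq> sats a (free - S)" "B \<subseteq> sats b (free - S)"
              "\<And>l r. l \<in> A \<Longrightarrow> r \<in> B \<Longrightarrow> \<not> conflict l r" "score c = card (sats i S) + card A + card B"
              by (rule three_coloring_independent[OF k abi c]) blast
            have "card A + card B + ?M \<le> card L + card R"
              by (rule matched_le[OF conjunct1[OF 2(2)]]) (use AB in \<open>auto simp: LR\<close>)
            then show ?thesis using AB(4) by simp
          qed
          moreover obtain c where "ext c" "?v - ?M \<le> score c"
          proof -
            obtain A B where AB: "A \<subseteq> L" "B \<subseteq> R" "\<And>l r. l \<in> A \<Longrightarrow> r \<in> B \<Longrightarrow> \<not> conflict l r"
              "card L + card R \<le> card A + card B + ?M"
              by (rule matched_ge[OF conjunct1[OF 2(2)] conjunct2[OF 2(2)]]) blast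
            have Sf: "S \<subseteq> free" unfolding S by (rule dec_subset)
            obtain c where "ext c" "card (sats i S) + card A + card B \<le> score c"
              by (rule independent_three_coloring[OF k abi Sf AB(1,2)[unfolded LR] AB(3)])
            then show ?thesis using AB(4) by (intro that) auto
          qed
          ultimately show ?case using s4 vD by (auto simp: iab)
        qed (use mD s3 vD in simp_all)
      qed (use D in simp)
    qed (use D in simp)
  qed
qed

lemma ok_three_search:
  assumes k: "k = 3" and e: "env s" and g: "s ''g'' 0 = tg"
    and D: "n < 2 ^ D" "2 < D" "3 * m + 1 < 2 ^ D" "m * (m + 1) + 1 < 2 ^ D" "2 ^ card free < (2 :: nat) ^ D"
    and B: "B = card (small free)"
    and N: "N = (3 * (m * (n * 5 + 7) + 2) + 5) + ((m * 5 + 2) +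
       (((m * (m + 1) + 1) * (m * (m * (n * 5 + 9) + 15) + 4) + 2) + (m * 5 + 2)))"
  shows "ok D three_search ((n * (B * 7 + 7) + 5) + (1 + ((3 * ((B * ((N + (1 + 1 + 1)) + 2) + 2) + 2) + 2) + (1 + 1 + 1))))
     (\<lambda>s'. s' ''out'' 0 = of_bool (good tg)) s"
proof -
  have "(2::nat) ^ 2 < 2 ^ D" using D(2) by (intro power_strict_increasing) auto
  then have D4: "(4::nat) < 2 ^ D" by simp
  have "B \<le> card (Pow free)" unfolding B by (rule card_mono) (auto simp: small_def)
  then have "B \<le> 2 ^ card free" by (simp add: card_Pow)
  then have BD: "B < 2 ^ D" using D(5) by (rule le_less_trans)
  obtain c0 where c0: "ext c0" using ext_exists k by auto
  show ?thesis unfolding three_search_def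
  proof (rule ok_Seq, rule ok_post[OF ok_list_masks[OF e, folded B]], goal_cases)
    case (5 s1)
    have e1: "env s1" by (rule env_mono[OF _ 5(1)]) (use e in auto)
    have bij: "bij_betw (\<lambda>q. dec (s1 ''l'' q)) {..<s1 ''nl'' 0} (small free)"
      and lP: "\<forall>q<s1 ''nl'' 0. s1 ''l'' q < 2 ^ card free" using 5(2) by auto
    have nl: "s1 ''nl'' 0 = B" using bij_betw_same_card[OF bij] by (simp add: B)
    have g1: "s1 ''g'' 0 = tg" using g by (simp add: frameD[OF 5(1)])
    let ?S = "\<lambda>q. dec (s1 ''l'' q)"
    \<comment> \<open>\<open>P\<close> holds the pairs of color offset and list index tried so far.
      \<open>best\<close> dominates every coloring that matches such a pair and is itself reached by
      an extension.\<close>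
    define I where "I P s' \<longleftrightarrow> (\<exists>c. ext c \<and> s' ''best'' 0 \<le> score c) \<and> s' ''best'' 0 < 2 ^ D \<and>
       (\<forall>p\<in>P. \<forall>c. ext c \<and> cls c (Suc (fst p)) = ?S (snd p) \<longrightarrow> score c \<le> s' ''best'' 0)"
      for P :: "(nat \<times> nat) set" and s' :: state
    have I_upd [simp]: "I P (s'(y := h)) = I P s'" if "y \<noteq> ''best''" for P s' y h
      using that by (simp add: I_def)
    show ?case
    proof (rule ok_Seq, rule ok_Assign, goal_cases)
      case 2
      show ?case
      proof (rule ok_Seq, rule ok_For[where I = "\<lambda>o'. I ({..<o'} \<times> {..<B})"], goal_cases)
        case (5 o' s2)
        note f2 = frameD[OF 5(1)]
        have e2: "env s2" by (rule env_mono[OF _ 5(1)]) (use e1 in auto)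
        show ?case
        proof (rule ok_For[where I = "\<lambda>q. I ({..<o'} \<times> {..<B} \<union> {o'} \<times> {..<q})" and H = B], goal_cases)
          case (2 s')
          then show ?case using nl by (simp add: frameD[OF 2] f2)
        next
          case (5 q s3)
          note f3 = frameD[OF 5(1)]
          have e3: "env s3" by (rule env_mono[OF _ 5(1)]) (use e2 in auto)
          have v3: "s3 ''q'' 0 = q" "s3 ''l'' = s1 ''l''" "s3 ''o'' 0 = o'"
            using 5 \<open>s2 ''o'' 0 = o'\<close> by (simp_all add: f3 f2)
          have lq: "s3 ''l'' (s3 ''q'' 0) < 2 ^ D"
            using lP 5(2) nl D(5) v3 by (metis less_trans)
          show ?case
          proof (rule ok_Seq, rule ok_post[OF ok_try_class[where S = "?S q", OF k e3 D(1-4) lq _ v3(3) _ N]], goal_cases)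
            case 1
            show ?case using \<open>o' < 3\<close> .
          next
            case (3 s4)
            have b4: "s4 ''best'' = s3 ''best''" by (simp add: frameD[OF 3(1)])
            have up: "\<forall>c. ext c \<and> cls c (Suc o') = ?S q \<longrightarrow> score c \<le> s4 ''s'' 0"
              and lo: "\<exists>c. ext c \<and> s4 ''s'' 0 \<le> score c" and lt: "s4 ''s'' 0 < 2 ^ D"
              using 3(2) v3 by auto
            have I3: "I ({..<o'} \<times> {..<B} \<union> {o'} \<times> {..<q}) s4" using 5(4) b4 by (simp add: I_def)
            let ?Q = "{..<o'} \<times> {..<B} \<union> {o'} \<times> {..<q}"
            have old: "score c \<le> s4 ''best'' 0" if "p \<in> ?Q" "ext c" "cls c (Suc (fst p)) = ?S (snd p)" for p c
              using I3 that unfolding I_def by blast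
            have new: "score c \<le> s4 ''s'' 0" if "ext c" "cls c (Suc (fst (o', q))) = ?S (snd (o', q))" for c
              using up that by simp
            have Suc_q: "{..<o'} \<times> {..<B} \<union> {o'} \<times> {..<Suc q} = insert (o', q) ({..<o'} \<times> {..<B} \<union> {o'} \<times> {..<q})"
              by (auto simp: less_Suc_eq)
            show ?case
            proof (rule ok_If)
              assume "bval (Less (V ''best'') (V ''s'')) s4"
              then have less: "s4 ''best'' 0 < s4 ''s'' 0" by simp
              have "I ({..<o'} \<times> {..<B} \<union> {o'} \<times> {..<Suc q}) (put ''best'' (s4 ''s'' 0) s4)"
                unfolding Suc_q I_def
              proof (intro conjI ballI allI impI, goal_cases)
                case (3 p c)
                show ?case
                proof (cases "p = (o', q)")
                  case True
                  then show ?thesis using new 3 by simp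
                next
                  case False
                  then have "score c \<le> s4 ''best'' 0" using 3 by (intro old) auto
                  then show ?thesis using less by simp
                qed
              qed (use lo lt in simp_all)
              then show "ok D (''best'' ::= V ''s'') 1
                (\<lambda>s''. I ({..<o'} \<times> {..<B} \<union> {o'} \<times> {..<Suc q}) (put ''q'' (Suc q) s'')) s4"
                by (intro ok_Assign) (use lt in simp_all)
            next
              assume "\<not> bval (Less (V ''best'') (V ''s'')) s4"
              then have le: "s4 ''s'' 0 \<le> s4 ''best'' 0" by simp
              have "I ({..<o'} \<times> {..<B} \<union> {o'} \<times> {..<Suc q}) s4"
                unfolding Suc_q I_def
              proof (intro conjI ballI allI impI, goal_cases)
                case (3 p c)
                show ?case
                proof (cases "p = (o', q)")
                  case True
                  then show ?thesis using new[of c] 3 le by simp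
                next
                  case False
                  then show ?thesis using 3 by (intro old) auto
                qed
              qed (use I3 in \<open>simp_all add: I_def\<close>)
              then show "ok D Skip 1
                (\<lambda>s''. I ({..<o'} \<times> {..<B} \<union> {o'} \<times> {..<Suc q}) (put ''q'' (Suc q) s'')) s4"
                by (intro ok_Skip) simp
            qed
          qed (use v3 in simp)
        next
          case (6 s')
          have "{..<o'} \<times> {..<B} \<union> {o'} \<times> {..<B} = {..<Suc o'} \<times> {..<B}" by (auto simp: less_Suc_eq)
          then show ?case using 6(3) by simp
        qed (use 5 BD in auto)
      next
        case (6 s2)
        note f2 = frameD[OF 6(1)]
        have g2: "s2 ''g'' 0 = tg" using g1 by (simp add: f2)
        have I: "I ({..<3} \<times> {..<B}) s2" using 6(3) .
        have "tg \<le> s2 ''best'' 0 \<longleftrightarrow> good tg"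
        proof
          assume "tg \<le> s2 ''best'' 0"
          then show "good tg" using I by (auto simp: I_def good_def intro: order_trans)
        next
          assume "good tg"
          then obtain c where c: "ext c" "tg \<le> score c" by (auto simp: good_def)
          \<comment> \<open>Completeness of the candidates: a coloring that reaches the target has a
            small class, and the search has met this class under its own color.\<close>
          obtain i where i: "i \<in> {1, 2, 3}" "3 * card (cls c i) \<le> card free" by (rule small_class[OF c(1) k])
          have "cls c i \<in> small free" using i cls_subset by (simp add: small_def)
          then have "cls c i \<in> ?S ` {..<B}" using bij nl by (simp add: bij_betw_def)
          then obtain q where q: "q < B" "?S q = cls c i" by auto
          have "(i - 1, q) \<in> {..<3} \<times> {..<B}" "Suc (i - 1) = i" using i(1) q(1) by fastforce+
          moreover have "\<forall>p\<in>{..<3} \<times> {..<B}. \<forall>c. ext c \<and> cls c (Suc (fst p)) = ?S (snd p) \<longrightarrow> score c \<le> s2 ''best'' 0"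
            using I unfolding I_def by blast
          ultimately have "score c \<le> s2 ''best'' 0" using c(1) q(2) by (metis fst_conv snd_conv)
          then show "tg \<le> s2 ''best'' 0" using c by simp
        qed
        then show ?case by (intro ok_If ok_Assign) (use g2 D4 in auto)
      qed (use D4 c0 in \<open>auto simp: I_def\<close>)
    qed simp
  qed (use D BD in auto)
qed

end

section \<open>Polynomial bounds\<close>

text \<open>\<open>E\<close> isolates the exponential factor. The base \<open>sz x + 1\<close> is
  positive even for the empty graph, so exponents may be raised freely.\<close>

definition poly_bounded :: "'i set \<Rightarrow> ('i \<Rightarrow> nat) \<Rightarrow> ('i \<Rightarrow> nat) \<Rightarrow> ('i \<Rightarrow> nat) \<Rightarrow> bool" where
  "poly_bounded A sz E f \<longleftrightarrow> (\<exists>C a. \<forall>x\<in>A. f x \<le> C * (sz x + 1) ^ a * E x)"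

abbreviation one_fun :: "'i \<Rightarrow> nat" where "one_fun \<equiv> \<lambda>_. 1"

lemma poly_bounded_mono:
  "poly_bounded A sz E g \<Longrightarrow> (\<And>x. x \<in> A \<Longrightarrow> f x \<le> g x) \<Longrightarrow> poly_bounded A sz E f"
  unfolding poly_bounded_def by (meson order_trans)

lemma poly_bounded_weaken:
  "poly_bounded A sz one_fun f \<Longrightarrow> (\<And>x. x \<in> A \<Longrightarrow> 1 \<le> E x) \<Longrightarrow> poly_bounded A sz E f"
  unfolding poly_bounded_def by (metis (no_types, lifting) le_trans mult_le_mono2)

lemma poly_bounded_const: "poly_bounded A sz one_fun (\<lambda>_. c)"
  unfolding poly_bounded_def by (rule exI[of _ c], rule exI[of _ 0]) simp

lemma poly_bounded_size: "poly_bounded A sz one_fun sz"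
  unfolding poly_bounded_def by (rule exI[of _ 1], rule exI[of _ 1]) simp

lemma poly_bounded_factor: "poly_bounded A sz E E"
  unfolding poly_bounded_def by (rule exI[of _ 1], rule exI[of _ 0]) simp

lemma poly_bounded_add:
  assumes "poly_bounded A sz E f" "poly_bounded A sz E g"
  shows "poly_bounded A sz E (\<lambda>x. f x + g x)"
proof -
  obtain C a where f: "\<And>x. x \<in> A \<Longrightarrow> f x \<le> C * (sz x + 1) ^ a * E x" using assms(1) by (auto simp: poly_bounded_def)
  obtain C' a' where g: "\<And>x. x \<in> A \<Longrightarrow> g x \<le> C' * (sz x + 1) ^ a' * E x" using assms(2) by (auto simp: poly_bounded_def)
  have "f x + g x \<le> (C + C') * (sz x + 1) ^ (a + a') * E x" if "x \<in> A" for x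
  proof -
    have p: "(sz x + 1) ^ a \<le> (sz x + 1) ^ (a + a')" "(sz x + 1) ^ a' \<le> (sz x + 1) ^ (a + a')"
      by (rule power_increasing; simp)+
    have "f x \<le> C * (sz x + 1) ^ (a + a') * E x"
      by (rule order_trans[OF f[OF that]]) (intro mult_le_mono p order_refl)
    moreover have "g x \<le> C' * (sz x + 1) ^ (a + a') * E x"
      by (rule order_trans[OF g[OF that]]) (intro mult_le_mono p order_refl)
    ultimately show ?thesis by (simp only: add_mult_distrib)
  qed
  then show ?thesis unfolding poly_bounded_def by blast
qed

lemma poly_bounded_mult:
  assumes "poly_bounded A sz one_fun f" "poly_bounded A sz E g"
  shows "poly_bounded A sz E (\<lambda>x. f x * g x)"
proof -
  obtain C a where f: "\<And>x. x \<in> A \<Longrightarrow> f x \<le> C * (sz x + 1) ^ a * 1" using assms(1) by (auto simp: poly_bounded_def)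
  obtain C' a' where g: "\<And>x. x \<in> A \<Longrightarrow> g x \<le> C' * (sz x + 1) ^ a' * E x" using assms(2) by (auto simp: poly_bounded_def)
  have "f x * g x \<le> (C * C') * (sz x + 1) ^ (a + a') * E x" if "x \<in> A" for x
    using mult_le_mono[OF f[OF that] g[OF that]] by (simp add: power_add mult_ac)
  then show ?thesis unfolding poly_bounded_def by blast
qed

lemma poly_bounded_mult':
  "poly_bounded A sz E f \<Longrightarrow> poly_bounded A sz one_fun g \<Longrightarrow> poly_bounded A sz E (\<lambda>x. f x * g x)"
  using poly_bounded_mult[of A sz g E f] by (simp add: mult.commute)

lemma poly_bounded_Suc: "poly_bounded A sz one_fun f \<Longrightarrow> poly_bounded A sz one_fun (\<lambda>x. Suc (f x))"
  using poly_bounded_add[OF _ poly_bounded_const[of A sz 1], of f] by simp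

lemma poly_bounded_power:
  "poly_bounded A sz one_fun f \<Longrightarrow> poly_bounded A sz one_fun (\<lambda>x. f x ^ a)"
proof (induction a)
  case 0
  then show ?case using poly_bounded_const[of A sz 1] by simp
next
  case (Suc a)
  then show ?case using poly_bounded_mult[of A sz f one_fun "\<lambda>x. f x ^ a"] by simp
qed

lemma solvable_in_timeI:
  fixes sz :: "'i \<Rightarrow> nat"
  assumes ok: "\<And>x. x \<in> A \<Longrightarrow> ok (D x) p (N x) (\<lambda>s. s ''out'' 0 = of_bool (Q x)) (init_state (enc x))"
    and bs: "\<And>x. x \<in> A \<Longrightarrow> bounded_state (D x) (init_state (enc x))"
    and D: "poly_bounded A sz one_fun D" and N: "poly_bounded A sz E N"
    and E: "\<And>x. x \<in> A \<Longrightarrow> real (E x) \<le> g x"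
  shows "solvable_in_time A enc Q (Ostar A sz g)"
proof -
  let ?b = "\<lambda>x. N x * (cweight p * (Suc (D x))\<^sup>2)"
  have "\<forall>x\<in>A. \<exists>t. (\<exists>s. exec p (init_state (enc x)) t s \<and> s ''out'' 0 = of_bool (Q x)) \<and> t \<le> ?b x"
    using ok bs unfolding ok_def by metis
  \<comment> \<open>The running time is picked by choice separately for each input, since the word
    length \<open>D x\<close> and the step bound vary with the input. Values outside
    \<open>A\<close> do not matter for the filter \<open>principal A\<close>.\<close>
  then obtain T where T: "\<And>x. x \<in> A \<Longrightarrow> (\<exists>s. exec p (init_state (enc x)) (T x) s \<and> s ''out'' 0 = of_bool (Q x))"
    and Tb: "\<And>x. x \<in> A \<Longrightarrow> T x \<le> ?b x"
    unfolding bchoice_iff by blast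
  have "poly_bounded A sz E ?b"
    by (intro poly_bounded_mult'[OF N] poly_bounded_mult poly_bounded_const poly_bounded_power poly_bounded_Suc D)
  then have "poly_bounded A sz E T" by (rule poly_bounded_mono) (rule Tb)
  then obtain C a where Ca: "\<And>x. x \<in> A \<Longrightarrow> T x \<le> C * (sz x + 1) ^ a * E x"
    by (auto simp: poly_bounded_def)
  \<comment> \<open>The polynomial \<open>C * (X + 1) ^ a\<close>.\<close>
  define q where "q = smult (real C) ([:1, 1:] ^ a)"
  have "real (T x) \<le> g x * poly q (real (sz x))" if "x \<in> A" for x
  proof -
    have "real (T x) \<le> real (C * (sz x + 1) ^ a * E x)" using Ca[OF that] by (rule of_nat_mono)
    also have "\<dots> = real (E x) * poly q (real (sz x))" by (simp add: q_def poly_power mult_ac)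
    also have "\<dots> \<le> g x * poly q (real (sz x))"
      by (intro mult_right_mono E that) (simp add: q_def poly_power)
    finally show ?thesis .
  qed
  then have "(\<lambda>x. real (T x)) \<in> O[principal A](\<lambda>x. g x * poly q (real (sz x)))"
    by (intro bigoI[where c = 1]) (auto simp: eventually_principal simp del: abs_mult intro: order_trans[OF _ abs_ge_self])
  then show ?thesis using T unfolding solvable_in_time_def Ostar_def by blast
qed

section \<open>Reading the input\<close>

lemma length_concat_rows: "length (concat (map (\<lambda>u. map (f u) [0..<n]) [0..<m])) = m * n"
  by (induction m) auto

lemma nth_concat_rows:
  "u < m \<Longrightarrow> v < n \<Longrightarrow> concat (map (\<lambda>u. map (f u) [0..<n]) [0..<m]) ! (u * n + v) = f u v"
proof (induction m)
  case (Suc m)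
  show ?case
  proof (cases "u = m")
    case True
    then show ?thesis using Suc.prems by (simp add: nth_append length_concat_rows)
  next
    case False
    then have "u < m" using Suc.prems by simp
    then have "Suc u * n \<le> m * n" by (intro mult_le_mono1) simp
    then have "u * n + v < m * n" using Suc.prems(2) by simp
    then show ?thesis using Suc.IH[OF \<open>u < m\<close> Suc.prems(2)] by (simp add: nth_append length_concat_rows)
  qed
qed simp

definition input :: "hc_inst \<Rightarrow> nat \<Rightarrow> nat" where
  "input I = init_state (encode I) ''in''"

definition color_of :: "hc_inst \<Rightarrow> nat \<Rightarrow> nat" where
  "color_of I v = (case precol_of I v of None \<Rightarrow> 0 | Some i \<Rightarrow> i)"

definition digits :: "hc_inst \<Rightarrow> nat list" where
  "digits I = (let m = nat \<bar>target_of I\<bar> in map (\<lambda>i. of_bool (bit m i)) (rev [0..<floorlog 2 m]))"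

definition rows :: "hc_inst \<Rightarrow> nat list" where
  "rows I = concat (map (\<lambda>u. map (\<lambda>v. of_bool ({u, v} \<in> edges_of I)) [0..<size_of I]) [0..<size_of I])"

lemma encode_eq: "encode I = [size_of I] @ rows I @ map (color_of I) [0..<size_of I] @
    [of_bool (target_of I < 0)] @ digits I @ [2]"
  by (simp add: encode_def rows_def color_of_def digits_def)

lemma length_rows: "length (rows I) = size_of I * size_of I"
  unfolding rows_def by (rule length_concat_rows)

lemma length_digits: "length (digits I) = floorlog 2 (nat \<bar>target_of I\<bar>)"
  by (simp add: digits_def Let_def)

lemma input_size: "input I 0 = size_of I"
  by (simp add: input_def init_state_def encode_eq)

lemma input_edge:
  assumes "u < size_of I" "v < size_of I"
  shows "input I (1 + (u * size_of I + v)) = of_bool ({u, v} \<in> edges_of I)"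
proof -
  let ?n = "size_of I"
  have "Suc u * ?n \<le> ?n * ?n" using assms by (intro mult_le_mono1) simp
  then have lt: "u * ?n + v < ?n * ?n" using assms by simp
  have "rows I ! (u * ?n + v) = of_bool ({u, v} \<in> edges_of I)"
    unfolding rows_def by (rule nth_concat_rows[OF assms])
  then show ?thesis using lt by (simp add: input_def init_state_def encode_eq nth_append length_rows)
qed

lemma input_color: "v < size_of I \<Longrightarrow> input I (1 + size_of I * size_of I + v) = color_of I v"
  by (simp add: input_def init_state_def encode_eq nth_append length_rows)

lemma input_sign: "input I (1 + size_of I * size_of I + size_of I) = of_bool (target_of I < 0)"
  by (simp add: input_def init_state_def encode_eq nth_append length_rows)

lemma input_digit:
  "q < floorlog 2 (nat \<bar>target_of I\<bar>) \<Longrightarrow> input I (2 + size_of I * size_of I + size_of I + q) =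
    of_bool (bit (nat \<bar>target_of I\<bar>) (floorlog 2 (nat \<bar>target_of I\<bar>) - Suc q))"
  by (simp add: input_def init_state_def encode_eq nth_append length_rows length_digits)
    (simp add: digits_def Let_def rev_nth)

lemma input_end:
  "input I (2 + size_of I * size_of I + size_of I + floorlog 2 (nat \<bar>target_of I\<bar>)) = 2"
  by (simp add: input_def init_state_def encode_eq nth_append length_rows length_digits)

lemma color_of_le:
  assumes "I \<in> hc_instances k" shows "color_of I v \<le> k"
proof (cases "precol_of I v")
  case (Some i)
  then have "i \<in> ran (precol_of I)" by (auto simp: ran_def)
  then show ?thesis using assms Some by (auto simp: hc_instances_def partial_coloring_def color_of_def)
qed (simp add: color_of_def)

lemma bounded_init_state:
  assumes "I \<in> hc_instances k" "size_of I < 2 ^ D" "k < 2 ^ D" "2 \<le> D"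
  shows "bounded_state D (init_state (encode I))"
proof -
  have "(2::nat) ^ 2 \<le> 2 ^ D" using assms(4) by (intro power_increasing) auto
  then have D: "(2::nat) < 2 ^ D" "(1::nat) < 2 ^ D" "(0::nat) < 2 ^ D" by simp_all
  have bD: "of_bool b < (2::nat) ^ D" for b using D by (cases b) simp_all
  have c: "color_of I v < 2 ^ D" for v using color_of_le[OF assms(1), of v] assms(3) by simp
  have "\<forall>x\<in>set (encode I). x < 2 ^ D"
    using assms(2) D c bD by (auto simp: encode_eq rows_def digits_def Let_def)
  then show ?thesis using D by (auto simp: bounded_state_def init_state_def)
qed

text \<open>The number on the right is the prefix of \<open>i\<close> binary digits. Its leading
  digit is 1, so for positive \<open>i\<close> it is at least \<open>2 ^ (i - 1)\<close>.
  Consequently a prefix of at most \<open>n * n\<close> has at most \<open>n * n\<close> digits,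
  which bounds the reading of the target.\<close>

lemma floorlog_prefix_ge:
  assumes "i \<le> floorlog 2 M"
  shows "i \<le> M div 2 ^ (floorlog 2 M - i)"
proof (cases i)
  case (Suc i')
  define L where "L = floorlog 2 M"
  have "M \<noteq> 0" using assms Suc by (auto simp: floorlog_def split: if_splits)
  then have "2 ^ (L - 1) \<le> M" unfolding L_def using floorlog_bounds[of M 2] by simp
  moreover have "L - 1 = i' + (L - i)" using assms Suc by (simp add: L_def)
  ultimately have "2 ^ i' * 2 ^ (L - i) \<le> M" by (simp add: power_add)
  then have "2 ^ i' \<le> M div 2 ^ (L - i)" by (simp add: less_eq_div_iff_mult_less_eq)
  moreover have "i \<le> 2 ^ i'" using Suc by (metis Suc_leI less_exp)
  ultimately show ?thesis by (simp add: L_def)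
qed simp

lemma prefix_Suc:
  fixes M :: nat
  assumes "i < L"
  shows "M div 2 ^ (L - Suc i) = 2 * (M div 2 ^ (L - i)) + of_bool (bit M (L - Suc i))"
proof -
  have "L - i = Suc (L - Suc i)" using assms by simp
  then have "M div 2 ^ (L - i) = (M div 2 ^ (L - Suc i)) div 2"
    by (simp only: power_Suc2 div_mult2_eq)
  moreover have "of_bool (bit M (L - Suc i)) = (M div 2 ^ (L - Suc i)) mod 2"
    by (simp add: bit_iff_odd mod_2_eq_odd)
  ultimately show ?thesis by (simp only: mult_div_mod_eq)
qed

section \<open>Programs that read the vertices, the sets and the target\<close>

definition read_vertices :: com where
  "read_vertices = ''u'' ::= Const 0 ;; ''P'' ::= Const 1 ;;
     For ''x'' (V ''n'')
       (Assign ''c'' (V ''x'') (Get ''in'' (Add (Add (Const 1) (Mul (V ''n'') (V ''n''))) (V ''x''))) ;;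
        If (Equal (Get ''c'' (V ''x'')) (Const 0))
          (Assign ''w'' (V ''x'') (V ''P'') ;; ''P'' ::= Mul (Const 2) (V ''P'') ;; ''u'' ::= Add (V ''u'') (Const 1)) Skip)"

text \<open>The two tests are the only part that differs between the two problems. They find their
  arguments in \<open>j\<close> and \<open>x\<close>, which the flat loop over the table
  \<open>h\<close> recovers by quotient and remainder.\<close>

definition read_sets :: "bexp \<Rightarrow> bexp \<Rightarrow> com" where
  "read_sets vb mb =
     For ''j'' (V ''m'') (If vb (Assign ''v'' (V ''j'') (Const 1)) (Assign ''v'' (V ''j'') (Const 0))) ;;
     For ''y'' (Mul (V ''m'') (V ''n''))
       (''j'' ::= Quot (V ''y'') (V ''n'') ;; ''x'' ::= Rem (V ''y'') (V ''n'') ;;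
        If mb (Assign ''h'' (V ''y'') (Const 1)) (Assign ''h'' (V ''y'') (Const 0)))"

text \<open>No score exceeds \<open>n * n\<close>, so it suffices to read a prefix of the target that exceeds \<open>n * n\<close>.\<close>

definition read_target :: com where
  "read_target = ''y'' ::= Add (Add (Const 2) (Mul (V ''n'') (V ''n''))) (V ''n'') ;; ''g'' ::= Const 0 ;;
     While (Conj (Neg (Equal (Get ''in'' (V ''y'')) (Const 2))) (Neg (Less (Mul (V ''n'') (V ''n'')) (V ''g''))))
       (''g'' ::= Add (Mul (Const 2) (V ''g'')) (Get ''in'' (V ''y'')) ;; ''y'' ::= Add (V ''y'') (Const 1))"

text \<open>The search always runs with the absolute value of the target. Any extension reaches a
  negative target, so in that case the answer is overwritten at the end.\<close>

definition decide :: "aexp \<Rightarrow> bexp \<Rightarrow> bexp \<Rightarrow> com \<Rightarrow> com" where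
  "decide me vb mb p = ''n'' ::= Get ''in'' (Const 0) ;; ''m'' ::= me ;;
     read_vertices ;; read_sets vb mb ;; read_target ;; p ;;
     If (Equal (Get ''in'' (Add (Add (Const 1) (Mul (V ''n'') (V ''n''))) (V ''n''))) (Const 1))
       (''out'' ::= Const 1) Skip"

lemma writes_read_vertices [simp]: "writes read_vertices = {''u'', ''P'', ''x'', ''c'', ''w''}"
  by (auto simp: read_vertices_def)

lemma writes_read_sets [simp]: "writes (read_sets vb mb) = {''j'', ''v'', ''y'', ''x'', ''h''}"
  by (auto simp: read_sets_def)

lemma writes_read_target [simp]: "writes read_target = {''y'', ''g''}"
  by (auto simp: read_target_def)

text \<open>Either the target is read completely, or the prefix already exceeds \<open>n * n\<close>
  and so does the target. Another digit is read only while the prefix is at most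
  \<open>n * n\<close>, which gives the bound \<open>2 * (n * n) + 1\<close>.\<close>

lemma ok_read_target:
  assumes n: "s ''n'' 0 = n" and L: "L = floorlog 2 M"
    and digit: "\<And>q. q < L \<Longrightarrow> s ''in'' (2 + n * n + n + q) = of_bool (bit M (L - Suc q))"
    and stop: "s ''in'' (2 + n * n + n + L) = 2"
    and D: "2 * (n * n) + n + 4 < 2 ^ D"
  shows "ok D read_target ((n * n + 1) * 3 + 3)
    (\<lambda>s'. s' ''g'' 0 \<le> 2 * (n * n) + 1 \<and> (s' ''g'' 0 = M \<or> n * n < s' ''g'' 0 \<and> s' ''g'' 0 \<le> M)) s"
proof -
  let ?Q = "\<lambda>s'. s' ''g'' 0 \<le> 2 * (n * n) + 1 \<and> (s' ''g'' 0 = M \<or> n * n < s' ''g'' 0 \<and> s' ''g'' 0 \<le> M)"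
  let ?c = "Conj (Neg (Equal (Get ''in'' (V ''y'')) (Const 2))) (Neg (Less (Mul (V ''n'') (V ''n'')) (V ''g'')))"
  let ?b = "''g'' ::= Add (Mul (Const 2) (V ''g'')) (Get ''in'' (V ''y'')) ;; ''y'' ::= Add (V ''y'') (Const 1)"
  let ?s = "s(''y'' := (s ''y'')(0 := 2 + n * n + n), ''g'' := (s ''g'')(0 := 0))"
  have M0: "M div 2 ^ L = 0" using lt_power_floorlog[of M] by (simp add: L)
  have "ok D (While ?c ?b) ((n * n + 1) * ((1 + 1) + 1) + 1) ?Q ?s"
  proof (rule ok_While[where I = "\<lambda>i s'. i \<le> L \<and> s' ''y'' 0 = 2 + n * n + n + i \<and>
       s' ''g'' 0 = M div 2 ^ (L - i) \<and> s' ''g'' 0 \<le> 2 * (n * n) + 1"])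
    show "0 \<le> L \<and> ?s ''y'' 0 = 2 + n * n + n + 0 \<and> ?s ''g'' 0 = M div 2 ^ (L - 0) \<and> ?s ''g'' 0 \<le> 2 * (n * n) + 1"
      using M0 by simp
    fix i s1 assume f1: "frame (writes ?b) ?s s1" and I: "i \<le> L \<and> s1 ''y'' 0 = 2 + n * n + n + i \<and>
       s1 ''g'' 0 = M div 2 ^ (L - i) \<and> s1 ''g'' 0 \<le> 2 * (n * n) + 1"
    have v: "s1 ''in'' = s ''in''" "s1 ''n'' 0 = n" using n by (simp_all add: frameD[OF f1])
    {
      assume b: "bval ?c s1"
      have iL: "i < L" using b I v stop by (cases "i = L") auto
      have gn: "s1 ''g'' 0 \<le> n * n" using b v by simp
      \<comment> \<open>The prefix is at least the number of digits read, so the guard itself limits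
        the number of rounds.\<close>
      have "i \<le> s1 ''g'' 0" using floorlog_prefix_ge[of i M] I by (simp add: L)
      then have iH: "i < n * n + 1" using gn by simp
      have d: "s1 ''in'' (s1 ''y'' 0) = of_bool (bit M (L - Suc i))" using I v digit[OF iL] by simp
      have dle: "of_bool (bit M (L - Suc i)) \<le> (1::nat)" by simp
      have g': "2 * s1 ''g'' 0 + s1 ''in'' (s1 ''y'' 0) = M div 2 ^ (L - Suc i)"
        using prefix_Suc[OF iL, of M] I d by simp
      have le: "2 * s1 ''g'' 0 + s1 ''in'' (s1 ''y'' 0) \<le> 2 * (n * n) + 1" using gn d dle by linarith
      have "ok D ?b (1 + 1) (\<lambda>s'. Suc i \<le> L \<and> s' ''y'' 0 = 2 + n * n + n + Suc i \<and>
       s' ''g'' 0 = M div 2 ^ (L - Suc i) \<and> s' ''g'' 0 \<le> 2 * (n * n) + 1) s1"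
        by (intro ok_Seq ok_Assign) (use I iL iH D g' le in simp_all)
      with iH show "i < n * n + 1 \<and> ok D ?b (1 + 1) (\<lambda>s'. Suc i \<le> L \<and> s' ''y'' 0 = 2 + n * n + n + Suc i \<and>
       s' ''g'' 0 = M div 2 ^ (L - Suc i) \<and> s' ''g'' 0 \<le> 2 * (n * n) + 1) s1" ..
    }
    assume nb: "\<not> bval ?c s1"
    show "?Q s1"
    proof (cases "n * n < s1 ''g'' 0")
      case True
      then show ?thesis using I by simp
    next
      case False
      then have two: "s1 ''in'' (s1 ''y'' 0) = 2" using nb v by simp
      have "i = L"
      proof (rule ccontr)
        assume "i \<noteq> L"
        then have "i < L" using I by simp
        then have "s1 ''in'' (s1 ''y'' 0) \<le> 1" using I v digit[of i] by simp
        then show False using two by simp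
      qed
      then show ?thesis using I by simp
    qed
  qed
  then have "ok D read_target (1 + (1 + ((n * n + 1) * ((1 + 1) + 1) + 1))) ?Q s"
    unfolding read_target_def by (intro ok_Seq ok_Assign) (use n D in simp_all)
  then show ?thesis by (rule ok_steps) simp
qed

context set_family
begin

lemma ok_read_vertices:
  assumes n: "s ''n'' 0 = n" and col: "\<And>x. x < n \<Longrightarrow> s ''in'' (1 + n * n + x) = col x"
    and D: "n < 2 ^ D" "k < 2 ^ D" "2 ^ card free < (2 :: nat) ^ D"
  shows "ok D read_vertices (n * 8 + 4) (\<lambda>s'. s' ''u'' 0 = card free \<and> s' ''P'' 0 = 2 ^ card free \<and>
     (\<forall>x<n. s' ''c'' x = col x) \<and> (\<forall>x\<in>free. s' ''w'' x = 2 ^ rk x)) s"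
proof -
  let ?b = "Assign ''c'' (V ''x'') (Get ''in'' (Add (Add (Const 1) (Mul (V ''n'') (V ''n''))) (V ''x''))) ;;
        If (Equal (Get ''c'' (V ''x'')) (Const 0))
          (Assign ''w'' (V ''x'') (V ''P'') ;; ''P'' ::= Mul (Const 2) (V ''P'') ;; ''u'' ::= Add (V ''u'') (Const 1)) Skip"
  let ?s = "s(''u'' := (s ''u'')(0 := 0), ''P'' := (s ''P'')(0 := 1))"
  let ?Q = "\<lambda>s'. s' ''u'' 0 = card free \<and> s' ''P'' 0 = 2 ^ card free \<and>
     (\<forall>x<n. s' ''c'' x = col x) \<and> (\<forall>x\<in>free. s' ''w'' x = 2 ^ rk x)"
  have rk_le: "rk i \<le> card free" if "i \<le> n" for i using rk_mono[OF that] by (simp add: rk_n)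
  have PD: "2 ^ rk i < (2::nat) ^ D" if "i \<le> n" for i
    using rk_le[OF that] D(3) by (meson le_less_trans one_le_numeral power_increasing)
  have D1: "(1::nat) < 2 ^ D" using D(3) by (rule le_less_trans[rotated]) simp
  have "ok D (For ''x'' (V ''n'') ?b) (n * ((1 + ((1 + (1 + 1)) + 1 + 1)) + 2) + 2) ?Q ?s"
  proof (rule ok_For[where I = "\<lambda>i s'. s' ''u'' 0 = rk i \<and> s' ''P'' 0 = 2 ^ rk i \<and>
     (\<forall>x<i. s' ''c'' x = col x) \<and> (\<forall>x<i. x \<in> free \<longrightarrow> s' ''w'' x = 2 ^ rk x)"])
    fix s1 assume f1: "frame (insert ''x'' (writes ?b)) ?s s1"
    have v: "s1 ''in'' = s ''in''" "s1 ''n'' 0 = n" using n by (simp_all add: frameD[OF f1])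
    then show "aval (V ''n'') s1 = n" by simp
    {
      fix i assume i: "i < n" "s1 ''x'' 0 = i" and I: "s1 ''u'' 0 = rk i \<and> s1 ''P'' 0 = 2 ^ rk i \<and>
        (\<forall>x<i. s1 ''c'' x = col x) \<and> (\<forall>x<i. x \<in> free \<longrightarrow> s1 ''w'' x = 2 ^ rk x)"
      have ci: "s1 ''in'' (1 + n * n + i) = col i" using col[OF i(1)] v by simp
      have cD: "col i < 2 ^ D" using col_le[OF i(1)] D(2) by simp
      have rS: "rk (Suc i) = (if col i = 0 then Suc (rk i) else rk i)" by (rule rk_Suc)
      have uD: "rk (Suc i) < 2 ^ D" using rk_le[of "Suc i"] card_free_le i D(1) by simp
      have fi: "i \<in> free \<longleftrightarrow> col i = 0" using i by (simp add: free_def)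
      show "ok D ?b (1 + ((1 + (1 + 1)) + 1 + 1)) (\<lambda>s'. (put ''x'' (Suc i) s') ''u'' 0 = rk (Suc i) \<and>
        (put ''x'' (Suc i) s') ''P'' 0 = 2 ^ rk (Suc i) \<and>
        (\<forall>x<Suc i. (put ''x'' (Suc i) s') ''c'' x = col x) \<and>
        (\<forall>x<Suc i. x \<in> free \<longrightarrow> (put ''x'' (Suc i) s') ''w'' x = 2 ^ rk x)) s1"
      proof (intro ok_Seq ok_Assign ok_If ok_Skip, goal_cases)
        case 1
        show ?case using ci cD i v by simp
      next
        case 2
        show ?case using I PD[of i] i by simp
      next
        case 3
        then have "col i = 0" using ci i v by simp
        then show ?case using I PD[of "Suc i"] i rS by simp
      next
        case 4
        then have "col i = 0" using ci i v by simp
        then show ?case using I uD i rS by simp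
      next
        case 5
        then have "col i = 0" using ci i v by simp
        then show ?case using I ci i v rS by (simp add: less_Suc_eq)
      next
        case 6
        then have "col i \<noteq> 0" using ci i v by simp
        then show ?case using I ci i v rS fi by (auto simp: less_Suc_eq)
      qed
    }
    assume "s1 ''u'' 0 = rk n \<and> s1 ''P'' 0 = 2 ^ rk n \<and>
     (\<forall>x<n. s1 ''c'' x = col x) \<and> (\<forall>x<n. x \<in> free \<longrightarrow> s1 ''w'' x = 2 ^ rk x)"
    then show "?Q s1" using free_lt by (simp add: rk_n)
  qed (use D in auto)
  then have "ok D read_vertices (1 + (1 + (n * ((1 + ((1 + (1 + 1)) + 1 + 1)) + 2) + 2))) ?Q s"
    unfolding read_vertices_def by (intro ok_Seq ok_Assign) (use D1 in simp_all)
  then show ?thesis by (rule ok_steps) simp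
qed

lemma ok_read_sets:
  assumes n: "s ''n'' 0 = n" "s ''m'' 0 = m"
    and vb: "\<And>s'. s' ''in'' = s ''in'' \<Longrightarrow> s' ''n'' 0 = n \<Longrightarrow> s' ''j'' 0 < m \<Longrightarrow> bval vb s' \<longleftrightarrow> val (s' ''j'' 0)"
    and mb: "\<And>s'. s' ''in'' = s ''in'' \<Longrightarrow> s' ''n'' 0 = n \<Longrightarrow> s' ''j'' 0 < m \<Longrightarrow> s' ''x'' 0 < n \<Longrightarrow>
       bval mb s' \<longleftrightarrow> mem (s' ''j'' 0) (s' ''x'' 0)"
    and D: "n < 2 ^ D" "m < 2 ^ D" "m * n < 2 ^ D" "0 < D"
  shows "ok D (read_sets vb mb) (m * 5 + 2 + (m * n * 7 + 2)) (\<lambda>s'. (\<forall>j<m. s' ''v'' j = of_bool (val j)) \<and>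
     (\<forall>j<m. \<forall>x<n. s' ''h'' (j * n + x) = of_bool (mem j x))) s"
proof -
  let ?b1 = "If vb (Assign ''v'' (V ''j'') (Const 1)) (Assign ''v'' (V ''j'') (Const 0))"
  let ?b2 = "''j'' ::= Quot (V ''y'') (V ''n'') ;; ''x'' ::= Rem (V ''y'') (V ''n'') ;;
        If mb (Assign ''h'' (V ''y'') (Const 1)) (Assign ''h'' (V ''y'') (Const 0))"
  let ?Q = "\<lambda>s'. (\<forall>j<m. s' ''v'' j = of_bool (val j)) \<and> (\<forall>j<m. \<forall>x<n. s' ''h'' (j * n + x) = of_bool (mem j x))"
  have D1: "(1::nat) < 2 ^ D" using D(4) one_less_power[of "2::nat" D] by simp
  have "ok D (read_sets vb mb) ((m * ((1 + 1 + 1) + 2) + 2) + (m * n * ((1 + (1 + (1 + 1 + 1))) + 2) + 2)) ?Q s"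
    unfolding read_sets_def
  proof (rule ok_Seq, rule ok_For[where I = "\<lambda>i s'. \<forall>j<i. s' ''v'' j = of_bool (val j)"])
    fix s1 assume f1: "frame (insert ''j'' (writes ?b1)) s s1"
    have v: "s1 ''in'' = s ''in''" "s1 ''n'' 0 = n" "s1 ''m'' 0 = m" using n by (simp_all add: frameD[OF f1])
    then show "aval (V ''m'') s1 = m" by simp
    {
      fix i assume i: "i < m" "s1 ''j'' 0 = i" and I: "\<forall>j<i. s1 ''v'' j = of_bool (val j)"
      show "ok D ?b1 (1 + 1 + 1) (\<lambda>s'. \<forall>j<Suc i. (put ''j'' (Suc i) s') ''v'' j = of_bool (val j)) s1"
        by (intro ok_If ok_Assign) (use I i v vb[of s1] D1 in \<open>auto simp: less_Suc_eq\<close>)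
    }
    assume V: "\<forall>j<m. s1 ''v'' j = of_bool (val j)"
    show "ok D (For ''y'' (Mul (V ''m'') (V ''n'')) ?b2) (m * n * ((1 + (1 + (1 + 1 + 1))) + 2) + 2) ?Q s1"
    proof (rule ok_For[where I = "\<lambda>i s'. \<forall>p<i. s' ''h'' p = of_bool (mem (p div n) (p mod n))"])
      fix s2 assume f2: "frame (insert ''y'' (writes ?b2)) s1 s2"
      have v2: "s2 ''in'' = s ''in''" "s2 ''n'' 0 = n" "s2 ''m'' 0 = m" "s2 ''v'' = s1 ''v''"
        using v by (simp_all add: frameD[OF f2])
      then show "aval (Mul (V ''m'') (V ''n'')) s2 = m * n" by simp
      {
        fix p assume p: "p < m * n" "s2 ''y'' 0 = p" and I: "\<forall>p'<p. s2 ''h'' p' = of_bool (mem (p' div n) (p' mod n))"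
        have n0: "0 < n" using p by (cases n) auto
        have j: "p div n < m" using p by (simp add: less_mult_imp_div_less)
        have x: "p mod n < n" using n0 by simp
        have b: "bval mb (s2(''j'' := a, ''x'' := c)) \<longleftrightarrow> mem (p div n) (p mod n)"
          if "a 0 = p div n" "c 0 = p mod n" for a c
          using mb[of "s2(''j'' := a, ''x'' := c)"] v2 j x that by simp
        show "ok D ?b2 (1 + (1 + (1 + 1 + 1)))
          (\<lambda>s'. \<forall>p'<Suc p. (put ''y'' (Suc p) s') ''h'' p' = of_bool (mem (p' div n) (p' mod n))) s2"
        proof (intro ok_Seq ok_If ok_Assign, goal_cases)
          case 1
          show ?case using j D(2) p v2 by simp
        next
          case 2
          show ?case using x D(1) p v2 by simp
        qed (use I p v2 b D1 in \<open>auto simp: less_Suc_eq\<close>)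
      }
      assume I: "\<forall>p<m * n. s2 ''h'' p = of_bool (mem (p div n) (p mod n))"
      have "s2 ''h'' (j * n + x) = of_bool (mem j x)" if "j < m" "x < n" for j x
      proof -
        have "Suc j * n \<le> m * n" using that by (intro mult_le_mono1) simp
        then have "j * n + x < m * n" using that by simp
        then show ?thesis using I that by simp
      qed
      then show "?Q s2" using V v2 by simp
    qed (use D in auto)
  qed (use D in auto)
  then show ?thesis by (rule ok_steps) simp
qed

end

section \<open>Step counts and a sufficient word length\<close>

definition partition_steps :: "nat \<Rightarrow> nat \<Rightarrow> nat \<Rightarrow> nat \<Rightarrow> nat \<Rightarrow> nat \<Rightarrow> nat" where
  "partition_steps k n m u tg E =
    (let N1 = E * (m * (n * 5 + 7) + n * 5 + m * 3 + 11) + 2; N2 = n * (E * 5 + 6) + 2 in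
     1 + (1 + ((k * n * 3 + 2) + (1 + ((k * m * 3 + 2) + (1 + ((u * 3 + 2) + (1 + ((tg * 3 + 2) +
      ((E * (1 + 2) + 2) + ((k * ((1 + (N1 + (N2 + (E * (1 + 2) + 2)))) + 2) + 2) +
      (N2 + (1 + 1 + 1)))))))))))))"

definition three_steps :: "nat \<Rightarrow> nat \<Rightarrow> nat \<Rightarrow> nat" where
  "three_steps n m B =
    (let N = (3 * (m * (n * 5 + 7) + 2) + 5) + ((m * 5 + 2) +
       (((m * (m + 1) + 1) * (m * (m * (n * 5 + 9) + 15) + 4) + 2) + (m * 5 + 2))) in
     (n * (B * 7 + 7) + 5) + (1 + ((3 * ((B * ((N + (1 + 1 + 1)) + 2) + 2) + 2) + 2) + (1 + 1 + 1))))"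

definition decide_steps :: "nat \<Rightarrow> nat \<Rightarrow> nat \<Rightarrow> nat" where
  "decide_steps n m N = 1 + (1 + ((n * 8 + 4) + ((m * 5 + 2 + (m * n * 7 + 2)) + (((n * n + 1) * 3 + 3) + (N + (1 + 1 + 1))))))"

text \<open>The largest number is \<open>(2 ^ u * (W ^ u * z ^ m)) ^ k\<close>. With
  \<open>z\<close> of about \<open>k * n\<close> bits and \<open>W\<close> of about
  \<open>k * m\<close> times as many, its length is of order
  \<open>k * u * (k * m) * (k * n)\<close>, and \<open>u \<le> n\<close>,
  \<open>m \<le> n * n\<close> turn this into \<open>k ^ 3 * n ^ 4\<close>.\<close>

definition word_size :: "nat \<Rightarrow> nat \<Rightarrow> nat" where
  "word_size k n = 10 * (k + 1) ^ 3 * (n + 1) ^ 4"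

lemma writes_partition_search [simp]: "writes (partition_search k) =
   {''b'', ''z'', ''q'', ''W'', ''U'', ''G'', ''X'', ''T'', ''o'', ''i'', ''s'', ''t'', ''x'', ''j'', ''f'', ''a'', ''A'', ''out''}"
  by (auto simp: partition_search_def)

lemma writes_three_search [simp]: "writes three_search =
   {''l'', ''d'', ''nl'', ''x'', ''y'', ''q'', ''best'', ''o'', ''X'', ''s'', ''i'', ''t'', ''j'', ''f'', ''mt'', ''pr'',
    ''ow'', ''it'', ''bp'', ''r'', ''e'', ''br'', ''out''}"
  by (auto simp: three_search_def)

lemma word_size_bounds:
  fixes k n m u tg :: nat
  assumes k: "1 \<le> k" and m: "m \<le> n * n" and u: "u \<le> n" and tg: "tg \<le> 2 * (n * n) + 1"
    and D: "D = word_size k n"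
  shows "k * n < D" "k * m < D" "m * n < D" "m * (m + 1) + 1 < D" "3 * m + 1 < D" "2 * (n * n) + n + 4 < D"
    "k < D" "u < D" "2 < D" "tg < D"
    "(k * n + 1) * Suc (k * m) < D" "(k * n + 1) * Suc (k * m) * u + (k * n + 1) * tg < D"
    "(u + ((k * n + 1) * Suc (k * m) * u + (k * n + 1) * m)) * k < D"
proof -
  \<comment> \<open>With both bases at least 1, every monomial of degree at most 3 in
    \<open>K\<close> and at most 4 in \<open>q\<close> is below \<open>X\<close>. The factor 10 in
    \<open>word_size\<close> absorbs the coefficients and the constants.\<close>
  define K q where "K = k + 1" and "q = n + 1"
  have K1: "1 \<le> K" and q1: "1 \<le> q" by (simp_all add: K_def q_def)
  have kK: "k \<le> K" and nq: "n \<le> q" and uq: "u \<le> q" using u by (simp_all add: K_def q_def)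
  have mq: "m \<le> q ^ 2" using m by (simp add: q_def power2_eq_square)
  have tq: "tg \<le> 2 * q ^ 2" using tg by (simp add: q_def power2_eq_square)
  define X where "X = K ^ 3 * q ^ 4"
  have D': "D = 10 * X" by (simp add: D word_size_def K_def q_def X_def)
  have mon: "K ^ a * q ^ b \<le> X" if "a \<le> 3" "b \<le> 4" for a b
    unfolding X_def using that K1 q1 by (intro mult_le_mono power_increasing)
  have pos: "1 \<le> X" using mon[of 0 0] by simp
  have kn: "k * n + 1 \<le> K * q" by (simp add: K_def q_def)
  have "k * m + 1 \<le> k * q ^ 2 + q ^ 2" using mq q1 by (intro add_mono mult_le_mono) auto
  then have km: "Suc (k * m) \<le> K * q ^ 2" by (simp add: K_def)
  have A: "(k * n + 1) * Suc (k * m) \<le> K ^ 2 * q ^ 3"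
    using mult_le_mono[OF kn km] by (simp add: power2_eq_square power3_eq_cube mult_ac)
  have Au: "(k * n + 1) * Suc (k * m) * u \<le> K ^ 2 * q ^ 4"
    using mult_le_mono[OF A uq] by (simp add: power_numeral_reduce mult_ac)
  have At: "(k * n + 1) * tg \<le> 2 * (K ^ 1 * q ^ 3)"
    using mult_le_mono[OF kn tq] by (simp add: power_numeral_reduce mult_ac)
  have Am: "(k * n + 1) * m \<le> K ^ 1 * q ^ 3"
    using mult_le_mono[OF kn mq] by (simp add: power_numeral_reduce mult_ac)
  have mm: "m * m \<le> K ^ 0 * q ^ 4"
    using mult_le_mono[OF mq mq] by (simp add: power_numeral_reduce mult_ac)
  have mn: "m * n \<le> K ^ 0 * q ^ 3"
    using mult_le_mono[OF mq nq] by (simp add: power_numeral_reduce mult_ac)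
  have nn: "n * n \<le> K ^ 0 * q ^ 2" using mult_le_mono[OF nq nq] by (simp add: power2_eq_square)
  have X: "(k * n + 1) * Suc (k * m) \<le> X" "(k * n + 1) * Suc (k * m) * u \<le> X" "(k * n + 1) * tg \<le> 2 * X"
    "m * m \<le> X" "m * n \<le> X" "n * n \<le> X" "m \<le> X" "u \<le> X" "n \<le> X" "k \<le> X" "tg \<le> 2 * X" "k * n \<le> X" "k * m \<le> X"
    using order_trans[OF A mon] order_trans[OF Au mon] At mon[of 1 3] order_trans[OF mm mon] order_trans[OF mn mon]
      order_trans[OF nn mon] mq mon[of 0 2] uq nq mon[of 0 1] kK mon[of 1 0] tq kn mon[of 1 1] km mon[of 1 2]
    by simp_all
  have "m * (m + 1) = m * m + m" by simp
  then show "k * n < D" "k * m < D" "m * n < D" "m * (m + 1) + 1 < D" "3 * m + 1 < D" "2 * (n * n) + n + 4 < D"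
    "k < D" "u < D" "2 < D" "tg < D"
    "(k * n + 1) * Suc (k * m) < D" "(k * n + 1) * Suc (k * m) * u + (k * n + 1) * tg < D"
    unfolding D' using X pos by linarith+
  have "u + ((k * n + 1) * Suc (k * m) * u + (k * n + 1) * m) \<le> 3 * (K ^ 2 * q ^ 4)"
  proof -
    have "K ^ 1 * q ^ 3 \<le> K ^ 2 * q ^ 4" using K1 q1 by (intro mult_le_mono power_increasing; simp)
    moreover have "K ^ 0 * q ^ 1 \<le> K ^ 2 * q ^ 4" using K1 q1 by (intro mult_le_mono power_increasing; simp)
    then have "q \<le> K ^ 2 * q ^ 4" by simp
    ultimately show ?thesis using Au Am uq by linarith
  qed
  from mult_le_mono[OF this kK]
  have "(u + ((k * n + 1) * Suc (k * m) * u + (k * n + 1) * m)) * k \<le> 3 * X"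
    unfolding X_def by (simp add: power_numeral_reduce mult_ac)
  then show "(u + ((k * n + 1) * Suc (k * m) * u + (k * n + 1) * m)) * k < D" unfolding D' using pos by linarith
qed

section \<open>The complete decision program\<close>

context set_family
begin

lemma ok_partition_search_word_size:
  assumes e: "env s" and g: "s ''g'' 0 = tg" and k: "1 \<le> k" and m: "m \<le> n * n" and tg: "tg \<le> 2 * (n * n) + 1"
  shows "ok (word_size k n) (partition_search k) (partition_steps k n m (card free) (2 * (n * n) + 1) (2 ^ card free))
     (\<lambda>s'. s' ''out'' 0 = of_bool (good tg)) s"
proof (rule ok_steps)
  define D where "D = word_size k n"
  define u where "u = card free"
  note b = word_size_bounds[OF k m card_free_le tg D_def, folded u_def]
  have lt: "x < 2 ^ D" if "x < D" for x using that less_exp[of D] by (rule less_trans)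
  define z W where "z = (2::nat) * 2 ^ (k * n)" and "W = z ^ Suc (k * m)"
  have z: "z = 2 ^ (k * n + 1)" by (simp add: z_def)
  have W: "W = 2 ^ ((k * n + 1) * Suc (k * m))" by (simp only: W_def z power_mult)
  have 1: "W < 2 ^ D" unfolding W by (rule power_strict_increasing) (use b in simp_all)
  have 2: "W ^ u * z ^ tg < 2 ^ D" unfolding W z power_mult[symmetric] power_add[symmetric]
    by (rule power_strict_increasing) (use b in simp_all)
  have 3: "(2 ^ u * (W ^ u * z ^ m)) ^ k < 2 ^ D" unfolding W z power_mult[symmetric] power_add[symmetric]
    by (rule power_strict_increasing) (use b in simp_all)
  have n: "n < D" using b(6) by simp
  have mD: "m < D" using b(5) by simp
  have D1: "1 < D" using b(9) by simp
  have uD: "2 ^ u < (2::nat) ^ D" by (rule power_strict_increasing) (use b in simp_all)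
  show "ok D (partition_search k) (partition_steps k n m u tg (2 ^ u)) (\<lambda>s'. s' ''out'' 0 = of_bool (good tg)) s"
    unfolding partition_steps_def Let_def u_def
    by (rule ok_partition_search[OF e g k lt[OF b(7)] lt[OF n] D1 lt[OF mD] lt[OF b(1)] lt[OF b(2)] lt[OF b(10)]
         uD[unfolded u_def] z_def W_def 1 2[unfolded u_def] 3[unfolded u_def] refl refl])
  \<comment> \<open>The prefix \<open>tg\<close> is a value of the run. Replacing it by its bound
    leaves a step count that depends on the instance only.\<close>
  show "partition_steps k n m u tg (2 ^ u) \<le> partition_steps k n m u (2 * (n * n) + 1) (2 ^ u)"
    unfolding partition_steps_def Let_def using tg by simp
qed

lemma ok_three_search_word_size:
  assumes k: "k = 3" and e: "env s" and g: "s ''g'' 0 = tg" and m: "m \<le> n * n" and tg: "tg \<le> 2 * (n * n) + 1"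
  shows "ok (word_size k n) three_search (three_steps n m (card (small free)))
     (\<lambda>s'. s' ''out'' 0 = of_bool (good tg)) s"
proof -
  define D where "D = word_size k n"
  have k1: "1 \<le> k" using k by simp
  note b = word_size_bounds[OF k1 m card_free_le tg D_def]
  have lt: "x < 2 ^ D" if "x < D" for x using that less_exp[of D] by (rule less_trans)
  have n: "n < D" using b(6) by simp
  have uD: "2 ^ card free < (2::nat) ^ D" by (rule power_strict_increasing) (use b in simp_all)
  show ?thesis unfolding three_steps_def Let_def D_def[symmetric]
    by (rule ok_three_search[OF k e g lt[OF n] b(9) lt[OF b(5)] lt[OF b(4)] uD refl refl])
qed

lemma ok_decide:
  assumes I: "I \<in> hc_instances k" and n: "n = size_of I" and col: "col = color_of I"
    and k: "1 \<le> k" and m: "m \<le> n * n"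
    and me: "\<And>s. s ''in'' = input I \<Longrightarrow> s ''n'' 0 = n \<Longrightarrow> aval me s = m"
    and vb: "\<And>s. s ''in'' = input I \<Longrightarrow> s ''n'' 0 = n \<Longrightarrow> s ''j'' 0 < m \<Longrightarrow> bval vb s \<longleftrightarrow> val (s ''j'' 0)"
    and mb: "\<And>s. s ''in'' = input I \<Longrightarrow> s ''n'' 0 = n \<Longrightarrow> s ''j'' 0 < m \<Longrightarrow> s ''x'' 0 < n \<Longrightarrow>
       bval mb s \<longleftrightarrow> mem (s ''j'' 0) (s ''x'' 0)"
    and score: "\<And>c. ext c \<Longrightarrow> score c \<le> n * n"
    and p: "\<And>s tg. env s \<Longrightarrow> s ''g'' 0 = tg \<Longrightarrow> tg \<le> 2 * (n * n) + 1 \<Longrightarrow>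
       ok (word_size k n) p N (\<lambda>s'. s' ''out'' 0 = of_bool (good tg)) s"
    and wp: "''in'' \<notin> writes p" "''n'' \<notin> writes p"
  shows "ok (word_size k n) (decide me vb mb p) (decide_steps n m N)
    (\<lambda>s. s ''out'' 0 = of_bool (target_of I < 0 \<or> good (nat \<bar>target_of I\<bar>))) (init_state (encode I))"
proof -
  define D where "D = word_size k n"
  define M where "M = nat \<bar>target_of I\<bar>"
  note b = word_size_bounds[OF k m card_free_le order_refl D_def]
  have lt: "x < 2 ^ D" if "x < D" for x using that less_exp[of D] by (rule less_trans)
  have nD: "n < D" and mD: "m < D" using b(5,6) by simp_all
  have uD: "2 ^ card free < (2::nat) ^ D" by (rule power_strict_increasing) (use b in simp_all)
  have D0: "0 < D" using b(9) by simp
  have D1: "(1::nat) < 2 ^ D" using lt[OF b(9)] by simp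
  let ?s0 = "init_state (encode I)"
  let ?s1 = "put ''n'' n ?s0"
  let ?s2 = "?s1(''m'' := (?s0 ''m'')(0 := m))"
  have in0: "?s0 ''in'' = input I" by (simp add: input_def)
  have sz: "input I 0 = n" by (simp add: input_size n)
  have incol: "input I (1 + n * n + x) = col x" if "x < n" for x
    using input_color[of x I] that by (simp add: n col)
  have eval_m: "aval me ?s1 = m" by (rule me) (simp_all add: in0)
  show ?thesis unfolding decide_def decide_steps_def D_def[symmetric] M_def[symmetric]
  proof (rule ok_Seq, rule ok_Assign, goal_cases)
    case 1
    show ?case using in0 sz lt[OF nD] by simp
  next
    case 2
    have eqs: "?s0(''n'' := (?s0 ''n'')(aval (Const 0) ?s0 := aval (Get ''in'' (Const 0)) ?s0)) = ?s1"
      using in0 sz by simp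
    show ?case unfolding eqs
    proof (rule ok_Seq, rule ok_Assign, goal_cases)
      case 1
      show ?case using eval_m lt[OF mD] by simp
    next
      case 2
      have eqs2: "?s1(''m'' := (?s1 ''m'')(aval (Const 0) ?s1 := aval me ?s1)) = ?s2" using eval_m by simp
      have v2: "?s2 ''in'' = input I" "?s2 ''n'' 0 = n" "?s2 ''m'' 0 = m" using in0 by simp_all
      show ?case unfolding eqs2
      proof (rule ok_Seq, rule ok_post[OF ok_read_vertices], goal_cases)
        case (6 s3)
        have v3: "s3 ''in'' = input I" "s3 ''n'' 0 = n" "s3 ''m'' 0 = m" using v2 by (simp_all add: frameD[OF 6(1)])
        show ?case
        proof (rule ok_Seq, rule ok_post[OF ok_read_sets], goal_cases)
          case (9 s4)
          have v4: "s4 ''in'' = input I" "s4 ''n'' 0 = n" using v3 by (simp_all add: frameD[OF 9(1)])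
          have e4: "env s4" unfolding env_def using 9(2) 6(2) v3 by (simp add: frameD[OF 9(1)])
          show ?case
          proof (rule ok_Seq, rule ok_post[OF ok_read_target[where s = s4 and n = n and M = M and L = "floorlog 2 M", OF v4(2) refl]], goal_cases)
            case (4 s5)
            have v5: "s5 ''in'' = input I" "s5 ''n'' 0 = n" using v4 by (simp_all add: frameD[OF 4(1)])
            have e5: "env s5" by (rule env_mono[OF _ 4(1)]) (use e4 in auto)
            define tg where "tg = s5 ''g'' 0"
            have tg: "tg \<le> 2 * (n * n) + 1" "tg = M \<or> n * n < tg \<and> tg \<le> M" using 4(2) by (simp_all add: tg_def)
            \<comment> \<open>If the target was cut off, both numbers exceed \<open>n * n\<close>
              and hence every score, so both questions have a negative answer.\<close>
            have good_eq: "good tg \<longleftrightarrow> good M"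
            proof (cases "tg = M")
              case False
              then have "\<not> good tg" "\<not> good M" using tg score unfolding good_def by fastforce+
              then show ?thesis by simp
            qed simp
            show ?case
            proof (rule ok_Seq, rule ok_post[OF p[OF e5 tg_def[symmetric] tg(1), folded D_def]], goal_cases)
              case (1 s6)
              have v6: "s6 ''in'' = input I" "s6 ''n'' 0 = n"
                using v5 wp by (simp_all add: frameD[OF 1(1)])
              have sg: "input I (Suc (n * n + n)) = of_bool (target_of I < 0)" using input_sign[of I] by (simp add: n)
              show ?case
                by (intro ok_If ok_Assign ok_Skip) (use v6 sg 1(2) good_eq D1 in auto)
            qed
          next
            case (1 q)
            then show ?case using input_digit[of q I] v4 by (simp add: n M_def)
          next
            case 2
            show ?case using input_end[of I] v4 by (simp add: n M_def)
          next
            case 3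
            show ?case using lt[OF b(6)] .
          qed
        next
          case (3 s')
          then show ?case using vb[of s'] v3 by simp
        next
          case (4 s')
          then show ?case using mb[of s'] v3 by simp
        qed (use v3 lt[OF nD] lt[OF mD] lt[OF b(3)] D0 in simp_all)
      next
        case (2 x)
        then show ?case using incol v2 by simp
      qed (use v2 lt[OF nD] lt[OF b(7)] uD in simp_all)
    qed
  qed
qed

text \<open>Nonempty sets determine the color in which they are monochromatic, so the summands of
  the score count disjoint families. An empty set would be counted once for each color.\<close>

lemma score_monochromatic:
  assumes c: "ext c" and ne: "\<And>j. j < m \<Longrightarrow> val j \<Longrightarrow> \<exists>x<n. mem j x"
  shows "score c = card {j. j < m \<and> val j \<and> (\<forall>x<n. \<forall>y<n. mem j x \<longrightarrow> mem j y \<longrightarrow> c x = c y)}"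
proof -
  have s: "j \<in> sats i (cls c i) \<longleftrightarrow> j < m \<and> val j \<and> (\<forall>x<n. mem j x \<longrightarrow> c x = i)" if "i \<in> {1..k}" for i j
    using sat_cls[OF c, of i j] that by (auto simp: sats_def)
  have "score c = card (\<Union>i\<in>{1..k}. sats i (cls c i))"
    unfolding score_def
  proof (rule card_UN_disjoint[symmetric])
    show "\<forall>i\<in>{1..k}. \<forall>i'\<in>{1..k}. i \<noteq> i' \<longrightarrow> sats i (cls c i) \<inter> sats i' (cls c i') = {}"
    proof (intro ballI impI, rule ccontr)
      fix i i' assume i: "i \<in> {1..k}" "i' \<in> {1..k}" "i \<noteq> i'" "sats i (cls c i) \<inter> sats i' (cls c i') \<noteq> {}"
      then obtain j where j: "j \<in> sats i (cls c i)" "j \<in> sats i' (cls c i')" by blast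
      then have *: "j < m" "val j" "\<forall>x<n. mem j x \<longrightarrow> c x = i" "\<forall>x<n. mem j x \<longrightarrow> c x = i'"
        using s[OF i(1), of j] s[OF i(2), of j] by simp_all
      then obtain x where "x < n" "mem j x" using ne by blast
      then show False using * i(3) by simp
    qed
  qed auto
  also have "(\<Union>i\<in>{1..k}. sats i (cls c i)) = {j. j < m \<and> val j \<and> (\<forall>x<n. \<forall>y<n. mem j x \<longrightarrow> mem j y \<longrightarrow> c x = c y)}"
    (is "?L = ?R")
  proof (intro equalityI subsetI)
    fix j assume "j \<in> ?L"
    then obtain i where i: "i \<in> {1..k}" "j \<in> sats i (cls c i)" by blast
    then have "j < m" "val j" "\<And>x. x < n \<Longrightarrow> mem j x \<Longrightarrow> c x = i" using s[OF i(1), of j] by simp_all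
    then show "j \<in> ?R" by simp
  next
    fix j assume j: "j \<in> ?R"
    then obtain x where x: "x < n" "mem j x" using ne by blast
    then have "c x \<in> {1..k}" using c by (auto simp: ext_def)
    moreover have "j \<in> sats (c x) (cls c (c x))" using s[OF \<open>c x \<in> {1..k}\<close>] j x by blast
    ultimately show "j \<in> ?L" by blast
  qed
  finally show ?thesis .
qed

lemma score_le:
  assumes "ext c" "\<And>j. j < m \<Longrightarrow> val j \<Longrightarrow> \<exists>x<n. mem j x"
  shows "score c \<le> m"
proof -
  have "score c = card {j. j < m \<and> val j \<and> (\<forall>x<n. \<forall>y<n. mem j x \<longrightarrow> mem j y \<longrightarrow> c x = c y)}"
    using assms by (rule score_monochromatic)
  also have "\<dots> \<le> card {..<m}" by (rule card_mono) auto
  finally show ?thesis by simp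
qed

lemma good_target:
  assumes "1 \<le> k"
  shows "(t < 0 \<or> good (nat \<bar>t\<bar>)) \<longleftrightarrow> (\<exists>c. ext c \<and> t \<le> int (score c))"
proof (cases "t < 0")
  case True
  then have "t \<le> int (score c)" for c by simp
  then show ?thesis using True ext_exists[OF assms] by blast
next
  case False
  then show ?thesis by (auto simp: good_def nat_le_iff)
qed

end

section \<open>From set families back to graphs\<close>

lemma extended_full_coloring_iff:
  assumes "I \<in> hc_instances k"
  shows "extended_full_coloring k {..<size_of I} (precol_of I) c \<longleftrightarrow>
    (\<forall>x<size_of I. c x \<in> {1..k} \<and> (color_of I x \<noteq> 0 \<longrightarrow> c x = color_of I x))"
proof -
  have dom: "dom (precol_of I) \<subseteq> {..<size_of I}" and ran: "ran (precol_of I) \<subseteq> {1..k}"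
    using assms by (auto simp: hc_instances_def partial_coloring_def)
  \<comment> \<open>Colors start at 1, so the value 0 of \<open>color_of\<close> identifies the
    uncolored vertices unambiguously.\<close>
  have some: "i \<noteq> 0" if "precol_of I x = Some i" for x i using ran that by (force simp: ran_def)
  have "(\<forall>v\<in>dom (precol_of I). precol_of I v = Some (c v)) \<longleftrightarrow>
     (\<forall>x<size_of I. color_of I x \<noteq> 0 \<longrightarrow> c x = color_of I x)"
  proof (intro iffI allI ballI impI)
    fix x assume "\<forall>v\<in>dom (precol_of I). precol_of I v = Some (c v)" "color_of I x \<noteq> 0"
    then show "c x = color_of I x" by (cases "precol_of I x") (auto simp: color_of_def dom_def)
  next
    fix v assume v: "v \<in> dom (precol_of I)" and c: "\<forall>x<size_of I. color_of I x \<noteq> 0 \<longrightarrow> c x = color_of I x"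
    then obtain i where i: "precol_of I v = Some i" by auto
    have "v < size_of I" using v dom by auto
    then show "precol_of I v = Some (c v)" using c i some[OF i] by (simp add: color_of_def)
  qed
  then show ?thesis by (auto simp: extended_full_coloring_def)
qed

lemma set_family_color_of: "I \<in> hc_instances k \<Longrightarrow> set_family n k (color_of I)"
  by unfold_locales (rule color_of_le)

lemma card_free_color_of:
  assumes "I \<in> hc_instances k"
  shows "card (set_family.free (size_of I) (color_of I)) = uncolored I"
proof -
  interpret set_family "size_of I" m k val mem "color_of I" for m val mem
    using set_family_color_of[OF assms] .
  have ran: "ran (precol_of I) \<subseteq> {1..k}"
    using assms by (auto simp: hc_instances_def partial_coloring_def)
  have "color_of I x = 0 \<longleftrightarrow> x \<notin> dom (precol_of I)" for x
    using ran by (force simp: color_of_def ran_def dom_def split: option.splits)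
  then have "free = {..<size_of I} - dom (precol_of I)" by (auto simp: free_def)
  then show ?thesis by (simp add: uncolored_def)
qed

section \<open>Happy colorings\<close>

text \<open>Index \<open>j\<close> stands for the position of an ordered pair in the adjacency
  matrix. The condition that the row is smaller than the column selects one of the two positions of
  each edge, so no edge is counted twice and no edge list has to be built.\<close>

definition edge_valid :: "hc_inst \<Rightarrow> nat \<Rightarrow> bool" where
  "edge_valid I j \<longleftrightarrow> {j div size_of I, j mod size_of I} \<in> edges_of I \<and> j div size_of I < j mod size_of I"

definition edge_mem :: "hc_inst \<Rightarrow> nat \<Rightarrow> nat \<Rightarrow> bool" where
  "edge_mem I j x \<longleftrightarrow> x = j div size_of I \<or> x = j mod size_of I"

text \<open>Including the center keeps the set nonempty even for an isolated vertex, which is always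
  happy.\<close>

definition hood_mem :: "hc_inst \<Rightarrow> nat \<Rightarrow> nat \<Rightarrow> bool" where
  "hood_mem I j x \<longleftrightarrow> x = j \<or> {x, j} \<in> edges_of I"

lemma edge_valid_lt:
  assumes "j < size_of I * size_of I"
  shows "j div size_of I < size_of I" "j mod size_of I < size_of I"
  using assms by (simp_all add: less_mult_imp_div_less) (cases "size_of I"; simp)

lemma card_happy_edges:
  assumes I: "I \<in> hc_instances k" and ext: "set_family.ext (size_of I) k (color_of I) c"
  shows "card (happy_edges (edges_of I) c) =
    set_family.score (size_of I) (size_of I * size_of I) k (edge_valid I) (edge_mem I) (color_of I) c"
proof -
  let ?n = "size_of I"
  interpret set_family ?n "?n * ?n" k "edge_valid I" "edge_mem I" "color_of I"
    using set_family_color_of[OF I] .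
  let ?J = "{j. j < ?n * ?n \<and> edge_valid I j \<and> (\<forall>x<?n. \<forall>y<?n. edge_mem I j x \<longrightarrow> edge_mem I j y \<longrightarrow> c x = c y)}"
  have J: "?J = {j. j < ?n * ?n \<and> edge_valid I j \<and> c (j div ?n) = c (j mod ?n)}"
    using edge_valid_lt[of _ I] by (auto simp: edge_mem_def)
  have score: "score c = card ?J"
    by (rule score_monochromatic[OF ext]) (use edge_valid_lt[of _ I] in \<open>auto simp: edge_mem_def\<close>)
  have "bij_betw (\<lambda>j. {j div ?n, j mod ?n}) ?J (happy_edges (edges_of I) c)"
    unfolding J bij_betw_def
  proof (intro conjI inj_onI equalityI subsetI)
    fix j j' assume "j \<in> {j. j < ?n * ?n \<and> edge_valid I j \<and> c (j div ?n) = c (j mod ?n)}"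
      "j' \<in> {j. j < ?n * ?n \<and> edge_valid I j \<and> c (j div ?n) = c (j mod ?n)}"
      and eq: "{j div ?n, j mod ?n} = {j' div ?n, j' mod ?n}"
    then have "j div ?n < j mod ?n" "j' div ?n < j' mod ?n" by (simp_all add: edge_valid_def)
    then have "j div ?n = j' div ?n" "j mod ?n = j' mod ?n" using eq by (auto simp: doubleton_eq_iff)
    then show "j = j'" by (metis div_mult_mod_eq)
  next
    fix e assume "e \<in> (\<lambda>j. {j div ?n, j mod ?n}) ` {j. j < ?n * ?n \<and> edge_valid I j \<and> c (j div ?n) = c (j mod ?n)}"
    then show "e \<in> happy_edges (edges_of I) c" by (auto simp: happy_edges_def edge_valid_def)
  next
    fix e assume e: "e \<in> happy_edges (edges_of I) c"
    then have eE: "e \<in> edges_of I" by (simp add: happy_edges_def)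
    moreover have "\<forall>e\<in>edges_of I. \<exists>u v. e = {u, v} \<and> u \<in> {..<?n} \<and> v \<in> {..<?n} \<and> u \<noteq> v"
      using I by (simp add: hc_instances_def simple_graph_def)
    ultimately obtain a b where ab: "e = {a, b}" "a < ?n" "b < ?n" "a \<noteq> b" by blast
    obtain u v where uv: "e = {u, v}" "u < ?n" "v < ?n" "u < v"
    proof (cases "a < b")
      case True
      then show thesis using that[of a b] ab by simp
    next
      case False
      then show thesis using that[of b a] ab by (simp add: insert_commute)
    qed
    have d: "(u * ?n + v) div ?n = u" "(u * ?n + v) mod ?n = v" using uv(3) by simp_all
    have "Suc u * ?n \<le> ?n * ?n" using uv(2) by (intro mult_le_mono1) simp
    then have "u * ?n + v < ?n * ?n" using uv(3) by simp
    moreover have "edge_valid I (u * ?n + v)"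
      unfolding edge_valid_def d using eE uv(1,4) by simp
    moreover have "\<forall>x\<in>e. \<forall>y\<in>e. c x = c y" using e unfolding happy_edges_def by blast
    then have "c u = c v" unfolding uv(1) by blast
    ultimately have "u * ?n + v \<in> {j. j < ?n * ?n \<and> edge_valid I j \<and> c (j div ?n) = c (j mod ?n)}"
      unfolding mem_Collect_eq d by blast
    moreover have "e = {(u * ?n + v) div ?n, (u * ?n + v) mod ?n}" unfolding d by (rule uv(1))
    ultimately show "e \<in> (\<lambda>j. {j div ?n, j mod ?n}) ` {j. j < ?n * ?n \<and> edge_valid I j \<and> c (j div ?n) = c (j mod ?n)}"
      by (rule rev_image_eqI)
  qed
  from bij_betw_same_card[OF this] show ?thesis unfolding score by (rule sym)
qed

lemma card_happy_vertices:
  assumes I: "I \<in> hc_instances k" and ext: "set_family.ext (size_of I) k (color_of I) c"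
  shows "card (happy_vertices {..<size_of I} (edges_of I) c) =
    set_family.score (size_of I) (size_of I) k (\<lambda>_. True) (hood_mem I) (color_of I) c"
proof -
  let ?n = "size_of I"
  interpret set_family ?n ?n k "\<lambda>_. True" "hood_mem I" "color_of I"
    using set_family_color_of[OF I] .
  have "score c = card {j. j < ?n \<and> True \<and> (\<forall>x<?n. \<forall>y<?n. hood_mem I j x \<longrightarrow> hood_mem I j y \<longrightarrow> c x = c y)}"
    by (rule score_monochromatic[OF ext]) (auto simp: hood_mem_def)
  also have "{j. j < ?n \<and> True \<and> (\<forall>x<?n. \<forall>y<?n. hood_mem I j x \<longrightarrow> hood_mem I j y \<longrightarrow> c x = c y)} =
      happy_vertices {..<?n} (edges_of I) c"
  proof -
    have "(\<forall>x<?n. \<forall>y<?n. hood_mem I j x \<longrightarrow> hood_mem I j y \<longrightarrow> c x = c y) \<longleftrightarrow>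
        (\<forall>u<?n. {u, j} \<in> edges_of I \<longrightarrow> c u = c j)" if "j < ?n" for j
    proof
      assume r: "\<forall>u<?n. {u, j} \<in> edges_of I \<longrightarrow> c u = c j"
      have "c x = c j" if "x < ?n" "hood_mem I j x" for x using r that by (auto simp: hood_mem_def)
      then show "\<forall>x<?n. \<forall>y<?n. hood_mem I j x \<longrightarrow> hood_mem I j y \<longrightarrow> c x = c y" by metis
    next
      assume l: "\<forall>x<?n. \<forall>y<?n. hood_mem I j x \<longrightarrow> hood_mem I j y \<longrightarrow> c x = c y"
      have "hood_mem I j j" "\<And>u. {u, j} \<in> edges_of I \<Longrightarrow> hood_mem I j u" by (simp_all add: hood_mem_def)
      with l that show "\<forall>u<?n. {u, j} \<in> edges_of I \<longrightarrow> c u = c j" by blast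
    qed
    then show ?thesis unfolding happy_vertices_def by auto
  qed
  finally show ?thesis ..
qed

text \<open>The interface between the two search algorithms and the two problems. A search may be
  used with any set family of at most \<open>n * n\<close> members, and its step count may depend on
  the uncolored vertices.\<close>

definition solves_set_families :: "nat \<Rightarrow> com \<Rightarrow> (nat \<Rightarrow> nat \<Rightarrow> nat set \<Rightarrow> nat) \<Rightarrow> bool" where
  "solves_set_families k p N \<longleftrightarrow> ''in'' \<notin> writes p \<and> ''n'' \<notin> writes p \<and>
    (\<forall>n m val mem col s. set_family n k col \<longrightarrow> m \<le> n * n \<longrightarrow> s ''g'' 0 \<le> 2 * (n * n) + 1 \<longrightarrow>
       set_family.env n m val mem col s \<longrightarrow>
       ok (word_size k n) p (N n m (set_family.free n col))
         (\<lambda>s'. s' ''out'' 0 = of_bool (set_family.good n m k val mem col (s ''g'' 0))) s)"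

lemma solves_partition_search:
  assumes "1 \<le> k"
  shows "solves_set_families k (partition_search k) (\<lambda>n m F. partition_steps k n m (card F) (2 * (n * n) + 1) (2 ^ card F))"
  unfolding solves_set_families_def
  by (intro conjI allI impI set_family.ok_partition_search_word_size refl assms) simp_all

lemma solves_three_search:
  "solves_set_families 3 three_search (\<lambda>n m F. three_steps n m (card {S. S \<subseteq> F \<and> 3 * card S \<le> card F}))"
  unfolding solves_set_families_def
proof (intro conjI allI impI)
  fix n m :: nat and val mem col and s :: state
  assume "set_family n 3 col" and "m \<le> n * n" "s ''g'' 0 \<le> 2 * (n * n) + 1" "set_family.env n m val mem col s"
  then interpret set_family n m 3 val mem col by simp
  show "ok (word_size 3 n) three_search (three_steps n m (card {S. S \<subseteq> free \<and> 3 * card S \<le> card free}))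
     (\<lambda>s'. s' ''out'' 0 = of_bool (good (s ''g'' 0))) s"
    unfolding small_def[symmetric] by (rule ok_three_search_word_size) (fact refl | fact)+
qed simp_all

definition free_of :: "hc_inst \<Rightarrow> nat set" where
  "free_of I = set_family.free (size_of I) (color_of I)"

lemma card_free_of: "I \<in> hc_instances k \<Longrightarrow> card (free_of I) = uncolored I"
  unfolding free_of_def by (rule card_free_color_of)

lemma finite_free_of: "finite (free_of I)"
proof (rule finite_subset)
  \<comment> \<open>The instance is arbitrary here, so the largest occurring color takes the part of
    \<open>k\<close>.\<close>
  interpret set_family "size_of I" 0 "Max (color_of I ` {..size_of I})" "\<lambda>_. True" "\<lambda>_ _. True" "color_of I"
    by unfold_locales auto
  show "free_of I \<subseteq> {..size_of I}" by (auto simp: free_of_def free_def)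
qed simp

lemma uncolored_le: "uncolored I \<le> size_of I"
  unfolding uncolored_def using card_mono[of "{..<size_of I}" "{..<size_of I} - dom (precol_of I)"] by simp

lemma solvable_set_family:
  assumes k: "1 \<le> k" and p: "solves_set_families k p N"
    and N: "poly_bounded (hc_instances k) size_of E (\<lambda>I. N (size_of I) (m I) (free_of I))"
    and E: "\<And>I. I \<in> hc_instances k \<Longrightarrow> 1 \<le> E I" "\<And>I. I \<in> hc_instances k \<Longrightarrow> real (E I) \<le> g I"
    and m: "\<And>I. m I \<le> size_of I * size_of I"
    and me: "\<And>I s. s ''in'' = input I \<Longrightarrow> s ''n'' 0 = size_of I \<Longrightarrow> aval me s = m I"
    and vb: "\<And>I s. s ''in'' = input I \<Longrightarrow> s ''n'' 0 = size_of I \<Longrightarrow> s ''j'' 0 < m I \<Longrightarrow>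
       bval vb s \<longleftrightarrow> val I (s ''j'' 0)"
    and mb: "\<And>I s. s ''in'' = input I \<Longrightarrow> s ''n'' 0 = size_of I \<Longrightarrow> s ''j'' 0 < m I \<Longrightarrow> s ''x'' 0 < size_of I \<Longrightarrow>
       bval mb s \<longleftrightarrow> mem I (s ''j'' 0) (s ''x'' 0)"
    and ne: "\<And>I j. j < m I \<Longrightarrow> val I j \<Longrightarrow> \<exists>x<size_of I. mem I j x"
    and Q: "\<And>I. I \<in> hc_instances k \<Longrightarrow> Q I \<longleftrightarrow> (\<exists>c. set_family.ext (size_of I) k (color_of I) c \<and>
       target_of I \<le> int (set_family.score (size_of I) (m I) k (val I) (mem I) (color_of I) c))"
  shows "solvable_in_time (hc_instances k) encode Q (Ostar (hc_instances k) size_of g)"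
proof (rule solvable_in_timeI[where p = "decide me vb mb p" and E = E
      and D = "\<lambda>I. word_size k (size_of I)"
      and N = "\<lambda>I. decide_steps (size_of I) (m I) (N (size_of I) (m I) (free_of I))"])
  fix I assume I: "I \<in> hc_instances k"
  interpret set_family "size_of I" "m I" k "val I" "mem I" "color_of I"
    using set_family_color_of[OF I] .
  have Qg: "Q I \<longleftrightarrow> target_of I < 0 \<or> good (nat \<bar>target_of I\<bar>)"
    unfolding Q[OF I] good_target[OF k] ..
  have "score c \<le> size_of I * size_of I" if "ext c" for c
  proof -
    have "score c \<le> m I" using that ne by (rule score_le)
    then show ?thesis using m[of I] by simp
  qed
  moreover have "ok (word_size k (size_of I)) p (N (size_of I) (m I) free) (\<lambda>s'. s' ''out'' 0 = of_bool (good tg)) s"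
    if "env s" "s ''g'' 0 = tg" "tg \<le> 2 * (size_of I * size_of I) + 1" for s tg
    using p m[of I] set_family_axioms that unfolding solves_set_families_def by blast
  moreover have "''in'' \<notin> writes p" "''n'' \<notin> writes p" using p by (simp_all add: solves_set_families_def)
  ultimately show "ok (word_size k (size_of I)) (decide me vb mb p)
     (decide_steps (size_of I) (m I) (N (size_of I) (m I) (free_of I)))
     (\<lambda>s. s ''out'' 0 = of_bool (Q I)) (init_state (encode I))"
    unfolding Qg free_of_def
    by (intro ok_decide[OF I refl refl k m]) (simp_all only: me vb mb not_False_eq_True)
  define D where "D = word_size k (size_of I)"
  note bounds = word_size_bounds[OF k le0 le0 le0 D_def]
  have D: "2 \<le> D" "size_of I < D" "k < D" using bounds(6,7,9) by simp_all
  have "x < 2 ^ D" if "x < D" for x using that less_exp[of D] by (rule less_trans)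
  then show "bounded_state (word_size k (size_of I)) (init_state (encode I))"
    unfolding D_def[symmetric] using D by (intro bounded_init_state[OF I]) simp_all
next
  have pm: "poly_bounded (hc_instances k) size_of one_fun m"
    by (rule poly_bounded_mono[OF poly_bounded_mult[OF poly_bounded_size poly_bounded_size]]) (rule m)
  have "poly_bounded (hc_instances k) size_of one_fun (\<lambda>I. decide_steps (size_of I) (m I) 0)"
    unfolding decide_steps_def
    by (intro poly_bounded_add poly_bounded_mult poly_bounded_const poly_bounded_size pm)
  then have "poly_bounded (hc_instances k) size_of E (\<lambda>I. decide_steps (size_of I) (m I) 0 + N (size_of I) (m I) (free_of I))"
    by (rule poly_bounded_add[OF poly_bounded_weaken[OF _ E(1)] N])
  then show "poly_bounded (hc_instances k) size_of E (\<lambda>I. decide_steps (size_of I) (m I) (N (size_of I) (m I) (free_of I)))"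
    by (rule poly_bounded_mono) (simp add: decide_steps_def)
  show "poly_bounded (hc_instances k) size_of one_fun (\<lambda>I. word_size k (size_of I))"
    unfolding word_size_def
    by (intro poly_bounded_add poly_bounded_mult poly_bounded_power poly_bounded_const poly_bounded_size)
qed (use E in auto)

text \<open>Position \<open>1 + j\<close> of the input is entry \<open>j\<close> of the adjacency
  matrix, because the first number of the input is \<open>n\<close>.\<close>

definition edge_valid_test :: bexp where
  "edge_valid_test = Conj (Equal (Get ''in'' (Add (Const 1) (V ''j''))) (Const 1))
     (Less (Quot (V ''j'') (V ''n'')) (Rem (V ''j'') (V ''n'')))"

definition edge_mem_test :: bexp where
  "edge_mem_test = Neg (Conj (Neg (Equal (V ''x'') (Quot (V ''j'') (V ''n'')))) (Neg (Equal (V ''x'') (Rem (V ''j'') (V ''n'')))))"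

definition hood_mem_test :: bexp where
  "hood_mem_test = Neg (Conj (Neg (Equal (V ''x'') (V ''j'')))
     (Neg (Equal (Get ''in'' (Add (Const 1) (Add (Mul (V ''x'') (V ''n'')) (V ''j'')))) (Const 1))))"

lemma solvable_MHE:
  assumes k: "1 \<le> k" and p: "solves_set_families k p N"
    and N: "\<And>m. (\<And>I. m I \<le> size_of I * size_of I) \<Longrightarrow>
       poly_bounded (hc_instances k) size_of E (\<lambda>I. N (size_of I) (m I) (free_of I))"
    and E: "\<And>I. I \<in> hc_instances k \<Longrightarrow> 1 \<le> E I" "\<And>I. I \<in> hc_instances k \<Longrightarrow> real (E I) \<le> g I"
  shows "solvable_in_time (hc_instances k) encode (MHE k) (Ostar (hc_instances k) size_of g)"
proof (rule solvable_set_family[OF k p N E, where me = "Mul (V ''n'') (V ''n'')" and vb = edge_valid_test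
      and mb = edge_mem_test and val = edge_valid and mem = edge_mem])
  fix I :: hc_inst and s :: state
  assume s: "s ''in'' = input I" "s ''n'' 0 = size_of I" "s ''j'' 0 < size_of I * size_of I"
  let ?j = "s ''j'' 0"
  have "input I (1 + (?j div size_of I * size_of I + ?j mod size_of I)) =
      of_bool ({?j div size_of I, ?j mod size_of I} \<in> edges_of I)"
    by (rule input_edge) (rule edge_valid_lt[OF s(3)])+
  then show "bval edge_valid_test s \<longleftrightarrow> edge_valid I ?j" using s by (simp add: edge_valid_test_def edge_valid_def)
next
  fix I :: hc_inst and s :: state
  assume "s ''in'' = input I" "s ''n'' 0 = size_of I"
  then show "bval edge_mem_test s \<longleftrightarrow> edge_mem I (s ''j'' 0) (s ''x'' 0)"
    by (auto simp: edge_mem_test_def edge_mem_def)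
next
  fix I :: hc_inst and j assume "j < size_of I * size_of I"
  from edge_valid_lt(1)[OF this] show "\<exists>x<size_of I. edge_mem I j x" by (auto simp: edge_mem_def)
next
  fix I assume I: "I \<in> hc_instances k"
  have "set_family.ext (size_of I) k (color_of I) c \<longleftrightarrow> extended_full_coloring k {..<size_of I} (precol_of I) c" for c
    unfolding extended_full_coloring_iff[OF I] set_family.ext_def[OF set_family_color_of[OF I]] ..
  then show "MHE k I \<longleftrightarrow> (\<exists>c. set_family.ext (size_of I) k (color_of I) c \<and> target_of I \<le>
      int (set_family.score (size_of I) (size_of I * size_of I) k (edge_valid I) (edge_mem I) (color_of I) c))"
    using card_happy_edges[OF I] by (auto simp: MHE_def)
qed auto

lemma solvable_MHV:
  assumes k: "1 \<le> k" and p: "solves_set_families k p N"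
    and N: "\<And>m. (\<And>I. m I \<le> size_of I * size_of I) \<Longrightarrow>
       poly_bounded (hc_instances k) size_of E (\<lambda>I. N (size_of I) (m I) (free_of I))"
    and E: "\<And>I. I \<in> hc_instances k \<Longrightarrow> 1 \<le> E I" "\<And>I. I \<in> hc_instances k \<Longrightarrow> real (E I) \<le> g I"
  shows "solvable_in_time (hc_instances k) encode (MHV k) (Ostar (hc_instances k) size_of g)"
proof (rule solvable_set_family[OF k p N E, where me = "V ''n''" and vb = "Equal (Const 0) (Const 0)"
      and mb = hood_mem_test and val = "\<lambda>_ _. True" and mem = hood_mem])
  fix I :: hc_inst and s :: state
  assume s: "s ''in'' = input I" "s ''n'' 0 = size_of I" "s ''j'' 0 < size_of I" "s ''x'' 0 < size_of I"
  then show "bval hood_mem_test s \<longleftrightarrow> hood_mem I (s ''j'' 0) (s ''x'' 0)"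
    using input_edge[OF s(4,3)] by (auto simp: hood_mem_test_def hood_mem_def)
next
  fix I assume I: "I \<in> hc_instances k"
  have "set_family.ext (size_of I) k (color_of I) c \<longleftrightarrow> extended_full_coloring k {..<size_of I} (precol_of I) c" for c
    unfolding extended_full_coloring_iff[OF I] set_family.ext_def[OF set_family_color_of[OF I]] ..
  then show "MHV k I \<longleftrightarrow> (\<exists>c. set_family.ext (size_of I) k (color_of I) c \<and> target_of I \<le>
      int (set_family.score (size_of I) (size_of I) k (\<lambda>_. True) (hood_mem I) (color_of I) c))"
    using card_happy_vertices[OF I] by (auto simp: MHV_def)
qed (auto simp: hood_mem_def)

lemma poly_bounded_factor_mult:
  "poly_bounded A sz one_fun f \<Longrightarrow> poly_bounded A sz E (\<lambda>x. E x * f x)"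
  by (rule poly_bounded_mult'[OF poly_bounded_factor])

lemma poly_bounded_partition_steps:
  assumes m: "\<And>I. m I \<le> size_of I * size_of I"
  shows "poly_bounded (hc_instances k) size_of (\<lambda>I. 2 ^ uncolored I)
    (\<lambda>I. partition_steps k (size_of I) (m I) (card (free_of I)) (2 * (size_of I * size_of I) + 1) (2 ^ card (free_of I)))"
proof -
  let ?A = "hc_instances k"
  let ?E = "\<lambda>I. 2 ^ uncolored I :: nat"
  have pm: "poly_bounded ?A size_of one_fun m"
    by (rule poly_bounded_mono[OF poly_bounded_mult[OF poly_bounded_size poly_bounded_size]]) (rule m)
  have pu: "poly_bounded ?A size_of one_fun uncolored"
    by (rule poly_bounded_mono[OF poly_bounded_size]) (rule uncolored_le)
  have w: "poly_bounded ?A size_of ?E f" if "poly_bounded ?A size_of one_fun f" for f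
    by (rule poly_bounded_weaken[OF that]) simp
  have "poly_bounded ?A size_of ?E
    (\<lambda>I. partition_steps k (size_of I) (m I) (uncolored I) (2 * (size_of I * size_of I) + 1) (?E I))"
    unfolding partition_steps_def Let_def
    \<comment> \<open>The step count is affine in the exponential quantity: in every product at most
      one factor contains it, and the other factors are polynomial in the size.\<close>
    by (rule poly_bounded_add poly_bounded_factor_mult[where E = ?E] poly_bounded_mult[where E = ?E]
      poly_bounded_mult[where E = one_fun] poly_bounded_const poly_bounded_size pm pu
      w[OF poly_bounded_const] w[OF poly_bounded_size] w[OF pm] w[OF pu])+
  then show ?thesis by (rule poly_bounded_mono) (simp add: card_free_of)
qed

lemma poly_bounded_three_steps:
  assumes m: "\<And>I. m I \<le> size_of I * size_of I" and E: "\<And>I. I \<in> A \<Longrightarrow> 1 \<le> E I"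
  shows "poly_bounded A size_of E (\<lambda>I. three_steps (size_of I) (m I) (E I))"
proof -
  have pm: "poly_bounded A size_of one_fun m"
    by (rule poly_bounded_mono[OF poly_bounded_mult[OF poly_bounded_size poly_bounded_size]]) (rule m)
  have w: "poly_bounded A size_of E f" if "poly_bounded A size_of one_fun f" for f
    by (rule poly_bounded_weaken[OF that E])
  show ?thesis
    unfolding three_steps_def Let_def
    by (rule poly_bounded_add poly_bounded_factor_mult[where E = E] poly_bounded_mult[where E = E]
      poly_bounded_mult[where E = one_fun] poly_bounded_const poly_bounded_size pm
      w[OF poly_bounded_const] w[OF poly_bounded_size] w[OF pm])+
qed

theorem theorem7:
  shows "(\<forall>k\<ge>3.
            solvable_in_time (hc_instances k) encode (MHE k)
              (Ostar (hc_instances k) size_of (\<lambda>I. 2 ^ uncolored I)) \<and>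
            solvable_in_time (hc_instances k) encode (MHV k)
              (Ostar (hc_instances k) size_of (\<lambda>I. 2 ^ uncolored I))) \<and>
         solvable_in_time (hc_instances 3) encode (MHE 3)
           (Ostar (hc_instances 3) size_of (\<lambda>I. 1.89 ^ uncolored I)) \<and>
         solvable_in_time (hc_instances 3) encode (MHV 3)
           (Ostar (hc_instances 3) size_of (\<lambda>I. 1.89 ^ uncolored I))"
proof (intro conjI allI impI)
  fix k :: nat assume "3 \<le> k"
  then have k: "1 \<le> k" by simp
  note prems = solves_partition_search[OF k] poly_bounded_partition_steps
  show "solvable_in_time (hc_instances k) encode (MHE k) (Ostar (hc_instances k) size_of (\<lambda>I. 2 ^ uncolored I))"
    by (rule solvable_MHE[OF k prems]) simp_all
  show "solvable_in_time (hc_instances k) encode (MHV k) (Ostar (hc_instances k) size_of (\<lambda>I. 2 ^ uncolored I))"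
    by (rule solvable_MHV[OF k prems]) simp_all
next
  \<comment> \<open>The exponential factor is kept as the exact number of candidate sets, a natural
    number. The base 1.89 enters only through the final inequality between reals.\<close>
  let ?E = "\<lambda>I. card {S. S \<subseteq> free_of I \<and> 3 * card S \<le> card (free_of I)}"
  have E1: "1 \<le> ?E I" for I
  proof -
    have "finite {S. S \<subseteq> free_of I \<and> 3 * card S \<le> card (free_of I)}"
      by (rule finite_subset[of _ "Pow (free_of I)"]) (use finite_free_of in auto)
    \<comment> \<open>The empty set is small, so the factor never vanishes and polynomial terms can
      be absorbed into it.\<close>
    then have "card {{} :: nat set} \<le> ?E I" by (rule card_mono) simp
    then show ?thesis by simp
  qed
  have Eg: "real (?E I) \<le> 1.89 ^ uncolored I" if "I \<in> hc_instances 3" for I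
    using card_small_subsets[OF finite_free_of, of I] by (simp add: card_free_of[OF that])
  note prems = solves_three_search poly_bounded_three_steps[OF _ E1] E1 Eg
  show "solvable_in_time (hc_instances 3) encode (MHE 3) (Ostar (hc_instances 3) size_of (\<lambda>I. 1.89 ^ uncolored I))"
    by (rule solvable_MHE[OF _ prems]) simp_all
  show "solvable_in_time (hc_instances 3) encode (MHV 3) (Ostar (hc_instances 3) size_of (\<lambda>I. 1.89 ^ uncolored I))"
    by (rule solvable_MHV[OF _ prems]) simp_all
qed

end
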